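(* Let $Q_n(x)$, $L_1$, $L_2$, the phases $R(1)$, $R(2)$ and the number $x^*$ be as in the context. (a) Let $X\subset R(1)\setminus[x^*,0]$ be compact. Then, as $n\to\infty$, uniformly for $x\in X$, \[ Q_n(x)=\sqrt[12]{1-x}\,\sqrt{\frac{L_1(x)}{6\pi n^{4/3}}}\,\exp\!\left(\tfrac32 n^{2/3}L_1(x)\right)\left(1+O_X\!\left(n^{-1/3}\right)\right). \] (b) Let $X\subset R(2)$ be compact. Then, as $n\to\infty$, uniformly for $x\in X$, \[ Q_n(x)=(-1)^n\sqrt[24]{1-x^2}\,\sqrt[8]{\frac{1-x}{1+x}}\,\sqrt{\frac{L_2(x)}{6\pi n^{4/3}}}\,\exp\!\left(\tfrac32 n^{2/3}L_2(x)\right)\left(1+O_X\!\left(n^{-1/3}\right)\right). \]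
   Context: A plane partition of a positive integer $n$ is an array $(\pi_{i,j})_{i,j\ge1}$ of nonnegative integers with $\sum\pi_{i,j}=n$; its trace is $\sum_i\pi_{i,i}$. Let $pp_k(n)$ be the number of plane partitions of $n$ with trace $k$, and let $Q_n(x)=\sum_{k=1}^n pp_k(n)x^k$. Equivalently, $\prod_{m\ge1}(1-xu^m)^{-m}=1+\sum_{n\ge1}Q_n(x)u^n$. Let $Li_3(x)=\sum_{n\ge1}x^n/n^3$ be the trilogarithm. For $k\ge1$ and $|x|<1$, set $L_k(x)=\frac1k\sqrt[3]{2\,Li_3(x^k)}$, with the principal branch of the cube root. All other fractional powers and square roots are principal branches. Let $D=\{x:0<|x|<1\}$. For $m\ge1$, the phase $R(m)$ is the union of all open sets $V\subset D$ such that $\Re L_m(x)>\Re L_k(x)$ for all $x\in V$ and all $k\ne m$. It is known that $D$ contains exactly two nonempty phases, $R(1)$ and $R(2)$, whose union is dense in $D$. Their common boundary is $\{x\in D:\Re L_1(x)=\Re L_2(x)\}$, and this set contains exactly one real point $x^*\approx-0.8250030529$. Moreover $R(2)\cap\mathbb R=(-1,x^* )$. The notation $O_X(\cdot)$ means the implied constant depends only on $X$. *)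

theory Defs
  imports "HOL-Analysis.Analysis"
begin

text \<open>Rows and columns are indexed from 0, so an array is a function on all pairs of naturals.\<close>

definition is_plane_partition :: "nat \<Rightarrow> (nat \<Rightarrow> nat \<Rightarrow> nat) \<Rightarrow> bool" where
  "is_plane_partition n \<pi> \<longleftrightarrow>
     (\<forall>i j. \<pi> (Suc i) j \<le> \<pi> i j \<and> \<pi> i (Suc j) \<le> \<pi> i j) \<and>
     finite {(i, j). \<pi> i j \<noteq> 0} \<and>
     (\<Sum>(i, j) \<in> {(i, j). \<pi> i j \<noteq> 0}. \<pi> i j) = n"

definition pp_trace :: "(nat \<Rightarrow> nat \<Rightarrow> nat) \<Rightarrow> nat" where
  "pp_trace \<pi> = (\<Sum>i \<in> {i. \<pi> i i \<noteq> 0}. \<pi> i i)"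

definition pp :: "nat \<Rightarrow> nat \<Rightarrow> nat" where
  "pp k n = card {\<pi>. is_plane_partition n \<pi> \<and> pp_trace \<pi> = k}"

definition Q :: "nat \<Rightarrow> complex \<Rightarrow> complex" where
  "Q n x = (\<Sum>k = 1..n. of_nat (pp k n) * x ^ k)"

definition Li3 :: "complex \<Rightarrow> complex" where
  "Li3 x = (\<Sum>n. x ^ Suc n / of_nat (Suc n) ^ 3)"

text \<open>On the complex numbers, \<open>powr\<close> is defined through the principal logarithm
  (imaginary part in the half-open interval from \<open>-\<pi>\<close>, excluded, to \<open>\<pi>\<close>, included),
  so it gives the principal branch of every root below.\<close>

definition L :: "nat \<Rightarrow> complex \<Rightarrow> complex" where
  "L k x = (2 * Li3 (x ^ k)) powr (1 / 3) / of_nat k"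

definition punctured_disk :: "complex set" where
  "punctured_disk = {x. 0 < norm x \<and> norm x < 1}"

definition phase :: "nat \<Rightarrow> complex set" where
  "phase m = \<Union> {V. open V \<and> V \<subseteq> punctured_disk \<and>
     (\<forall>x \<in> V. \<forall>k. k \<ge> 1 \<and> k \<noteq> m \<longrightarrow> Re (L m x) > Re (L k x))}"

text \<open>There is exactly one such point: for \<open>0 < r < 1\<close> one has \<open>Re (L 1 r) > Re (L 2 r)\<close>, while
  equality at \<open>-r\<close> means \<open>-Li3 (-r) / r = Li3 (r\<^sup>2) / r\<close>, whose left side decreases and whose
  right side increases in \<open>r\<close>. Its value is approximately \<open>-0.8250030529\<close>.\<close>

definition xstar :: real where
  "xstar = (THE r. complex_of_real r \<in> punctured_disk \<and>
     Re (L 1 (complex_of_real r)) = Re (L 2 (complex_of_real r)))"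

end

theory Submission
  imports Defs "HOL-Probability.Probability" "HOL-Complex_Analysis.Complex_Analysis"
begin

text \<open>The diagonals of a plane partition form two chains of interlacing partitions with a common
  start. Hence the trace generating function is a Cauchy sum of Schur functions, and the
  Cauchy identity (proved by commuting the operators that add and remove horizontal strips) gives
  \<open>1 + \<Sum>n. Q n x u^n = exp (\<Sum>k\<ge>1. x^k / k * u^k / (1 - u^k)\<^sup>2)\<close>.

  Since \<open>\<bar>x\<bar> < 1\<close>, the exponent converges geometrically, so the circle method needs no Farey
  dissection. Near a primitive \<open>q\<close>-th root of unity, with \<open>u\<close> replaced by the root times
  \<open>exp (- s)\<close>, the exponent is \<open>(L q x)\<^sup>3 / (2 s\<^sup>2)\<close> up to terms of smaller order, so on the
  circle \<open>Re s = Re (L m x) / n^(1/3)\<close> its real part is at most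
  \<open>n^(2/3) (Re (L q x))\<^sup>3 / (2 (Re (L m x))\<^sup>2)\<close>. In phase \<open>m\<close> this is smaller for every
  \<open>q \<noteq> m\<close>, so the saddle point \<open>s = L m x / n^(1/3)\<close> at the root \<open>1\<close> (for \<open>m = 1\<close>) or
  \<open>-1\<close> (for \<open>m = 2\<close>) dominates, and a Gaussian integral there gives the asymptotics.\<close>

section \<open>Interlacing partitions\<close>

definition fin_supp :: "(nat \<Rightarrow> nat) \<Rightarrow> bool" where
  "fin_supp \<mu> \<longleftrightarrow> (\<exists>M. \<forall>i\<ge>M. \<mu> i = 0)"

definition psize :: "(nat \<Rightarrow> nat) \<Rightarrow> nat" where
  "psize \<mu> = sum \<mu> {i. \<mu> i \<noteq> 0}"

definition interlaces :: "(nat \<Rightarrow> nat) \<Rightarrow> (nat \<Rightarrow> nat) \<Rightarrow> bool" (infix "\<rhd>" 50) where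
  "\<rho> \<rhd> \<mu> \<longleftrightarrow> fin_supp \<rho> \<and> (\<forall>i. \<mu> i \<le> \<rho> i \<and> \<rho> (Suc i) \<le> \<mu> i)"

lemma psize_eq_sum_lessThan: "(\<And>i. i \<ge> M \<Longrightarrow> \<mu> i = 0) \<Longrightarrow> psize \<mu> = sum \<mu> {..<M}"
  unfolding psize_def by (rule sum.mono_neutral_left) (auto, metis neq0_conv not_less)

lemma psize_zero [simp]: "psize (\<lambda>_. 0) = 0"
  by (simp add: psize_def)

lemma interlaces_bounds:
  assumes "\<rho> \<rhd> \<mu>"
  shows "\<mu> i \<le> \<rho> i" "\<rho> (Suc i) \<le> \<mu> i"
  using assms by (auto simp: interlaces_def)

lemma fin_supp_interlaces:
  assumes "\<rho> \<rhd> \<mu>"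
  shows "fin_supp \<rho>" "fin_supp \<mu>"
  using assms by (auto simp: interlaces_def fin_supp_def) (metis le_zero_eq)

lemma fin_supp_obtain_common_bound:
  assumes "fin_supp \<mu>" "fin_supp \<nu>"
  obtains M where "\<And>i. i \<ge> M \<Longrightarrow> \<mu> i = 0" "\<And>i. i \<ge> M \<Longrightarrow> \<nu> i = 0"
  using assms unfolding fin_supp_def by (metis max.bounded_iff)

lemma interlaces_zero_left_iff: "(\<lambda>_. 0) \<rhd> \<mu> \<longleftrightarrow> \<mu> = (\<lambda>_. 0)"
  by (auto simp: interlaces_def fin_supp_def fun_eq_iff)

lemma psize_mono_interlaces:
  assumes "\<rho> \<rhd> \<mu>"
  shows "psize \<mu> \<le> psize \<rho>"
proof -
  obtain M where "\<And>i. i \<ge> M \<Longrightarrow> \<rho> i = 0" "\<And>i. i \<ge> M \<Longrightarrow> \<mu> i = 0"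
    using fin_supp_obtain_common_bound fin_supp_interlaces[OF assms] by metis
  thus ?thesis
    using interlaces_bounds(1)[OF assms] by (simp add: psize_eq_sum_lessThan[of M] sum_mono)
qed

text \<open>If \<open>\<mu>\<close> and \<open>\<nu>\<close> both interlace with \<open>\<kappa>\<close> below and with \<open>\<rho>\<close> above, the entries
  \<open>\<rho> (Suc i)\<close> and \<open>\<kappa> i\<close> range over the same interval from \<open>max (\<mu> (Suc i)) (\<nu> (Suc i))\<close> to
  \<open>min (\<mu> i) (\<nu> i)\<close>, and the toggle exchanges them by reflecting it. The entry \<open>\<rho> 0\<close> is only
  bounded below, which accounts for the additional natural number.\<close>

definition toggle ::
    "(nat \<Rightarrow> nat) \<Rightarrow> (nat \<Rightarrow> nat) \<Rightarrow> (nat \<Rightarrow> nat) \<times> nat \<Rightarrow> nat \<Rightarrow> nat" where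
  "toggle \<mu> \<nu> = (\<lambda>(\<kappa>, a) i. case i of 0 \<Rightarrow> max (\<mu> 0) (\<nu> 0) + a
      | Suc j \<Rightarrow> min (\<mu> j) (\<nu> j) + max (\<mu> (Suc j)) (\<nu> (Suc j)) - \<kappa> j)"

definition untoggle ::
    "(nat \<Rightarrow> nat) \<Rightarrow> (nat \<Rightarrow> nat) \<Rightarrow> (nat \<Rightarrow> nat) \<Rightarrow> (nat \<Rightarrow> nat) \<times> nat" where
  "untoggle \<mu> \<nu> \<rho> = (\<lambda>i. min (\<mu> i) (\<nu> i) + max (\<mu> (Suc i)) (\<nu> (Suc i)) - \<rho> (Suc i),
     \<rho> 0 - max (\<mu> 0) (\<nu> 0))"

lemma toggle_0: "toggle \<mu> \<nu> (\<kappa>, a) 0 = max (\<mu> 0) (\<nu> 0) + a"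
  and toggle_Suc: "toggle \<mu> \<nu> (\<kappa>, a) (Suc j)
    = min (\<mu> j) (\<nu> j) + max (\<mu> (Suc j)) (\<nu> (Suc j)) - \<kappa> j"
  by (simp_all add: toggle_def)

lemma toggle_commute: "toggle \<mu> \<nu> = toggle \<nu> \<mu>"
  by (simp add: toggle_def max.commute min.commute fun_eq_iff split: nat.split)

lemma untoggle_commute: "untoggle \<mu> \<nu> = untoggle \<nu> \<mu>"
  by (simp add: untoggle_def max.commute min.commute fun_eq_iff)

lemma toggle_Suc_add:
  assumes "\<mu> \<rhd> \<kappa>" "\<nu> \<rhd> \<kappa>"
  shows "toggle \<mu> \<nu> (\<kappa>, a) (Suc i) + \<kappa> i = min (\<mu> i) (\<nu> i) + max (\<mu> (Suc i)) (\<nu> (Suc i))"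
  using interlaces_bounds[OF assms(1), of i] interlaces_bounds[OF assms(2), of i]
  by (simp add: toggle_Suc)

lemma interlaces_toggle:
  assumes "\<mu> \<rhd> \<kappa>" "\<nu> \<rhd> \<kappa>"
  shows "toggle \<mu> \<nu> (\<kappa>, a) \<rhd> \<mu>"
proof -
  note bounds = interlaces_bounds[OF assms(1)] interlaces_bounds[OF assms(2)]
  obtain M where M: "\<And>i. i \<ge> M \<Longrightarrow> \<mu> i = 0" "\<And>i. i \<ge> M \<Longrightarrow> \<nu> i = 0"
    using fin_supp_obtain_common_bound fin_supp_interlaces(1) assms by metis
  have "toggle \<mu> \<nu> (\<kappa>, a) i = 0" if "i \<ge> Suc M" for i
    using that M by (cases i) (auto simp: toggle_def)
  hence "fin_supp (toggle \<mu> \<nu> (\<kappa>, a))"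
    unfolding fin_supp_def by blast
  moreover have "\<mu> i \<le> toggle \<mu> \<nu> (\<kappa>, a) i \<and> toggle \<mu> \<nu> (\<kappa>, a) (Suc i) \<le> \<mu> i" for i
    using bounds[of i] bounds[of "i - 1"] by (cases i) (auto simp: toggle_def)
  ultimately show ?thesis
    by (simp add: interlaces_def)
qed

lemma interlaces_untoggle:
  assumes "\<rho> \<rhd> \<mu>" "\<rho> \<rhd> \<nu>"
  shows "\<mu> \<rhd> fst (untoggle \<mu> \<nu> \<rho>)"
proof -
  note bounds = interlaces_bounds[OF assms(1)] interlaces_bounds[OF assms(2)]
  have "fst (untoggle \<mu> \<nu> \<rho>) i \<le> \<mu> i \<and> \<mu> (Suc i) \<le> fst (untoggle \<mu> \<nu> \<rho>) i" for i
    using bounds[of i] bounds[of "Suc i"] by (auto simp: untoggle_def)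
  thus ?thesis
    using fin_supp_interlaces[OF assms(1)] by (simp add: interlaces_def)
qed

lemma untoggle_toggle:
  assumes "\<mu> \<rhd> \<kappa>" "\<nu> \<rhd> \<kappa>"
  shows "untoggle \<mu> \<nu> (toggle \<mu> \<nu> (\<kappa>, a)) = (\<kappa>, a)"
proof -
  have "min (\<mu> i) (\<nu> i) + max (\<mu> (Suc i)) (\<nu> (Suc i)) - toggle \<mu> \<nu> (\<kappa>, a) (Suc i) = \<kappa> i" for i
    using toggle_Suc_add[OF assms, of a i] by linarith
  thus ?thesis
    by (simp add: untoggle_def toggle_0)
qed

lemma toggle_untoggle:
  assumes "\<rho> \<rhd> \<mu>" "\<rho> \<rhd> \<nu>"
  shows "toggle \<mu> \<nu> (untoggle \<mu> \<nu> \<rho>) = \<rho>"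
proof
  note bounds = interlaces_bounds[OF assms(1)] interlaces_bounds[OF assms(2)]
  fix i
  show "toggle \<mu> \<nu> (untoggle \<mu> \<nu> \<rho>) i = \<rho> i"
  proof (cases i)
    case 0
    thus ?thesis using bounds[of 0] by (simp add: untoggle_def toggle_0)
  next
    case (Suc j)
    have "\<rho> (Suc j) \<le> min (\<mu> j) (\<nu> j) + max (\<mu> (Suc j)) (\<nu> (Suc j))"
      using bounds[of j] by linarith
    thus ?thesis using Suc by (simp add: untoggle_def toggle_Suc)
  qed
qed

lemma bij_betw_toggle:
  "bij_betw (toggle \<mu> \<nu>) ({\<kappa>. \<mu> \<rhd> \<kappa> \<and> \<nu> \<rhd> \<kappa>} \<times> UNIV) {\<rho>. \<rho> \<rhd> \<mu> \<and> \<rho> \<rhd> \<nu>}"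
proof (rule bij_betw_byWitness[where f' = "untoggle \<mu> \<nu>"])
  show "\<forall>p\<in>{\<kappa>. \<mu> \<rhd> \<kappa> \<and> \<nu> \<rhd> \<kappa>} \<times> UNIV. untoggle \<mu> \<nu> (toggle \<mu> \<nu> p) = p"
    using untoggle_toggle by auto
  show "\<forall>\<rho>\<in>{\<rho>. \<rho> \<rhd> \<mu> \<and> \<rho> \<rhd> \<nu>}. toggle \<mu> \<nu> (untoggle \<mu> \<nu> \<rho>) = \<rho>"
    using toggle_untoggle by auto
  show "toggle \<mu> \<nu> ` ({\<kappa>. \<mu> \<rhd> \<kappa> \<and> \<nu> \<rhd> \<kappa>} \<times> UNIV) \<subseteq> {\<rho>. \<rho> \<rhd> \<mu> \<and> \<rho> \<rhd> \<nu>}"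
    using interlaces_toggle[of \<mu> _ \<nu>] interlaces_toggle[of \<nu> _ \<mu>]
    by (auto simp: toggle_commute[of \<nu> \<mu>])
  have "fst (untoggle \<mu> \<nu> \<rho>) \<in> {\<kappa>. \<mu> \<rhd> \<kappa> \<and> \<nu> \<rhd> \<kappa>}" if "\<rho> \<rhd> \<mu>" "\<rho> \<rhd> \<nu>" for \<rho>
    using interlaces_untoggle[OF that] interlaces_untoggle[OF that(2,1)]
    by (simp add: untoggle_commute[of \<nu> \<mu>])
  thus "untoggle \<mu> \<nu> ` {\<rho>. \<rho> \<rhd> \<mu> \<and> \<rho> \<rhd> \<nu>} \<subseteq> {\<kappa>. \<mu> \<rhd> \<kappa> \<and> \<nu> \<rhd> \<kappa>} \<times> UNIV"
    by (simp add: image_subset_iff mem_Times_iff)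
qed

lemma psize_toggle:
  assumes "\<mu> \<rhd> \<kappa>" "\<nu> \<rhd> \<kappa>"
  shows "psize (toggle \<mu> \<nu> (\<kappa>, a)) + psize \<kappa> = psize \<mu> + psize \<nu> + a"
proof -
  let ?\<rho> = "toggle \<mu> \<nu> (\<kappa>, a)"
  obtain M where M: "\<And>i. i \<ge> M \<Longrightarrow> \<mu> i = 0" "\<And>i. i \<ge> M \<Longrightarrow> \<nu> i = 0"
    using fin_supp_obtain_common_bound fin_supp_interlaces(1) assms by metis
  have "?\<rho> i = 0" if "i \<ge> Suc M" for i
    using that M by (cases i) (auto simp: toggle_def)
  hence "psize ?\<rho> = sum ?\<rho> {..<Suc M}"
    by (rule psize_eq_sum_lessThan)
  moreover have "\<kappa> i = 0" if "i \<ge> M" for i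
    using M(1)[OF that] interlaces_bounds(1)[OF assms(1), of i] by simp
  hence "psize \<kappa> = sum \<kappa> {..<M}"
    by (rule psize_eq_sum_lessThan)
  ultimately have "psize ?\<rho> + psize \<kappa> = ?\<rho> 0 + (\<Sum>i<M. ?\<rho> (Suc i) + \<kappa> i)"
    by (simp add: sum.lessThan_Suc_shift sum.distrib del: sum.lessThan_Suc)
  also have "\<dots> = a + (\<Sum>i<M. min (\<mu> i) (\<nu> i)) + (\<Sum>i<Suc M. max (\<mu> i) (\<nu> i))"
    by (simp add: toggle_Suc_add[OF assms] sum.lessThan_Suc_shift sum.distrib toggle_0
        del: sum.lessThan_Suc)
  also have "\<dots> = a + (\<Sum>i<M. min (\<mu> i) (\<nu> i) + max (\<mu> i) (\<nu> i))"
    using M by (simp add: sum.distrib)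
  also have "\<dots> = a + (\<Sum>i<M. \<mu> i + \<nu> i)"
    by (simp add: min_def max_def add.commute if_distrib cong: if_cong)
  finally show ?thesis
    using M by (simp add: psize_eq_sum_lessThan[of M] sum.distrib)
qed

section \<open>Sums over arbitrary types\<close>

abbreviation nsum :: "('a \<Rightarrow> ennreal) \<Rightarrow> ennreal" where
  "nsum f \<equiv> integral\<^sup>N (count_space UNIV) f"

lemma nsum_prod: "nsum f = nsum (\<lambda>x. nsum (\<lambda>y. f (x, y)))"
  by (rule nn_integral_fst_count_space[symmetric])

lemma nsum_swap: "nsum (\<lambda>x. nsum (\<lambda>y. f x y)) = nsum (\<lambda>y. nsum (\<lambda>x. f x y))"
  using nn_integral_fst_count_space[of "\<lambda>(x, y). f x y"]
    nn_integral_snd_count_space[of "\<lambda>(x, y). f x y"]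
  by simp

lemma nsum_cmult: "nsum (\<lambda>x. c * f x) = c * nsum f"
  by (rule nn_integral_cmult) simp

lemma nsum_multc: "nsum (\<lambda>x. f x * c) = nsum f * c"
  by (rule nn_integral_multc) simp

lemma nsum_if_cmult: "(if P then c * nsum f else 0) = nsum (\<lambda>x. if P then c * f x else 0)"
  by (simp add: nsum_cmult)

lemma nsum_restrict: "nsum (\<lambda>x. if x \<in> A then f x else 0) = integral\<^sup>N (count_space A) f"
  by (subst nn_integral_count_space_indicator)
     (auto intro!: nn_integral_cong split: split_indicator)

lemma nsum_reindex:
  assumes "bij_betw g A B"
  shows "nsum (\<lambda>x. if x \<in> B then f x else 0) = nsum (\<lambda>x. if x \<in> A then f (g x) else 0)"
  using nn_integral_bij_count_space[OF assms, of f] by (simp add: nsum_restrict)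

lemma nsum_delta: "nsum (\<lambda>x. if x = a then f x else 0) = f a"
  using nsum_restrict[of "{a}" f] by (simp add: nn_integral_count_space_finite)

section \<open>Horizontal strips and the Cauchy identity\<close>

definition add_strip :: "ennreal \<Rightarrow> ((nat \<Rightarrow> nat) \<Rightarrow> ennreal) \<Rightarrow> (nat \<Rightarrow> nat) \<Rightarrow> ennreal" where
  "add_strip y f \<rho> = nsum (\<lambda>\<mu>. if \<rho> \<rhd> \<mu> then y ^ (psize \<rho> - psize \<mu>) * f \<mu> else 0)"

definition rem_strip :: "ennreal \<Rightarrow> ((nat \<Rightarrow> nat) \<Rightarrow> ennreal) \<Rightarrow> (nat \<Rightarrow> nat) \<Rightarrow> ennreal" where
  "rem_strip z f \<mu> = nsum (\<lambda>\<rho>. if \<rho> \<rhd> \<mu> then z ^ (psize \<rho> - psize \<mu>) * f \<rho> else 0)"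

definition geo :: "ennreal \<Rightarrow> ennreal" where
  "geo w = nsum (\<lambda>a::nat. w ^ a)"

lemma add_strip_cmult: "add_strip y (\<lambda>\<mu>. c * f \<mu>) \<rho> = c * add_strip y f \<rho>"
  unfolding add_strip_def
  by (subst nsum_cmult[symmetric]) (intro nn_integral_cong, auto simp: mult_ac)

lemma strip_weight_toggle:
  fixes y z :: ennreal and a :: nat
  assumes "\<mu> \<rhd> \<kappa>" "\<nu> \<rhd> \<kappa>"
  defines "\<rho> \<equiv> toggle \<mu> \<nu> (\<kappa>, a)"
  shows "z ^ (psize \<rho> - psize \<mu>) * y ^ (psize \<rho> - psize \<nu>)
    = (y * z) ^ a * (y ^ (psize \<mu> - psize \<kappa>) * z ^ (psize \<nu> - psize \<kappa>))"
proof -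
  have "psize \<rho> - psize \<mu> = a + (psize \<nu> - psize \<kappa>)" "psize \<rho> - psize \<nu> = a + (psize \<mu> - psize \<kappa>)"
    using psize_toggle[OF assms(1,2), of a] assms(1,2)[THEN psize_mono_interlaces]
    unfolding \<rho>_def by linarith+
  thus ?thesis by (simp add: power_add power_mult_distrib mult_ac)
qed

lemma strip_exchange:
  "nsum (\<lambda>\<rho>. if \<rho> \<rhd> \<mu> \<and> \<rho> \<rhd> \<nu> then z ^ (psize \<rho> - psize \<mu>) * y ^ (psize \<rho> - psize \<nu>) else 0)
   = geo (y * z) * nsum (\<lambda>\<kappa>. if \<mu> \<rhd> \<kappa> \<and> \<nu> \<rhd> \<kappa>
       then y ^ (psize \<mu> - psize \<kappa>) * z ^ (psize \<nu> - psize \<kappa>) else 0)"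
  (is "nsum ?upper = geo _ * nsum ?lower")
proof -
  have "nsum ?upper = nsum (\<lambda>p. if p \<in> {\<kappa>. \<mu> \<rhd> \<kappa> \<and> \<nu> \<rhd> \<kappa>} \<times> UNIV
      then z ^ (psize (toggle \<mu> \<nu> p) - psize \<mu>) * y ^ (psize (toggle \<mu> \<nu> p) - psize \<nu>) else 0)"
    using nsum_reindex[OF bij_betw_toggle[of \<mu> \<nu>]] by simp
  also have "\<dots> = nsum (\<lambda>\<kappa>. nsum (\<lambda>a. (y * z) ^ a * ?lower \<kappa>))"
    by (subst nsum_prod, intro nn_integral_cong) (auto simp: strip_weight_toggle)
  finally show ?thesis
    by (simp only: nsum_multc nsum_cmult geo_def)
qed

lemma strip_commute: "rem_strip z (add_strip y f) \<mu> = geo (y * z) * add_strip y (rem_strip z f) \<mu>"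
proof -
  let ?upper = "\<lambda>\<rho> \<nu>. if \<rho> \<rhd> \<mu> \<and> \<rho> \<rhd> \<nu>
      then z ^ (psize \<rho> - psize \<mu>) * y ^ (psize \<rho> - psize \<nu>) else 0"
  let ?lower = "\<lambda>\<kappa> \<nu>. if \<mu> \<rhd> \<kappa> \<and> \<nu> \<rhd> \<kappa>
      then y ^ (psize \<mu> - psize \<kappa>) * z ^ (psize \<nu> - psize \<kappa>) else 0"
  have "rem_strip z (add_strip y f) \<mu> = nsum (\<lambda>\<rho>. nsum (\<lambda>\<nu>. ?upper \<rho> \<nu> * f \<nu>))"
    unfolding rem_strip_def add_strip_def nsum_if_cmult
    by (intro nn_integral_cong) (auto simp: mult_ac)
  also have "\<dots> = nsum (\<lambda>\<nu>. nsum (\<lambda>\<rho>. ?upper \<rho> \<nu>) * f \<nu>)"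
    by (subst nsum_swap) (simp only: nsum_multc)
  also have "\<dots> = geo (y * z) * nsum (\<lambda>\<nu>. nsum (\<lambda>\<kappa>. ?lower \<kappa> \<nu> * f \<nu>))"
    by (simp only: strip_exchange nsum_multc nsum_cmult mult.assoc)
  also have "nsum (\<lambda>\<nu>. nsum (\<lambda>\<kappa>. ?lower \<kappa> \<nu> * f \<nu>)) = add_strip y (rem_strip z f) \<mu>"
    unfolding rem_strip_def add_strip_def nsum_if_cmult
    by (subst nsum_swap, intro nn_integral_cong) (auto simp: mult_ac)
  finally show ?thesis .
qed

lemma strip_adjoint: "nsum (\<lambda>\<rho>. add_strip z f \<rho> * g \<rho>) = nsum (\<lambda>\<mu>. f \<mu> * rem_strip z g \<mu>)"
proof -
  let ?t = "\<lambda>\<rho> \<mu>. if \<rho> \<rhd> \<mu> then z ^ (psize \<rho> - psize \<mu>) * f \<mu> * g \<rho> else 0"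
  have "nsum (\<lambda>\<rho>. add_strip z f \<rho> * g \<rho>) = nsum (\<lambda>\<rho>. nsum (\<lambda>\<mu>. ?t \<rho> \<mu>))"
    unfolding add_strip_def by (subst nsum_multc[symmetric]) (intro nn_integral_cong, auto)
  also have "\<dots> = nsum (\<lambda>\<mu>. nsum (\<lambda>\<rho>. ?t \<rho> \<mu>))"
    by (rule nsum_swap)
  also have "\<dots> = nsum (\<lambda>\<mu>. f \<mu> * rem_strip z g \<mu>)"
    unfolding rem_strip_def
    by (subst nsum_cmult[symmetric]) (intro nn_integral_cong, auto simp: mult_ac)
  finally show ?thesis .
qed

primrec schur :: "ennreal list \<Rightarrow> (nat \<Rightarrow> nat) \<Rightarrow> ennreal" where
  "schur [] = (\<lambda>\<rho>. if \<rho> = (\<lambda>_. 0) then 1 else 0)"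
| "schur (y # ys) = add_strip y (schur ys)"

lemma rem_strip_schur: "rem_strip z (schur ys) \<mu> = (\<Prod>y\<leftarrow>ys. geo (y * z)) * schur ys \<mu>"
proof (induction ys arbitrary: \<mu>)
  case Nil
  have "rem_strip z (schur []) \<mu>
      = nsum (\<lambda>\<rho>::nat \<Rightarrow> nat. if \<rho> = (\<lambda>_. 0) then schur [] \<mu> else 0)"
    unfolding rem_strip_def by (intro nn_integral_cong) (auto simp: interlaces_zero_left_iff)
  thus ?case
    by (subst (asm) nsum_delta) simp
next
  case (Cons y ys)
  have "rem_strip z (schur ys) = (\<lambda>\<mu>. (\<Prod>y\<leftarrow>ys. geo (y * z)) * schur ys \<mu>)"
    using Cons by blast
  thus ?case
    by (simp add: strip_commute add_strip_cmult mult.assoc)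
qed

lemma schur_zero: "schur ys (\<lambda>_. 0) = 1"
proof (induction ys)
  case (Cons y ys)
  have "add_strip y (schur ys) (\<lambda>_. 0) = nsum (\<lambda>\<mu>::nat \<Rightarrow> nat. if \<mu> = (\<lambda>_. 0) then 1 else 0)"
    unfolding add_strip_def
    by (intro nn_integral_cong) (auto simp: interlaces_zero_left_iff Cons)
  thus ?case by (simp add: nsum_delta)
qed simp

theorem cauchy_identity:
  "nsum (\<lambda>\<rho>. schur zs \<rho> * schur ys \<rho>) = (\<Prod>z\<leftarrow>zs. \<Prod>y\<leftarrow>ys. geo (y * z))"
proof (induction zs)
  case Nil
  have "nsum (\<lambda>\<rho>. schur [] \<rho> * schur ys \<rho>) = nsum (\<lambda>\<rho>. if \<rho> = (\<lambda>_. 0) then schur ys \<rho> else 0)"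
    by (intro nn_integral_cong) auto
  thus ?case by (simp add: nsum_delta schur_zero)
next
  case (Cons z zs)
  have "nsum (\<lambda>\<rho>. schur (z # zs) \<rho> * schur ys \<rho>)
      = nsum (\<lambda>\<mu>. (\<Prod>y\<leftarrow>ys. geo (y * z)) * (schur zs \<mu> * schur ys \<mu>))"
    unfolding schur.simps strip_adjoint rem_strip_schur by (simp only: mult_ac)
  thus ?case
    by (simp only: nsum_cmult Cons list.map prod_list.Cons)
qed

lemma schur_scale: "schur (map ((*) t) ys) \<rho> = t ^ psize \<rho> * schur ys \<rho>"
proof (induction ys arbitrary: \<rho>)
  case (Cons y ys)
  have "add_strip (t * y) (schur (map ((*) t) ys)) \<rho>
      = nsum (\<lambda>\<mu>. t ^ psize \<rho> * (if \<rho> \<rhd> \<mu> then y ^ (psize \<rho> - psize \<mu>) * schur ys \<mu> else 0))"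
    unfolding add_strip_def
  proof (intro nn_integral_cong)
    fix \<mu>
    have "t ^ psize \<rho> = t ^ (psize \<rho> - psize \<mu>) * t ^ psize \<mu>" if "\<rho> \<rhd> \<mu>"
      using psize_mono_interlaces[OF that] by (simp add: power_add[symmetric])
    thus "(if \<rho> \<rhd> \<mu> then (t * y) ^ (psize \<rho> - psize \<mu>) * schur (map ((*) t) ys) \<mu> else 0)
       = t ^ psize \<rho> * (if \<rho> \<rhd> \<mu> then y ^ (psize \<rho> - psize \<mu>) * schur ys \<mu> else 0)"
      by (auto simp: Cons power_mult_distrib mult_ac)
  qed
  thus ?case by (simp add: nsum_cmult add_strip_def)
qed simp

section \<open>Plane partitions as pairs of chains\<close>

definition chain :: "nat \<Rightarrow> (nat \<Rightarrow> nat \<Rightarrow> nat) \<Rightarrow> bool" where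
  "chain N c \<longleftrightarrow> (\<forall>d. c d \<rhd> c (Suc d)) \<and> (\<forall>d\<ge>N. c d = (\<lambda>_. 0))"

definition tail_size :: "nat \<Rightarrow> (nat \<Rightarrow> nat \<Rightarrow> nat) \<Rightarrow> nat" where
  "tail_size N c = (\<Sum>d<N. psize (c (Suc d)))"

lemma chain_0_iff: "chain 0 c \<longleftrightarrow> c = (\<lambda>_ _. 0)"
  by (auto simp: chain_def fun_eq_iff interlaces_def fin_supp_def)

lemma chain_Suc_case_nat: "chain (Suc N) (case_nat \<rho> c) \<longleftrightarrow> chain N c \<and> \<rho> \<rhd> c 0"
proof -
  have "(\<forall>d. case_nat \<rho> c d \<rhd> c d) \<longleftrightarrow> \<rho> \<rhd> c 0 \<and> (\<forall>d. c d \<rhd> c (Suc d))"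
    by (auto split: nat.split)
  moreover have "(\<forall>d\<ge>Suc N. case_nat \<rho> c d = (\<lambda>_. 0)) \<longleftrightarrow> (\<forall>d\<ge>N. c d = (\<lambda>_. 0))"
    by (metis Suc_le_D Suc_le_mono nat.case(2))
  ultimately show ?thesis by (auto simp: chain_def)
qed

lemma tail_size_case_nat: "tail_size (Suc N) (case_nat \<rho> c) = psize (c 0) + tail_size N c"
  by (simp add: tail_size_def sum.lessThan_Suc_shift del: sum.lessThan_Suc)

lemma bij_betw_case_nat_chain:
  "bij_betw (case_nat \<rho>) {c. chain N c \<and> \<rho> \<rhd> c 0} {c. chain (Suc N) c \<and> c 0 = \<rho>}"
proof (rule bij_betw_byWitness[where f' = "\<lambda>c d. c (Suc d)"])
  show "\<forall>c\<in>{c. chain (Suc N) c \<and> c 0 = \<rho>}. case_nat \<rho> (\<lambda>d. c (Suc d)) = c"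
    by (auto simp: fun_eq_iff split: nat.split)
  thus "(\<lambda>c d. c (Suc d)) ` {c. chain (Suc N) c \<and> c 0 = \<rho>} \<subseteq> {c. chain N c \<and> \<rho> \<rhd> c 0}"
    using chain_Suc_case_nat[of N \<rho>] by (auto simp: chain_def)
qed (auto simp: chain_Suc_case_nat)

abbreviation powers :: "ennreal \<Rightarrow> nat \<Rightarrow> ennreal list" where
  "powers u N \<equiv> map (\<lambda>i. u ^ i) [0..<N]"

lemma chain_nsum:
  "nsum (\<lambda>c. if chain N c \<and> c 0 = \<rho> then u ^ tail_size N c else 0)
   = schur (powers u N) \<rho>"
proof (induction N arbitrary: \<rho>)
  case 0
  have "nsum (\<lambda>c. if chain 0 c \<and> c 0 = \<rho> then u ^ tail_size 0 c else 0)
     = nsum (\<lambda>c::nat \<Rightarrow> nat \<Rightarrow> nat. if c = (\<lambda>_ _. 0) then schur [] \<rho> else 0)"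
    by (intro nn_integral_cong) (auto simp: chain_0_iff tail_size_def)
  thus ?case
    by (subst (asm) nsum_delta) simp
next
  case (Suc N)
  let ?wt = "\<lambda>\<mu> c. if chain N c \<and> c 0 = \<mu> then u ^ tail_size N c else 0"
  let ?step = "\<lambda>\<mu>. if \<rho> \<rhd> \<mu> then u ^ psize \<mu> else 0"
  have "nsum (\<lambda>c. if chain (Suc N) c \<and> c 0 = \<rho> then u ^ tail_size (Suc N) c else 0)
     = nsum (\<lambda>c. if chain N c \<and> \<rho> \<rhd> c 0 then u ^ tail_size (Suc N) (case_nat \<rho> c) else 0)"
    using nsum_reindex[OF bij_betw_case_nat_chain[of \<rho> N], of "\<lambda>c. u ^ tail_size (Suc N) c"]
    by simp
  also have "\<dots> = nsum (\<lambda>c. nsum (\<lambda>\<mu>. if \<mu> = c 0 then ?step \<mu> * ?wt \<mu> c else 0))"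
    by (subst nsum_delta, intro nn_integral_cong) (auto simp: tail_size_case_nat power_add)
  also have "\<dots> = nsum (\<lambda>\<mu>. nsum (\<lambda>c. ?step \<mu> * ?wt \<mu> c))"
    by (subst nsum_swap, intro nn_integral_cong) auto
  also have "\<dots> = nsum (\<lambda>\<mu>. ?step \<mu> * schur (powers u N) \<mu>)"
    by (simp only: nsum_cmult Suc)
  also have "\<dots> = schur (1 # map ((*) u) (powers u N)) \<rho>"
    unfolding schur.simps add_strip_def schur_scale by (intro nn_integral_cong) auto
  also have "1 # map ((*) u) (powers u N) = powers u (Suc N)"
    by (subst map_upt_Suc) (auto simp: map_map o_def)
  finally show ?case .
qed

definition plane_part :: "(nat \<Rightarrow> nat \<Rightarrow> nat) \<Rightarrow> bool" where
  "plane_part p \<longleftrightarrow>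
     (\<forall>i j. p (Suc i) j \<le> p i j \<and> p i (Suc j) \<le> p i j) \<and> finite {(i, j). p i j \<noteq> 0}"

definition pp_size :: "(nat \<Rightarrow> nat \<Rightarrow> nat) \<Rightarrow> nat" where
  "pp_size p = (\<Sum>(i, j) \<in> {(i, j). p i j \<noteq> 0}. p i j)"

definition band :: "nat \<Rightarrow> (nat \<Rightarrow> nat \<Rightarrow> nat) \<Rightarrow> bool" where
  "band N p \<longleftrightarrow> (\<forall>i j. p i j \<noteq> 0 \<longrightarrow> i < j + N \<and> j < i + N)"

abbreviation (input) transposed :: "(nat \<Rightarrow> nat \<Rightarrow> 'a) \<Rightarrow> nat \<Rightarrow> nat \<Rightarrow> 'a" where
  "transposed p \<equiv> \<lambda>i j. p j i"

definition diagonals :: "(nat \<Rightarrow> nat \<Rightarrow> 'a) \<Rightarrow> nat \<Rightarrow> nat \<Rightarrow> 'a" where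
  "diagonals p d i = p i (i + d)"

lemma is_plane_partition_iff: "is_plane_partition n p \<longleftrightarrow> plane_part p \<and> pp_size p = n"
  by (auto simp: is_plane_partition_def plane_part_def pp_size_def)

lemma plane_part_bounded:
  assumes "plane_part p"
  obtains M where "\<And>i j. p i j \<noteq> 0 \<Longrightarrow> i < M \<and> j < M"
proof -
  have "finite (fst ` {(i, j). p i j \<noteq> 0} \<union> snd ` {(i, j). p i j \<noteq> 0})"
    using assms by (simp add: plane_part_def)
  then obtain M where "\<forall>i\<in>fst ` {(i, j). p i j \<noteq> 0} \<union> snd ` {(i, j). p i j \<noteq> 0}. i < M"
    using finite_nat_set_iff_bounded by blast
  hence "\<And>i j. p i j \<noteq> 0 \<Longrightarrow> i < M \<and> j < M" by force
  thus ?thesis using that by blast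
qed

lemma plane_part_transposed: "plane_part p \<Longrightarrow> plane_part (transposed p)"
proof -
  assume p: "plane_part p"
  have "{(i, j). p j i \<noteq> 0} = prod.swap ` {(i, j). p i j \<noteq> 0}"
    by force
  thus ?thesis
    using p by (simp add: plane_part_def)
qed

lemma band_transposed: "band N p \<Longrightarrow> band N (transposed p)"
  by (auto simp: band_def)

lemma ex_band:
  assumes "plane_part p"
  shows "\<exists>N. band N p"
proof -
  obtain M where "\<And>i j. p i j \<noteq> 0 \<Longrightarrow> i < M \<and> j < M"
    using plane_part_bounded[OF assms] by blast
  thus ?thesis
    unfolding band_def by (meson trans_less_add2)
qed

lemma sum_above_diagonal:
  fixes f :: "nat \<Rightarrow> nat \<Rightarrow> 'a :: comm_monoid_add"
  assumes "\<And>i j. j \<ge> M \<Longrightarrow> f i j = 0"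
  shows "(\<Sum>i<M. \<Sum>j\<in>{i<..<M}. f i j) = (\<Sum>d<M. \<Sum>i<M. diagonals f (Suc d) i)"
proof -
  have "(\<Sum>j\<in>{i<..<M}. f i j) = (\<Sum>d<M. diagonals f (Suc d) i)" for i
  proof -
    have "(\<Sum>j\<in>{i<..<M}. f i j) = (\<Sum>d\<in>{d. i + Suc d < M}. f i (i + Suc d))"
      by (rule sum.reindex_bij_witness[of _ "\<lambda>d. i + Suc d" "\<lambda>j. j - i - 1"]) auto
    also have "\<dots> = (\<Sum>d<M. diagonals f (Suc d) i)"
      unfolding diagonals_def by (rule sum.mono_neutral_left) (auto simp: assms)
    finally show ?thesis .
  qed
  thus ?thesis
    using sum.swap[of "\<lambda>i d. diagonals f (Suc d) i" "{..<M}" "{..<M}"] by simp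
qed

lemma sum_square_split_diagonal:
  fixes f :: "nat \<Rightarrow> nat \<Rightarrow> 'a :: comm_monoid_add"
  shows "(\<Sum>i<M. \<Sum>j<M. f i j)
    = (\<Sum>i<M. f i i) + (\<Sum>i<M. \<Sum>j\<in>{i<..<M}. f i j) + (\<Sum>j<M. \<Sum>i\<in>{j<..<M}. f i j)"
proof -
  have "(\<Sum>j<M. f i j) = f i i + (\<Sum>j\<in>{i<..<M}. f i j) + (\<Sum>j<i. f i j)" if "i < M" for i
  proof -
    have "{..<M} = insert i ({..<i} \<union> {i<..<M})" using that by auto
    hence "(\<Sum>j<M. f i j) = f i i + (\<Sum>j\<in>{..<i} \<union> {i<..<M}. f i j)" by simp
    also have "(\<Sum>j\<in>{..<i} \<union> {i<..<M}. f i j) = (\<Sum>j<i. f i j) + (\<Sum>j\<in>{i<..<M}. f i j)"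
      by (rule sum.union_disjoint) auto
    finally show ?thesis by (simp add: add_ac)
  qed
  moreover have "(\<Sum>i<M. \<Sum>j<i. f i j) = (\<Sum>j<M. \<Sum>i\<in>{j<..<M}. f i j)"
    unfolding sum.Sigma[OF finite_lessThan ballI[OF finite_lessThan]]
      sum.Sigma[OF finite_lessThan ballI[OF finite_greaterThanLessThan]]
    by (rule sum.reindex_bij_witness[of _ "\<lambda>(i, j). (j, i)" "\<lambda>(i, j). (j, i)"]) auto
  ultimately show ?thesis
    by (simp add: sum.distrib)
qed

lemma tail_size_diagonals:
  assumes "band N p" "N \<le> M" "\<And>i j. i \<ge> M \<Longrightarrow> p i j = 0"
  shows "tail_size N (diagonals p) = (\<Sum>d<M. \<Sum>i<M. diagonals p (Suc d) i)"
proof -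
  have "tail_size N (diagonals p) = (\<Sum>d<M. psize (diagonals p (Suc d)))"
    unfolding tail_size_def
  proof (rule sum.mono_neutral_left)
    show "\<forall>d\<in>{..<M} - {..<N}. psize (diagonals p (Suc d)) = 0"
    proof
      fix d assume "d \<in> {..<M} - {..<N}"
      hence "diagonals p (Suc d) = (\<lambda>_. 0)"
        using assms(1) by (force simp: band_def diagonals_def)
      thus "psize (diagonals p (Suc d)) = 0" by (simp only: psize_zero)
    qed
  qed (use assms(2) in auto)
  also have "\<dots> = (\<Sum>d<M. \<Sum>i<M. diagonals p (Suc d) i)"
    by (intro sum.cong refl psize_eq_sum_lessThan) (simp add: diagonals_def assms(3))
  finally show ?thesis .
qed

lemma pp_size_eq_tail_sizes:
  assumes "plane_part p" "band N p"
  shows "pp_size p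
    = pp_trace p + tail_size N (diagonals p) + tail_size N (diagonals (transposed p))"
proof -
  obtain M0 where M0: "\<And>i j. p i j \<noteq> 0 \<Longrightarrow> i < M0 \<and> j < M0"
    using plane_part_bounded[OF assms(1)] by blast
  define M where "M = max M0 N"
  have zero: "p i j = 0" if "i \<ge> M \<or> j \<ge> M" for i j
    using M0[of i j] that by (force simp: M_def)
  have "pp_size p = (\<Sum>(i, j)\<in>{..<M} \<times> {..<M}. p i j)"
    unfolding pp_size_def by (rule sum.mono_neutral_left) (auto, (metis zero neq0_conv not_le)+)
  also have "\<dots> = (\<Sum>i<M. \<Sum>j<M. p i j)"
    by (simp add: sum.cartesian_product)
  also have "\<dots> = (\<Sum>i<M. p i i) + (\<Sum>d<M. \<Sum>i<M. diagonals p (Suc d) i)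
      + (\<Sum>d<M. \<Sum>i<M. diagonals (transposed p) (Suc d) i)"
    using sum_above_diagonal[of M p] sum_above_diagonal[of M "transposed p"] zero
    by (simp add: sum_square_split_diagonal)
  also have "(\<Sum>i<M. p i i) = pp_trace p"
    using psize_eq_sum_lessThan[of M "\<lambda>i. p i i"] zero by (simp add: psize_def pp_trace_def)
  finally show ?thesis
    using tail_size_diagonals[OF assms(2), of M]
      tail_size_diagonals[OF band_transposed[OF assms(2)], of M] zero
    by (simp add: M_def)
qed

lemma chain_diagonals:
  assumes "plane_part p" "band N p"
  shows "chain N (diagonals p)"
proof -
  have decreasing: "p (Suc i) j \<le> p i j" "p i (Suc j) \<le> p i j" for i j
    using assms by (auto simp: plane_part_def)
  obtain M where "\<And>i j. p i j \<noteq> 0 \<Longrightarrow> i < M \<and> j < M"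
    using plane_part_bounded[OF assms(1)] by blast
  hence "fin_supp (diagonals p d)" for d
    unfolding fin_supp_def diagonals_def by (metis not_le)
  thus ?thesis
    using assms(2) decreasing
    by (force simp: chain_def interlaces_def band_def diagonals_def fun_eq_iff)
qed

definition glue :: "(nat \<Rightarrow> nat \<Rightarrow> nat) \<Rightarrow> (nat \<Rightarrow> nat \<Rightarrow> nat) \<Rightarrow> nat \<Rightarrow> nat \<Rightarrow> nat" where
  "glue c c' i j = (if i \<le> j then c (j - i) i else c' (i - j) j)"

lemma transposed_glue: "c 0 = c' 0 \<Longrightarrow> transposed (glue c c') = glue c' c"
  by (auto simp: glue_def fun_eq_iff)

lemma diagonals_glue: "diagonals (glue c c') = c"
  by (simp add: diagonals_def glue_def fun_eq_iff)

lemma glue_diagonals: "glue (diagonals p) (diagonals (transposed p)) = p"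
  by (auto simp: glue_def diagonals_def fun_eq_iff)

lemma pp_trace_glue: "pp_trace (glue c c') = psize (c 0)"
  by (simp add: pp_trace_def psize_def glue_def)

lemma glue_decreasing_row:
  assumes "chain N c" "chain N c'" "c 0 = c' 0"
  shows "glue c c' i (Suc j) \<le> glue c c' i j"
proof (cases "i \<le> j")
  case True
  thus ?thesis
    using assms(1) interlaces_bounds(1)[of "c (j - i)" "c (Suc (j - i))" i]
    by (simp add: glue_def chain_def Suc_diff_le)
next
  case False
  then obtain d where d: "i = Suc (j + d)"
    by (metis add_Suc_right less_natE not_le)
  show ?thesis
    using assms(2,3) interlaces_bounds(2)[of "c' d" "c' (Suc d)" j]
    by (cases d) (auto simp: glue_def chain_def d Suc_diff_le)
qed

lemma band_glue:
  assumes "chain N c" "chain N c'"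
  shows "band N (glue c c')"
  unfolding band_def
proof (intro allI impI)
  fix i j assume nonzero: "glue c c' i j \<noteq> 0"
  show "i < j + N \<and> j < i + N"
  proof (cases "i \<le> j")
    case True
    hence "\<not> N \<le> j - i"
      using nonzero assms(1) by (auto simp: glue_def chain_def)
    thus ?thesis using True by linarith
  next
    case False
    hence "\<not> N \<le> i - j"
      using nonzero assms(2) by (auto simp: glue_def chain_def)
    thus ?thesis using False by linarith
  qed
qed

lemma chain_le_start:
  assumes "chain N c"
  shows "c d i \<le> c 0 i"
proof (induction d)
  case (Suc d)
  have "c (Suc d) i \<le> c d i"
    using assms by (intro interlaces_bounds) (simp add: chain_def)
  thus ?case using Suc by (rule order_trans)
qed simp

lemma finite_support_glue:
  assumes "chain N c" "chain N c'" "c 0 = c' 0"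
  shows "finite {(i, j). glue c c' i j \<noteq> 0}"
proof -
  have "fin_supp (c 0)"
    using assms(1) by (auto simp: chain_def intro: fin_supp_interlaces(1))
  then obtain M where M: "\<And>i. i \<ge> M \<Longrightarrow> c 0 i = 0"
    unfolding fin_supp_def by blast
  have start: "glue c c' i j \<le> c 0 (min i j)" for i j
    using chain_le_start[OF assms(1)] chain_le_start[OF assms(2)] assms(3) by (simp add: glue_def)
  have "i < M + N \<and> j < M + N" if nonzero: "glue c c' i j \<noteq> 0" for i j
  proof -
    have "min i j < M"
      using start[of i j] M[of "min i j"] nonzero by (cases "M \<le> min i j") auto
    moreover have "i < j + N" "j < i + N"
      using band_glue[OF assms(1,2)] nonzero by (auto simp: band_def)
    ultimately show ?thesis by linarith
  qed
  hence "{(i, j). glue c c' i j \<noteq> 0} \<subseteq> {..<M + N} \<times> {..<M + N}"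
    by auto
  thus ?thesis
    by (rule finite_subset) auto
qed

lemma plane_part_glue:
  assumes "chain N c" "chain N c'" "c 0 = c' 0"
  shows "plane_part (glue c c')"
  unfolding plane_part_def
proof (intro conjI allI finite_support_glue[OF assms])
  fix i j
  show "glue c c' i (Suc j) \<le> glue c c' i j"
    by (rule glue_decreasing_row[OF assms])
  show "glue c c' (Suc i) j \<le> glue c c' i j"
    using glue_decreasing_row[OF assms(2,1) assms(3)[symmetric], of j i]
      transposed_glue[of c' c] assms(3) by (simp add: fun_eq_iff)
qed

definition glued_chains :: "nat \<Rightarrow> ((nat \<Rightarrow> nat \<Rightarrow> nat) \<times> (nat \<Rightarrow> nat \<Rightarrow> nat)) set" where
  "glued_chains N = {(c, c'). chain N c \<and> chain N c' \<and> c 0 = c' 0}"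

lemma bij_betw_glue:
  "bij_betw (case_prod glue) (glued_chains N) {p. plane_part p \<and> band N p}"
proof (rule bij_betw_byWitness[where f' = "\<lambda>p. (diagonals p, diagonals (transposed p))"])
  show "\<forall>cc\<in>glued_chains N. (diagonals (case_prod glue cc),
      diagonals (transposed (case_prod glue cc))) = cc"
    by (auto simp: glued_chains_def transposed_glue diagonals_glue)
  show "\<forall>p\<in>{p. plane_part p \<and> band N p}.
      case_prod glue (diagonals p, diagonals (transposed p)) = p"
    by (simp add: glue_diagonals)
  show "case_prod glue ` glued_chains N \<subseteq> {p. plane_part p \<and> band N p}"
    using plane_part_glue band_glue by (auto simp: glued_chains_def)
  show "(\<lambda>p. (diagonals p, diagonals (transposed p))) ` {p. plane_part p \<and> band N p}
      \<subseteq> glued_chains N"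
    using chain_diagonals chain_diagonals[OF plane_part_transposed band_transposed]
    by (auto simp: glued_chains_def diagonals_def)
qed

lemma weight_glue:
  fixes x u :: ennreal
  assumes "chain N c" "chain N c'" "c 0 = c' 0"
  shows "x ^ pp_trace (glue c c') * u ^ pp_size (glue c c')
    = (x * u) ^ psize (c 0) * u ^ tail_size N c * u ^ tail_size N c'"
  using pp_size_eq_tail_sizes[OF plane_part_glue[OF assms] band_glue[OF assms(1,2)]]
  by (simp add: transposed_glue[of c c', OF assms(3)] diagonals_glue pp_trace_glue power_add
      power_mult_distrib mult_ac)

lemma band_nsum:
  "nsum (\<lambda>p. if plane_part p \<and> band N p then x ^ pp_trace p * u ^ pp_size p else 0)
   = (\<Prod>i<N. \<Prod>j<N. geo (x * u ^ Suc (i + j)))"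
proof -
  let ?s = "schur (powers u N)"
  let ?wt = "\<lambda>\<rho> c. if chain N c \<and> c 0 = \<rho> then u ^ tail_size N c else 0"
  let ?t = "\<lambda>\<rho> cc. (x * u) ^ psize \<rho> * ?wt \<rho> (fst cc) * ?wt \<rho> (snd cc)"
  have "nsum (\<lambda>p. if plane_part p \<and> band N p then x ^ pp_trace p * u ^ pp_size p else 0)
     = nsum (\<lambda>cc. if cc \<in> glued_chains N then
         x ^ pp_trace (case_prod glue cc) * u ^ pp_size (case_prod glue cc) else 0)"
    using nsum_reindex[OF bij_betw_glue[of N], of "\<lambda>p. x ^ pp_trace p * u ^ pp_size p"]
    by simp
  also have "\<dots> = nsum (\<lambda>cc. nsum (\<lambda>\<rho>. if \<rho> = fst cc 0 then ?t \<rho> cc else 0))"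
    by (subst nsum_delta, intro nn_integral_cong) (auto simp: glued_chains_def weight_glue)
  also have "\<dots> = nsum (\<lambda>\<rho>. nsum (\<lambda>cc. ?t \<rho> cc))"
    by (subst nsum_swap, intro nn_integral_cong) auto
  also have "\<dots> = nsum (\<lambda>\<rho>. (x * u) ^ psize \<rho> * ?s \<rho> * ?s \<rho>)"
    by (subst nsum_prod) (simp only: fst_conv snd_conv nsum_cmult nsum_multc chain_nsum)
  also have "\<dots> = nsum (\<lambda>\<rho>. ?s \<rho> * schur (map ((*) (x * u)) (powers u N)) \<rho>)"
    by (simp only: schur_scale mult_ac)
  also have "\<dots> = (\<Prod>z\<leftarrow>powers u N.
      \<Prod>y\<leftarrow>map ((*) (x * u)) (powers u N). geo (y * z))"
    by (rule cauchy_identity)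
  also have "\<dots> = (\<Prod>i<N. \<Prod>j<N. geo (x * u ^ Suc (i + j)))"
    by (simp add: prod.distinct_set_conv_list[symmetric] o_def atLeast0LessThan power_add mult_ac)
  finally show ?thesis .
qed

section \<open>The trace generating function\<close>

definition log_gf_term :: "'a :: {real_normed_field, banach} \<Rightarrow> 'a \<Rightarrow> nat \<Rightarrow> 'a" where
  "log_gf_term x u k = x ^ Suc k / of_nat (Suc k) * (u ^ Suc k / (1 - u ^ Suc k) ^ 2)"

definition log_gf :: "'a :: {real_normed_field, banach} \<Rightarrow> 'a \<Rightarrow> 'a" where
  "log_gf x u = (\<Sum>k. log_gf_term x u k)"

lemma norm_log_gf_factor_le:
  fixes u :: "'a :: real_normed_field"
  assumes "norm u \<le> r" "r < 1"
  shows "norm (u ^ Suc k / (1 - u ^ Suc k) ^ 2) \<le> 1 / (1 - r) ^ 2"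
proof -
  have "norm (u ^ Suc k) \<le> norm u * 1"
    using assms unfolding power_Suc norm_mult norm_power
    by (intro mult_left_mono power_le_one) auto
  hence le_r: "norm (u ^ Suc k) \<le> r" using assms by simp
  hence "1 - r \<le> norm (1 - u ^ Suc k)"
    using norm_triangle_ineq2[of 1 "u ^ Suc k"] by simp
  hence "(1 - r) ^ 2 \<le> norm (1 - u ^ Suc k) ^ 2"
    using assms by (intro power_mono) auto
  moreover have "norm (u ^ Suc k) \<le> 1" using le_r assms by linarith
  ultimately show ?thesis
    unfolding norm_divide norm_power using assms by (intro frac_le) auto
qed

lemma norm_power_div_of_nat_le:
  fixes x :: "'a :: real_normed_field"
  assumes "norm x \<le> s"
  shows "norm (x ^ Suc k / of_nat (Suc k)) \<le> s ^ Suc k"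
proof -
  have "norm (x ^ Suc k / of_nat (Suc k)) \<le> s ^ Suc k / 1"
    unfolding norm_divide norm_power norm_of_nat
    using assms order_trans[OF norm_ge_zero assms] by (intro frac_le power_mono) auto
  thus ?thesis by simp
qed

lemma norm_log_gf_term_le:
  assumes "norm x \<le> s" "norm u \<le> r" "r < 1"
  shows "norm (log_gf_term x u k) \<le> s ^ Suc k / (1 - r) ^ 2"
proof -
  have "norm (log_gf_term x u k) \<le> s ^ Suc k * (1 / (1 - r) ^ 2)"
    unfolding log_gf_term_def norm_mult using order_trans[OF norm_ge_zero assms(1)]
    by (intro mult_mono norm_power_div_of_nat_le norm_log_gf_factor_le assms) auto
  thus ?thesis by simp
qed

lemma summable_power_Suc:
  fixes s :: "'a :: {real_normed_field, banach}"
  shows "norm s < 1 \<Longrightarrow> summable (\<lambda>k. s ^ Suc k)"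
  by (subst summable_Suc_iff) (rule summable_geometric)

lemma log_gf_sums:
  fixes x u :: "'a :: {real_normed_field, banach}"
  assumes "norm x < 1" "norm u < 1"
  shows "log_gf_term x u sums log_gf x u"
proof -
  have "summable (\<lambda>k. norm x ^ Suc k / (1 - norm u) ^ 2)"
    using assms by (intro summable_divide summable_power_Suc) auto
  hence "summable (log_gf_term x u)"
    by (rule summable_comparison_test'[of _ 0])
       (use norm_log_gf_term_le[OF order_refl order_refl assms(2)] in simp)
  thus ?thesis
    unfolding log_gf_def by (rule summable_sums)
qed

lemma log_gf_of_real:
  assumes "\<bar>x\<bar> < 1" "\<bar>u\<bar> < 1"
  shows "log_gf (complex_of_real x) (of_real u) = of_real (log_gf x u)"
proof -
  have "(\<lambda>k. complex_of_real (log_gf_term x u k)) sums of_real (log_gf x u)"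
    using log_gf_sums[of x u] assms by (simp only: sums_of_real_iff real_norm_def)
  thus ?thesis
    by (simp add: log_gf_def log_gf_term_def sums_iff)
qed

lemma Ln_one_minus_sums:
  assumes "norm x < 1"
  shows "(\<lambda>k. x ^ Suc k / of_nat (Suc k)) sums (- Ln (1 - x))"
proof -
  have "(\<lambda>n. (- 1) ^ Suc n / of_nat n * (- x) ^ n) sums Ln (1 + (- x))"
    by (rule Ln_series) (use assms in simp)
  from sums_minus[OF this]
  have "(\<lambda>n. - ((- 1) ^ Suc n / of_nat n * (- x) ^ n)) sums (- Ln (1 - x))"
    by simp
  also have "(\<lambda>n. - ((- 1) ^ Suc n / of_nat n * (- x) ^ n)) = (\<lambda>n. x ^ n / of_nat n)"
    by (simp add: power_mult_distrib[symmetric])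
  finally show ?thesis by (subst sums_Suc_iff) auto
qed

lemma ln_one_minus_sums:
  fixes x :: real
  assumes "\<bar>x\<bar> < 1"
  shows "(\<lambda>k. x ^ Suc k / real (Suc k)) sums (- ln (1 - x))"
proof -
  have "Ln (1 - complex_of_real x) = of_real (ln (1 - x))"
    using assms Ln_of_real[of "1 - x"] by simp
  hence "(\<lambda>k. complex_of_real (x ^ Suc k / real (Suc k))) sums of_real (- ln (1 - x))"
    using Ln_one_minus_sums[of "complex_of_real x"] assms by simp
  thus ?thesis by (simp only: sums_of_real_iff)
qed

definition band_gf :: "nat \<Rightarrow> real \<Rightarrow> real \<Rightarrow> real" where
  "band_gf N x u = (\<Prod>i<N. \<Prod>j<N. 1 / (1 - x * u ^ Suc (i + j)))"

definition band_log_term :: "nat \<Rightarrow> real \<Rightarrow> real \<Rightarrow> nat \<Rightarrow> real" where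
  "band_log_term N x u k
    = x ^ Suc k / real (Suc k) * (u ^ Suc k * (\<Sum>i<N. (u ^ Suc k) ^ i) ^ 2)"

context
  fixes x u :: real
  assumes x: "0 \<le> x" "x < 1" and u: "0 \<le> u" "u < 1"
begin

lemma mult_power_Suc_in_unit_interval: "0 \<le> x * u ^ Suc n" "x * u ^ Suc n < 1"
proof -
  show "0 \<le> x * u ^ Suc n" using x u by simp
  have "x * u ^ Suc n \<le> x * 1"
    using x u by (intro mult_left_mono power_le_one) auto
  thus "x * u ^ Suc n < 1" using x by simp
qed

lemma band_gf_factor_pos: "1 / (1 - x * u ^ Suc n) > 0"
  using mult_power_Suc_in_unit_interval(2)[of n] by simp

lemma band_gf_pos: "band_gf N x u > 0"
  unfolding band_gf_def by (intro prod_pos band_gf_factor_pos)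

lemma ln_band_gf: "ln (band_gf N x u) = (\<Sum>i<N. \<Sum>j<N. - ln (1 - x * u ^ Suc (i + j)))"
proof -
  note nonzero = band_gf_factor_pos[THEN less_imp_neq, symmetric]
  have "ln (band_gf N x u) = (\<Sum>i<N. ln (\<Prod>j<N. 1 / (1 - x * u ^ Suc (i + j))))"
    unfolding band_gf_def by (rule ln_prod) (use nonzero in auto)
  also have "\<dots> = (\<Sum>i<N. \<Sum>j<N. ln (1 / (1 - x * u ^ Suc (i + j))))"
    by (intro sum.cong refl ln_prod) (use nonzero in auto)
  also have "\<dots> = (\<Sum>i<N. \<Sum>j<N. - ln (1 - x * u ^ Suc (i + j)))"
    by (intro sum.cong refl)
       (use mult_power_Suc_in_unit_interval(2) in \<open>simp add: ln_div del: power_Suc\<close>)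
  finally show ?thesis .
qed

lemma band_log_term_sums: "band_log_term N x u sums ln (band_gf N x u)"
proof -
  have "(\<lambda>k. \<Sum>i<N. \<Sum>j<N. (x * u ^ Suc (i + j)) ^ Suc k / real (Suc k)) sums ln (band_gf N x u)"
    unfolding ln_band_gf
    by (intro sums_sum ln_one_minus_sums) (use mult_power_Suc_in_unit_interval in simp)
  moreover have "(x * u ^ Suc (i + j)) ^ Suc k / real (Suc k)
      = x ^ Suc k / real (Suc k) * (u ^ Suc k * ((u ^ Suc k) ^ i * (u ^ Suc k) ^ j))" for i j k
  proof -
    have "(u ^ Suc (i + j)) ^ Suc k = (u ^ Suc k) ^ Suc (i + j)"
      by (simp only: power_mult[symmetric] mult.commute)
    also have "\<dots> = u ^ Suc k * ((u ^ Suc k) ^ i * (u ^ Suc k) ^ j)"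
      by (simp only: power_Suc[of "u ^ Suc k"] power_add)
    finally show ?thesis by (simp only: power_mult_distrib times_divide_eq_left)
  qed
  hence "(\<lambda>k. \<Sum>i<N. \<Sum>j<N. (x * u ^ Suc (i + j)) ^ Suc k / real (Suc k)) = band_log_term N x u"
    by (simp only: band_log_term_def sum_distrib_left[symmetric] sum_distrib_right[symmetric]
        power2_eq_square fun_eq_iff simp_thms)
  ultimately show ?thesis by simp
qed

lemma geometric_partial_sums_tendsto:
  "(\<lambda>N. \<Sum>i<N. (u ^ Suc k) ^ i) \<longlonglongrightarrow> 1 / (1 - u ^ Suc k)"
proof -
  have "norm (u ^ Suc k) < 1"
    using u power_less_one_iff[of u "Suc k"] by simp
  from geometric_sums[OF this] show ?thesis
    by (simp add: sums_def)
qed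

lemma band_log_term_tendsto: "(\<lambda>N. band_log_term N x u k) \<longlonglongrightarrow> log_gf_term x u k"
proof -
  have "(\<lambda>N. band_log_term N x u k)
      \<longlonglongrightarrow> x ^ Suc k / real (Suc k) * (u ^ Suc k * (1 / (1 - u ^ Suc k)) ^ 2)"
    unfolding band_log_term_def by (intro tendsto_intros geometric_partial_sums_tendsto)
  thus ?thesis by (simp add: log_gf_term_def power_divide)
qed

lemma norm_band_log_term_le: "norm (band_log_term N x u k) \<le> x ^ Suc k / (1 - u) ^ 2"
proof -
  have pos: "0 \<le> band_log_term N x u k" for N
    using x u by (simp add: band_log_term_def)
  have "incseq (\<lambda>N. band_log_term N x u k)"
    unfolding band_log_term_def using x u
    by (intro incseq_SucI mult_left_mono power_mono) (auto intro!: sum_nonneg)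
  hence "band_log_term N x u k \<le> log_gf_term x u k"
    by (rule incseq_le[OF _ band_log_term_tendsto])
  also have "log_gf_term x u k \<le> x ^ Suc k / (1 - u) ^ 2"
    using norm_log_gf_term_le[of x x u u k] x u by simp
  finally show ?thesis using pos by simp
qed

lemma band_gf_tendsto: "(\<lambda>N. band_gf N x u) \<longlonglongrightarrow> exp (log_gf x u)"
proof -
  have "(\<lambda>N. \<Sum>k. band_log_term N x u k) \<longlonglongrightarrow> log_gf x u"
    unfolding log_gf_def
  proof (rule tannerys_theorem[THEN conjunct2, THEN conjunct2])
    show "\<forall>\<^sub>F (k, N) in sequentially \<times>\<^sub>F sequentially.
        norm (band_log_term N x u k) \<le> x ^ Suc k / (1 - u) ^ 2"
      using norm_band_log_term_le by (intro always_eventually) auto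
    show "summable (\<lambda>k. x ^ Suc k / (1 - u) ^ 2)"
      using x by (intro summable_divide summable_power_Suc) auto
  qed (auto intro: band_log_term_tendsto)
  moreover have "(\<Sum>k. band_log_term N x u k) = ln (band_gf N x u)" for N
    using band_log_term_sums by (simp add: sums_iff)
  ultimately have "(\<lambda>N. exp (ln (band_gf N x u))) \<longlonglongrightarrow> exp (log_gf x u)"
    by (intro tendsto_exp) simp
  thus ?thesis by (simp add: band_gf_pos)
qed

lemma geo_ennreal: "geo (ennreal (x * u ^ Suc n)) = ennreal (1 / (1 - x * u ^ Suc n))"
proof -
  note unit = mult_power_Suc_in_unit_interval[of n]
  have "(\<lambda>k. (x * u ^ Suc n) ^ k) sums (1 / (1 - x * u ^ Suc n))"
    using unit by (intro geometric_sums) (simp only: real_norm_def abs_of_nonneg)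
  hence "(\<Sum>k. ennreal ((x * u ^ Suc n) ^ k)) = ennreal (1 / (1 - x * u ^ Suc n))"
    using unit by (intro suminf_ennreal_eq) (simp_all del: power_Suc)
  thus ?thesis
    using unit by (simp add: geo_def nn_integral_count_space_nat ennreal_power del: power_Suc)
qed

lemma band_nsum_real:
  "nsum (\<lambda>p. if plane_part p \<and> band N p then ennreal (x ^ pp_trace p * u ^ pp_size p) else 0)
   = ennreal (band_gf N x u)"
proof -
  have "nsum (\<lambda>p. if plane_part p \<and> band N p then ennreal (x ^ pp_trace p * u ^ pp_size p) else 0)
     = nsum (\<lambda>p. if plane_part p \<and> band N p
         then ennreal x ^ pp_trace p * ennreal u ^ pp_size p else 0)"
    using x u by (intro nn_integral_cong) (simp add: ennreal_power ennreal_mult)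
  also have "\<dots> = (\<Prod>i<N. \<Prod>j<N. geo (ennreal (x * u ^ Suc (i + j))))"
    using x u by (simp add: band_nsum ennreal_power ennreal_mult del: power_Suc)
  also have "\<dots> = ennreal (band_gf N x u)"
    unfolding band_gf_def geo_ennreal using band_gf_factor_pos[THEN less_imp_le]
    by (simp add: prod_ennreal prod_nonneg del: power_Suc)
  finally show ?thesis .
qed

lemma plane_part_nsum:
  "nsum (\<lambda>p. if plane_part p then ennreal (x ^ pp_trace p * u ^ pp_size p) else 0)
   = ennreal (exp (log_gf x u))"
proof -
  define g where
    "g p = (if plane_part p then ennreal (x ^ pp_trace p * u ^ pp_size p) else 0)" for p
  define f where "f N p = (if band N p then g p else 0)" for N p
  have "band N' p" if "band N p" "N \<le> N'" for N N' p
    using that unfolding band_def by (meson add_left_mono order_less_le_trans)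
  hence inc: "incseq f"
    by (auto simp: incseq_def le_fun_def f_def)
  have "(SUP N. f N p) = g p" for p
  proof (rule antisym)
    show "(SUP N. f N p) \<le> g p"
      by (rule SUP_least) (simp add: f_def)
    have "\<exists>N. f N p = g p"
      using ex_band[of p] by (auto simp: f_def g_def)
    thus "g p \<le> (SUP N. f N p)"
      by (metis SUP_upper UNIV_I)
  qed
  hence "nsum g = nsum (\<lambda>p. SUP N. f N p)"
    by simp
  also have "\<dots> = (SUP N. nsum (f N))"
    using inc by (intro nn_integral_monotone_convergence_SUP) auto
  also have "\<dots> = ennreal (exp (log_gf x u))"
  proof (rule LIMSEQ_unique)
    show "(\<lambda>N. nsum (f N)) \<longlonglongrightarrow> (SUP N. nsum (f N))"
      using inc by (intro LIMSEQ_SUP) (auto simp: incseq_def le_fun_def intro!: nn_integral_mono)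
    have "nsum (f N) = ennreal (band_gf N x u)" for N
      unfolding band_nsum_real[symmetric] by (intro nn_integral_cong) (simp add: f_def g_def)
    thus "(\<lambda>N. nsum (f N)) \<longlonglongrightarrow> ennreal (exp (log_gf x u))"
      using band_gf_tendsto by simp
  qed
  finally show ?thesis
    unfolding g_def .
qed

end

lemma finite_plane_partitions:
  "finite {p. is_plane_partition n p \<and> pp_trace p = k}" (is "finite ?A")
proof (rule ccontr)
  assume "infinite ?A"
  let ?w = "(1 / 2) ^ k * (1 / 2) ^ n :: real"
  have "ennreal ?w * emeasure (count_space UNIV) ?A = nsum (\<lambda>p. ennreal ?w * indicator ?A p)"
    by (rule nn_integral_cmult_indicator[symmetric]) simp
  also have "\<dots> \<le> nsum (\<lambda>p. if plane_part p
      then ennreal ((1 / 2) ^ pp_trace p * (1 / 2) ^ pp_size p) else 0)"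
    by (intro nn_integral_mono) (auto simp: is_plane_partition_iff split: split_indicator)
  also have "\<dots> < \<top>"
    by (subst plane_part_nsum) auto
  finally show False
    using \<open>infinite ?A\<close> by (simp add: ennreal_mult_eq_top_iff emeasure_count_space_infinite)
qed

lemma pp_trace_le_pp_size:
  assumes "plane_part p"
  shows "pp_trace p \<le> pp_size p"
proof -
  have "pp_trace p = (\<Sum>(i, j)\<in>(\<lambda>i. (i, i)) ` {i. p i i \<noteq> 0}. p i j)"
    by (subst sum.reindex) (auto simp: inj_on_def pp_trace_def)
  also have "\<dots> \<le> pp_size p"
    unfolding pp_size_def by (rule sum_mono2) (use assms in \<open>auto simp: plane_part_def\<close>)
  finally show ?thesis .
qed

lemma pp_trace_eq_0_imp_zero:
  assumes "plane_part p" "pp_trace p = 0"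
  shows "p = (\<lambda>_ _. 0)"
proof -
  obtain M where M: "\<And>i j. p i j \<noteq> 0 \<Longrightarrow> i < M \<and> j < M"
    using plane_part_bounded[OF assms(1)] by blast
  hence "{i. p i i \<noteq> 0} \<subseteq> {..<M}" by blast
  hence "finite {i. p i i \<noteq> 0}" by (rule finite_subset) simp
  hence "p 0 0 = 0" using assms(2) by (auto simp: pp_trace_def)
  have decreasing: "p (Suc i) j \<le> p i j" "p i (Suc j) \<le> p i j" for i j
    using assms(1) by (auto simp: plane_part_def)
  have "p i j \<le> p i 0" for i j
    by (induction j) (use decreasing(2) order_trans in blast)+
  moreover have "p i 0 \<le> p 0 0" for i
    by (induction i) (use decreasing(1) order_trans in blast)+
  ultimately have "p i j \<le> 0" for i j
    using \<open>p 0 0 = 0\<close> order_trans by metis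
  thus ?thesis by (intro ext) simp
qed

lemma pp_eq_0:
  assumes "k > n"
  shows "pp k n = 0"
proof -
  have "{p. is_plane_partition n p \<and> pp_trace p = k} = {}"
    using pp_trace_le_pp_size assms by (force simp: is_plane_partition_iff)
  thus ?thesis unfolding pp_def by (simp only: card.empty)
qed

lemma pp_0_eq_0:
  assumes "n > 0"
  shows "pp 0 n = 0"
proof -
  have "{p. is_plane_partition n p \<and> pp_trace p = 0} = {}"
    using pp_trace_eq_0_imp_zero assms by (force simp: is_plane_partition_iff pp_size_def)
  thus ?thesis unfolding pp_def by (simp only: card.empty)
qed

lemma pp_nsum:
  "nsum (\<lambda>p. if plane_part p \<and> pp_size p = n \<and> pp_trace p = k then c else 0)
   = of_nat (pp k n) * c"
proof -
  let ?A = "{p. is_plane_partition n p \<and> pp_trace p = k}"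
  have "nsum (\<lambda>p. if plane_part p \<and> pp_size p = n \<and> pp_trace p = k then c else 0)
      = nsum (\<lambda>p. c * indicator ?A p)"
    by (intro nn_integral_cong) (auto simp: is_plane_partition_iff split: split_indicator)
  also have "\<dots> = c * emeasure (count_space UNIV) ?A"
    by (rule nn_integral_cmult_indicator) simp
  also have "\<dots> = of_nat (pp k n) * c"
    using finite_plane_partitions[of n k] by (simp add: pp_def mult.commute)
  finally show ?thesis .
qed

definition trace_poly :: "nat \<Rightarrow> 'a :: real_normed_field \<Rightarrow> 'a" where
  "trace_poly n x = (\<Sum>k\<le>n. of_nat (pp k n) * x ^ k)"

lemma trace_poly_eq_Q: "n > 0 \<Longrightarrow> trace_poly n x = Q n x"
  unfolding trace_poly_def Q_def
  by (rule sum.mono_neutral_right) (auto simp: pp_0_eq_0 not_less_eq_eq)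

lemma trace_poly_of_real: "trace_poly n (complex_of_real x) = of_real (trace_poly n x)"
  by (simp add: trace_poly_def)

lemma trace_poly_nonneg: "0 \<le> x \<Longrightarrow> 0 \<le> trace_poly n (x :: real)"
  by (auto simp: trace_poly_def intro!: sum_nonneg)

lemma trace_poly_nsum:
  assumes "0 \<le> x" "0 \<le> u"
  shows "nsum (\<lambda>p. if plane_part p \<and> pp_size p = n then ennreal (x ^ pp_trace p * u ^ n) else 0)
    = ennreal (trace_poly n x * u ^ n)"
proof -
  have "nsum (\<lambda>p. if plane_part p \<and> pp_size p = n then ennreal (x ^ pp_trace p * u ^ n) else 0)
      = nsum (\<lambda>p. nsum (\<lambda>k. if k = pp_trace p then
          (if plane_part p \<and> pp_size p = n \<and> pp_trace p = k then ennreal (x ^ k * u ^ n) else 0)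
          else 0))"
    by (subst nsum_delta) (simp cong: if_cong)
  also have "\<dots> = nsum (\<lambda>k. nsum (\<lambda>p.
      if plane_part p \<and> pp_size p = n \<and> pp_trace p = k then ennreal (x ^ k * u ^ n) else 0))"
    by (subst nsum_swap, intro nn_integral_cong) auto
  also have "\<dots> = (\<Sum>k. of_nat (pp k n) * ennreal (x ^ k * u ^ n))"
    by (simp only: pp_nsum nn_integral_count_space_nat)
  also have "\<dots> = (\<Sum>k\<le>n. of_nat (pp k n) * ennreal (x ^ k * u ^ n))"
    by (rule suminf_finite) (auto simp: pp_eq_0)
  also have "\<dots> = ennreal (trace_poly n x * u ^ n)"
    using assms
    by (simp add: trace_poly_def sum_distrib_right sum_ennreal ennreal_of_nat_eq_real_of_nat
        ennreal_mult[symmetric] mult.assoc)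
  finally show ?thesis .
qed

lemma trace_gf_real:
  assumes x: "0 \<le> x" "x < 1" and u: "0 \<le> u" "u < 1"
  shows "(\<lambda>n. trace_poly n x * u ^ n) sums exp (log_gf x (u :: real))"
proof -
  have "ennreal (exp (log_gf x u)) = nsum (\<lambda>p. nsum (\<lambda>n. if n = pp_size p then
      (if plane_part p \<and> pp_size p = n then ennreal (x ^ pp_trace p * u ^ n) else 0) else 0))"
    unfolding plane_part_nsum[OF x u, symmetric] by (subst nsum_delta) (simp cong: if_cong)
  also have "\<dots> = nsum (\<lambda>n. nsum (\<lambda>p.
      if plane_part p \<and> pp_size p = n then ennreal (x ^ pp_trace p * u ^ n) else 0))"
    by (subst nsum_swap, intro nn_integral_cong) auto
  also have "\<dots> = (\<Sum>n. ennreal (trace_poly n x * u ^ n))"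
    using x u by (simp only: trace_poly_nsum nn_integral_count_space_nat)
  finally have suminf_eq: "(\<Sum>n. ennreal (trace_poly n x * u ^ n)) = ennreal (exp (log_gf x u))" ..
  have nonneg: "0 \<le> trace_poly n x * u ^ n" for n
    using x u by (intro mult_nonneg_nonneg trace_poly_nonneg) auto
  have "summable (\<lambda>n. trace_poly n x * u ^ n)"
    using suminf_eq nonneg by (intro summable_suminf_not_top) auto
  moreover from this have "ennreal (\<Sum>n. trace_poly n x * u ^ n) = ennreal (exp (log_gf x u))"
    using suminf_eq nonneg by (simp add: suminf_ennreal2)
  ultimately show ?thesis
    using nonneg by (simp add: sums_iff suminf_nonneg)
qed

lemma holomorphic_on_suminf:
  fixes h :: "nat \<Rightarrow> complex \<Rightarrow> complex" and b :: "complex \<Rightarrow> real"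
  assumes S: "open S" and h: "\<And>k. h k holomorphic_on S"
    and b: "continuous_on S b" "\<And>z. z \<in> S \<Longrightarrow> b z < 1"
    and dominated: "\<And>r. 0 < r \<Longrightarrow> r < 1 \<Longrightarrow>
      \<exists>M. summable M \<and> (\<forall>k. \<forall>z\<in>S. b z \<le> r \<longrightarrow> norm (h k z) \<le> M k)"
  shows "(\<lambda>z. \<Sum>k. h k z) holomorphic_on S"
proof (rule holomorphic_uniform_sequence[OF S])
  fix z assume z: "z \<in> S"
  define r where "r = (1 + max 0 (b z)) / 2"
  have r: "0 < r" "r < 1" "b z < r" using b(2)[OF z] by (auto simp: r_def)
  have "open (S \<inter> b -` {..<r})"
    by (rule continuous_open_preimage[OF b(1) S]) simp
  then obtain d where d: "d > 0" "cball z d \<subseteq> S \<inter> b -` {..<r}"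
    using z r by (metis IntI lessThan_iff open_contains_cball vimage_eq)
  obtain M where M: "summable M" "\<And>k z. z \<in> S \<Longrightarrow> b z \<le> r \<Longrightarrow> norm (h k z) \<le> M k"
    using dominated[OF r(1,2)] by blast
  have "uniform_limit (cball z d) (\<lambda>n z. \<Sum>k<n. h k z) (\<lambda>z. \<Sum>k. h k z) sequentially"
    by (rule Weierstrass_m_test[OF _ M(1)]) (use d M(2) in \<open>auto simp: less_imp_le subset_iff\<close>)
  thus "\<exists>d>0. cball z d \<subseteq> S \<and>
      uniform_limit (cball z d) (\<lambda>n z. \<Sum>k<n. h k z) (\<lambda>z. \<Sum>k. h k z) sequentially"
    using d by blast
qed (intro holomorphic_intros h)

lemma power_neq_1_if_norm_less_1:
  fixes u :: "'a :: real_normed_field"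
  assumes "norm u < 1" "n > 0"
  shows "u ^ n \<noteq> 1"
proof
  assume "u ^ n = 1"
  hence "norm u ^ n = 1" by (metis norm_one norm_power)
  thus False using assms power_less_one_iff[of "norm u" n] by simp
qed

lemma holomorphic_on_log_gf:
  assumes S: "open S" and f: "f holomorphic_on S" "\<And>z. z \<in> S \<Longrightarrow> norm (f z) < 1"
    and g: "g holomorphic_on S" "\<And>z. z \<in> S \<Longrightarrow> norm (g z) < 1"
  shows "(\<lambda>z. log_gf (f z) (g z)) holomorphic_on S"
  unfolding log_gf_def
proof (rule holomorphic_on_suminf[OF S, where b = "\<lambda>z. max (norm (f z)) (norm (g z))"])
  have "1 - g z ^ Suc k \<noteq> 0" if "z \<in> S" for z k
    using power_neq_1_if_norm_less_1[OF g(2)[OF that], of "Suc k"] by auto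
  thus "(\<lambda>z. log_gf_term (f z) (g z) k) holomorphic_on S" for k
    unfolding log_gf_term_def by (intro holomorphic_intros f g) (auto simp del: power_Suc)
  fix r :: real assume r: "0 < r" "r < 1"
  have "summable (\<lambda>k. r ^ Suc k / (1 - r) ^ 2)"
    using r by (intro summable_divide summable_power_Suc) auto
  thus "\<exists>M. summable M \<and> (\<forall>k. \<forall>z\<in>S. max (norm (f z)) (norm (g z)) \<le> r \<longrightarrow>
      norm (log_gf_term (f z) (g z) k) \<le> M k)"
    using norm_log_gf_term_le[OF _ _ r(2)] by (intro exI[of _ "\<lambda>k. r ^ Suc k / (1 - r) ^ 2"]) auto
qed (auto intro!: continuous_intros holomorphic_on_imp_continuous_on f g)

lemma norm_trace_poly_le:
  fixes x :: complex
  assumes "norm x \<le> s"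
  shows "norm (trace_poly n x) \<le> trace_poly n s"
  unfolding trace_poly_def
  by (rule order_trans[OF norm_sum], intro sum_mono)
     (use assms in \<open>auto simp: norm_mult norm_power intro!: mult_left_mono power_mono\<close>)

lemma norm_trace_gf_term_le:
  fixes x u :: complex
  assumes "norm x \<le> s" "norm u \<le> r"
  shows "norm (trace_poly n x * u ^ n) \<le> trace_poly n s * r ^ n"
proof -
  have "0 \<le> s" using assms(1) norm_ge_zero order_trans by blast
  thus ?thesis
    unfolding norm_mult norm_power using assms
    by (intro mult_mono power_mono norm_trace_poly_le trace_poly_nonneg) auto
qed

lemma holomorphic_on_trace_poly:
  assumes "f holomorphic_on S"
  shows "(\<lambda>z. trace_poly n (f z)) holomorphic_on S"
  unfolding trace_poly_def by (intro holomorphic_intros assms)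

lemma holomorphic_on_trace_gf:
  assumes S: "open S" and f: "f holomorphic_on S" "\<And>z. z \<in> S \<Longrightarrow> norm (f z) < 1"
    and g: "g holomorphic_on S" "\<And>z. z \<in> S \<Longrightarrow> norm (g z) < 1"
  shows "(\<lambda>z. \<Sum>n. trace_poly n (f z) * g z ^ n) holomorphic_on S"
proof (rule holomorphic_on_suminf[OF S, where b = "\<lambda>z. max (norm (f z)) (norm (g z))"])
  show "(\<lambda>z. trace_poly n (f z) * g z ^ n) holomorphic_on S" for n
    by (intro holomorphic_intros holomorphic_on_trace_poly f g)
  fix r :: real assume r: "0 < r" "r < 1"
  have "summable (\<lambda>n. trace_poly n r * r ^ n)"
    using trace_gf_real[of r r] r by (simp add: sums_iff)
  thus "\<exists>M. summable M \<and> (\<forall>n. \<forall>z\<in>S. max (norm (f z)) (norm (g z)) \<le> r \<longrightarrow>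
      norm (trace_poly n (f z) * g z ^ n) \<le> M n)"
    using norm_trace_gf_term_le by (intro exI[of _ "\<lambda>n. trace_poly n r * r ^ n"]) auto
qed (auto intro!: continuous_intros holomorphic_on_imp_continuous_on f g)

lemma summable_norm_trace_gf:
  fixes x u :: complex
  assumes "norm x < 1" "norm u < 1"
  shows "summable (\<lambda>n. norm (trace_poly n x * u ^ n))"
proof -
  have "summable (\<lambda>n. trace_poly n (norm x) * norm u ^ n)"
    using trace_gf_real[of "norm x" "norm u"] assms by (simp add: sums_iff)
  thus ?thesis
    by (rule summable_comparison_test'[of _ 0]) (simp add: norm_trace_gf_term_le)
qed

lemma islimpt_of_real_image_greaterThanLessThan:
  assumes "a < b" "b < c"
  shows "complex_of_real b islimpt complex_of_real ` {a<..<c}"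
proof -
  have "b islimpt {a<..<c}"
    using assms by (intro interior_limit_point) simp
  then obtain X where X: "\<And>n. X n \<in> {a<..<c} - {b}" "X \<longlonglongrightarrow> b"
    by (auto simp: islimpt_sequential)
  hence "(\<lambda>n. complex_of_real (X n)) \<longlonglongrightarrow> of_real b"
    by (intro tendsto_of_real)
  thus ?thesis
    unfolding islimpt_sequential using X(1) by (intro exI[of _ "\<lambda>n. complex_of_real (X n)"]) auto
qed

lemma holomorphic_eq_if_eq_on_unit_interval:
  assumes "f holomorphic_on ball 0 1" "g holomorphic_on ball 0 1"
    and "\<And>t. 0 < t \<Longrightarrow> t < 1 \<Longrightarrow> f (complex_of_real t) = g (complex_of_real t)"
    and "norm z < 1"
  shows "f z = g z"
proof -
  have "f z - g z = 0"
  proof (rule analytic_continuation[of "\<lambda>z. f z - g z"])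
    show "(\<lambda>z. f z - g z) holomorphic_on ball 0 1"
      by (intro holomorphic_intros assms)
    show "complex_of_real (1 / 2) islimpt complex_of_real ` {0<..<1}"
      by (rule islimpt_of_real_image_greaterThanLessThan) auto
  qed (use assms in auto)
  thus ?thesis by simp
qed

theorem trace_gf:
  fixes x u :: complex
  assumes "norm x < 1" "norm u < 1"
  shows "(\<lambda>n. trace_poly n x * u ^ n) sums exp (log_gf x u)"
proof -
  note holomorphic = holomorphic_on_trace_gf[OF open_ball] holomorphic_on_log_gf[OF open_ball]
  have real: "(\<Sum>n. trace_poly n (complex_of_real t) * complex_of_real v ^ n)
      = exp (log_gf (complex_of_real t) (complex_of_real v))"
    if "0 < t" "t < 1" "0 < v" "v < 1" for t v
  proof -
    have "(\<lambda>n. complex_of_real (trace_poly n t * v ^ n)) sums complex_of_real (exp (log_gf t v))"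
      using trace_gf_real[of t v] that by (simp only: sums_of_real_iff less_imp_le)
    thus ?thesis
      using that by (simp add: log_gf_of_real trace_poly_of_real sums_iff exp_of_real)
  qed
  have real_x: "(\<Sum>n. trace_poly n (complex_of_real t) * u ^ n) = exp (log_gf (complex_of_real t) u)"
    if "0 < t" "t < 1" for t
    by (rule holomorphic_eq_if_eq_on_unit_interval[OF _ _ _ assms(2),
          of "\<lambda>u. \<Sum>n. trace_poly n (of_real t) * u ^ n" "\<lambda>u. exp (log_gf (of_real t) u)"])
       (use that real in \<open>auto intro!: holomorphic holomorphic_intros\<close>)
  have "(\<Sum>n. trace_poly n x * u ^ n) = exp (log_gf x u)"
    by (rule holomorphic_eq_if_eq_on_unit_interval[OF _ _ _ assms(1),
          of "\<lambda>x. \<Sum>n. trace_poly n x * u ^ n" "\<lambda>x. exp (log_gf x u)"])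
       (use assms(2) real_x in \<open>auto intro!: holomorphic holomorphic_intros\<close>)
  thus ?thesis
    using summable_norm_cancel[OF summable_norm_trace_gf[OF assms]] by (simp add: sums_iff)
qed

section \<open>The trilogarithm\<close>

lemma inverse_square_le_telescope:
  fixes x :: real
  assumes "x > 1 / 2"
  shows "1 / x ^ 2 \<le> 1 / (x - 1 / 2) - 1 / (x + 1 / 2)"
proof -
  have "1 / (x - 1 / 2) - 1 / (x + 1 / 2) = 1 / (x ^ 2 - 1 / 4)"
    using assms by (simp add: field_simps power2_eq_square)
  moreover have "(1 / 2) ^ 2 < x ^ 2"
    using assms by (intro power_strict_mono) auto
  hence "1 / x ^ 2 \<le> 1 / (x ^ 2 - 1 / 4)"
    by (intro divide_left_mono mult_pos_pos) (auto simp: power2_eq_square)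
  ultimately show ?thesis by simp
qed

lemma inverse_square_bounded_suminf:
  fixes f :: "nat \<Rightarrow> 'a :: banach"
  assumes bound: "\<And>n. norm (f (Suc n)) \<le> D / real (Suc (Suc n)) ^ 2"
  shows "summable f" "norm (suminf f - f 0) \<le> 2 / 3 * D"
proof -
  define g where "g n = D * (1 / (real n + 3 / 2) - 1 / (real (Suc n) + 3 / 2))" for n
  have "(\<lambda>n. 1 / (real n + 3 / 2) - 1 / (real (Suc n) + 3 / 2)) sums (1 / (real 0 + 3 / 2) - 0)"
    by (rule telescope_sums') real_asymp
  hence g: "g sums (2 / 3 * D)"
    unfolding g_def mult.commute[of "2 / 3" D] by (intro sums_mult) simp
  have "D \<ge> 0"
    using order_trans[OF norm_ge_zero bound[of 0]] by (simp add: zero_le_divide_iff)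
  have term_le: "norm (f (Suc n)) \<le> g n" for n
  proof -
    have "D * (1 / real (Suc (Suc n)) ^ 2) \<le> g n"
      unfolding g_def using inverse_square_le_telescope[of "real n + 2"] \<open>D \<ge> 0\<close>
      by (intro mult_left_mono) (auto simp: add_ac)
    thus ?thesis using bound[of n] by simp
  qed
  have summable_norm_tail: "summable (\<lambda>n. norm (f (Suc n)))"
    by (rule summable_comparison_test'[OF sums_summable[OF g], of 0]) (use term_le in simp)
  hence "summable (\<lambda>n. f (Suc n))" by (rule summable_norm_cancel)
  thus summable: "summable f" by (subst (asm) summable_Suc_iff)
  have "norm (suminf f - f 0) = norm (\<Sum>n. f (Suc n))"
    using suminf_split_head[OF summable] by simp
  also have "\<dots> \<le> (\<Sum>n. norm (f (Suc n)))" by (rule summable_norm[OF summable_norm_tail])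
  also have "\<dots> \<le> suminf g" by (rule suminf_le[OF term_le summable_norm_tail sums_summable[OF g]])
  finally show "norm (suminf f - f 0) \<le> 2 / 3 * D" using g by (simp add: sums_iff)
qed

definition trilog :: "'a :: {real_normed_field, banach} \<Rightarrow> 'a" where
  "trilog y = (\<Sum>n. y ^ Suc n / of_nat (Suc n) ^ 3)"

lemma Li3_eq_trilog: "Li3 = trilog"
  by (simp add: Li3_def trilog_def fun_eq_iff)

lemma norm_trilog_tail_term_le:
  fixes y :: "'a :: {real_normed_field, banach}"
  assumes "norm y \<le> 1"
  shows "norm (y ^ Suc (Suc n) / of_nat (Suc (Suc n)) ^ 3) \<le> norm y / 2 / real (Suc (Suc n)) ^ 2"
proof -
  have "norm y ^ Suc (Suc n) \<le> norm y"
    using power_decreasing[of 1 "Suc (Suc n)" "norm y"] assms by simp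
  hence "norm (y ^ Suc (Suc n) / of_nat (Suc (Suc n)) ^ 3) \<le> norm y / real (Suc (Suc n)) ^ 3"
    unfolding norm_divide norm_power norm_of_nat by (rule divide_right_mono) simp
  also have "\<dots> \<le> norm y / (2 * real (Suc (Suc n)) ^ 2)"
    by (intro divide_left_mono mult_pos_pos)
       (auto simp: power3_eq_cube power2_eq_square intro!: mult_right_mono simp del: of_nat_Suc)
  finally show ?thesis by simp
qed

lemma trilog_sums:
  fixes y :: "'a :: {real_normed_field, banach}"
  assumes "norm y \<le> 1"
  shows "(\<lambda>n. y ^ Suc n / of_nat (Suc n) ^ 3) sums trilog y"
  unfolding trilog_def
  by (intro summable_sums inverse_square_bounded_suminf(1)[OF norm_trilog_tail_term_le] assms)

lemma norm_trilog_minus_id_le: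
  fixes y :: "'a :: {real_normed_field, banach}"
  assumes "norm y \<le> 1"
  shows "norm (trilog y - y) \<le> norm y / 3"
  using inverse_square_bounded_suminf(2)[of "\<lambda>n. y ^ Suc n / of_nat (Suc n) ^ 3",
      OF norm_trilog_tail_term_le[OF assms]]
  by (simp add: trilog_def)

lemma norm_trilog_bounds:
  fixes y :: "'a :: {real_normed_field, banach}"
  assumes "norm y \<le> 1"
  shows "2 / 3 * norm y \<le> norm (trilog y)" "norm (trilog y) \<le> 4 / 3 * norm y"
  using norm_trilog_minus_id_le[OF assms]
    norm_triangle_ineq2[of y "trilog y"] norm_triangle_ineq2[of "trilog y" y]
  by (auto simp: norm_minus_commute)

lemma trilog_real_bounds:
  fixes t :: real
  assumes "\<bar>t\<bar> \<le> 1"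
  shows "t - \<bar>t\<bar> / 3 \<le> trilog t" "trilog t \<le> t + \<bar>t\<bar> / 3"
proof -
  have "\<bar>trilog t - t\<bar> \<le> \<bar>t\<bar> / 3"
    using norm_trilog_minus_id_le[of t] assms by simp
  thus "t - \<bar>t\<bar> / 3 \<le> trilog t" "trilog t \<le> t + \<bar>t\<bar> / 3"
    by linarith+
qed

lemma trilog_sign:
  fixes t :: real
  assumes "0 < t" "t \<le> 1"
  shows "trilog t > 0" "trilog (- t) < 0"
  using trilog_real_bounds(1)[of t] trilog_real_bounds(2)[of "- t"] assms by auto

lemma trilog_of_real:
  assumes "\<bar>t\<bar> \<le> 1"
  shows "trilog (complex_of_real t) = of_real (trilog t)"
proof -
  have "(\<lambda>n. complex_of_real (t ^ Suc n / real (Suc n) ^ 3)) sums of_real (trilog t)"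
    using trilog_sums[of t] assms by (simp only: sums_of_real_iff real_norm_def of_nat_id)
  thus ?thesis
    using trilog_sums[of "complex_of_real t"] assms by (simp add: sums_iff)
qed

lemma abs_Im_power_le:
  assumes "norm x \<le> 1"
  shows "\<bar>Im (x ^ n)\<bar> \<le> real n * \<bar>Im x\<bar>"
proof (induction n)
  case (Suc n)
  have "\<bar>Im (x ^ Suc n)\<bar> \<le> \<bar>Re x\<bar> * \<bar>Im (x ^ n)\<bar> + \<bar>Im x\<bar> * \<bar>Re (x ^ n)\<bar>"
    by (simp add: abs_mult[symmetric] abs_triangle_ineq)
  also have "\<dots> \<le> 1 * (real n * \<bar>Im x\<bar>) + \<bar>Im x\<bar> * 1"
  proof (intro add_mono mult_mono Suc)
    show "\<bar>Re x\<bar> \<le> 1" using abs_Re_le_cmod[of x] assms by linarith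
    have "norm (x ^ n) \<le> 1" using assms by (simp add: norm_power power_le_one)
    thus "\<bar>Re (x ^ n)\<bar> \<le> 1" using abs_Re_le_cmod[of "x ^ n"] by linarith
  qed auto
  finally show ?case by (simp add: algebra_simps)
qed simp

lemma Im_trilog_nonzero:
  assumes "norm x \<le> 1" "Im x \<noteq> 0"
  shows "Im (trilog x) \<noteq> 0"
proof -
  define f where "f n = Im (x ^ Suc n) / real (Suc n) ^ 3" for n
  have "Im (x ^ Suc n / of_nat (Suc n) ^ 3) = f n" for n
    using Im_divide_of_real[of "x ^ Suc n" "real (Suc n) ^ 3"] by (simp add: f_def)
  hence "f sums Im (trilog x)"
    using sums_Im[OF trilog_sums[OF assms(1)]] by (simp only:)
  moreover have "norm (suminf f - f 0) \<le> 2 / 3 * \<bar>Im x\<bar>"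
  proof (rule inverse_square_bounded_suminf)
    fix n
    have "norm (f (Suc n)) \<le> real (Suc (Suc n)) * \<bar>Im x\<bar> / real (Suc (Suc n)) ^ 3"
      unfolding f_def real_norm_def abs_divide using abs_Im_power_le[OF assms(1), of "Suc (Suc n)"]
      by (simp add: divide_right_mono del: power_Suc of_nat_Suc)
    also have "\<dots> = \<bar>Im x\<bar> / real (Suc (Suc n)) ^ 2"
      by (simp add: power3_eq_cube power2_eq_square del: of_nat_Suc)
    finally show "norm (f (Suc n)) \<le> \<bar>Im x\<bar> / real (Suc (Suc n)) ^ 2" .
  qed
  ultimately show ?thesis using assms(2) by (auto simp: f_def sums_iff)
qed

lemma nonpos_Reals_if_trilog_nonpos_Reals:
  fixes y :: complex
  assumes "norm y \<le> 1" "trilog y \<in> \<real>\<^sub>\<le>\<^sub>0"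
  shows "y \<in> \<real>\<^sub>\<le>\<^sub>0"
proof -
  have trilog: "Im (trilog y) = 0" "Re (trilog y) \<le> 0"
    using assms(2) by (auto simp: complex_nonpos_Reals_iff)
  hence "Im y = 0" using Im_trilog_nonzero[OF assms(1)] by auto
  hence "norm y = \<bar>Re y\<bar>" by (simp add: cmod_eq_Re)
  moreover have "\<bar>Re (trilog y) - Re y\<bar> \<le> norm y / 3"
    using norm_trilog_minus_id_le[OF assms(1)] abs_Re_le_cmod[of "trilog y - y"] by simp
  ultimately have "Re y \<le> 0"
    using trilog(2) by linarith
  thus ?thesis
    using \<open>Im y = 0\<close> by (simp add: complex_nonpos_Reals_iff)
qed

lemma continuous_on_trilog:
  "continuous_on {y :: 'a :: {real_normed_field, banach}. norm y \<le> 1} trilog"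
proof -
  have "uniform_limit {y :: 'a. norm y \<le> 1} (\<lambda>n y. \<Sum>k<n. y ^ Suc k / of_nat (Suc k) ^ 3)
      (\<lambda>y. \<Sum>k. y ^ Suc k / of_nat (Suc k) ^ 3) sequentially"
  proof (rule Weierstrass_m_test)
    fix k and y :: 'a assume "y \<in> {y. norm y \<le> 1}"
    hence "norm y ^ Suc k \<le> 1 ^ Suc k" by (intro power_mono) auto
    thus "norm (y ^ Suc k / of_nat (Suc k) ^ 3) \<le> 1 ^ Suc k / real (Suc k) ^ 3"
      unfolding norm_divide norm_power norm_of_nat by (rule divide_right_mono) simp
  next
    show "summable (\<lambda>k. 1 ^ Suc k / real (Suc k) ^ 3)"
      using trilog_sums[of "1 :: real"] by (simp only: sums_iff norm_one order_refl of_nat_id)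
  qed
  thus ?thesis
    unfolding trilog_def[abs_def]
    by (rule uniform_limit_theorem[rotated])
       (auto intro!: always_eventually continuous_intros simp del: of_nat_Suc)
qed

lemma continuous_on_trilog_compose [continuous_intros]:
  assumes "continuous_on A f" "\<And>x. x \<in> A \<Longrightarrow> norm (f x) \<le> 1"
  shows "continuous_on A (\<lambda>x. trilog (f x))"
  by (rule continuous_on_compose2[OF continuous_on_trilog assms(1)]) (use assms(2) in auto)

section \<open>Cube roots and the functions \<open>L k\<close>\<close>

lemma Re_cube_root: "Re (w powr (1 / 3)) = norm (w powr (1 / 3)) * cos (Arg w / 3)"
  by (cases "w = 0") (simp_all add: powr_def Re_exp Arg_eq_Im_Ln)

lemma cube_root_cubed: "((w::complex) powr (1 / 3)) ^ 3 = w"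
  by (cases "w = 0") (simp_all add: powr_def exp_of_nat_mult[symmetric])

lemma cos_third_greater_half: "\<bar>t\<bar> < pi \<Longrightarrow> cos (t / 3) > 1 / 2"
proof -
  assume "\<bar>t\<bar> < pi"
  hence "cos (pi / 3) < cos \<bar>t / 3\<bar>"
    by (intro cos_monotone_0_pi) auto
  thus ?thesis by (simp only: cos_abs_real cos_60)
qed

lemma norm_cube_root_eq:
  assumes "w \<in> \<real>\<^sub>\<le>\<^sub>0"
  shows "norm (w powr (1 / 3)) = 2 * Re (w powr (1 / 3))"
proof (cases "w = 0")
  case False
  hence "Arg w = pi"
    using assms by (auto simp: complex_nonpos_Reals_iff Arg_eq_pi complex_eq_iff)
  thus ?thesis using Re_cube_root[of w] by (simp add: cos_60)
qed simp

lemma norm_cube_root_less: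
  assumes "w \<notin> \<real>\<^sub>\<le>\<^sub>0"
  shows "norm (w powr (1 / 3)) < 2 * Re (w powr (1 / 3))"
proof -
  have "w \<noteq> 0" "Arg w \<noteq> pi"
    using assms by (auto simp: Arg_eq_pi complex_nonpos_Reals_iff)
  hence "\<bar>Arg w\<bar> < pi" "norm (w powr (1 / 3)) > 0"
    using Arg_bounded[of w] by auto
  hence "norm (w powr (1 / 3)) * (1 / 2) < norm (w powr (1 / 3)) * cos (Arg w / 3)"
    by (intro mult_strict_left_mono cos_third_greater_half)
  thus ?thesis by (simp add: Re_cube_root)
qed

lemma Re_cube_root_nonneg_Reals:
  assumes "w \<in> \<real>\<^sub>\<ge>\<^sub>0"
  shows "Re (w powr (1 / 3)) = norm (w powr (1 / 3))"
proof (cases "w = 0")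
  case False
  hence "Arg w = 0"
    using assms by (auto simp: complex_nonneg_Reals_iff Arg_eq_0 complex_is_Real_iff)
  thus ?thesis using Re_cube_root[of w] by simp
qed simp

lemma L_eq_trilog: "L k x = (2 * trilog (x ^ k)) powr (1 / 3) / of_nat k"
  by (simp add: L_def Li3_eq_trilog)

lemma L_cubed: "L k x ^ 3 = 2 * trilog (x ^ k) / of_nat k ^ 3"
  by (simp add: L_eq_trilog power_divide cube_root_cubed)

lemma norm_L_cubed: "norm (L k x) ^ 3 = 2 * norm (trilog (x ^ k)) / real k ^ 3"
  unfolding norm_power[symmetric] L_cubed by (simp add: norm_divide norm_mult norm_power)

lemma norm_L_eq:
  assumes "trilog (x ^ k) \<in> \<real>\<^sub>\<le>\<^sub>0"
  shows "norm (L k x) = 2 * Re (L k x)"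
  using norm_cube_root_eq[of "2 * trilog (x ^ k)"] assms
  by (simp add: L_eq_trilog norm_divide complex_nonpos_Reals_iff)

lemma norm_L_less:
  assumes "trilog (x ^ k) \<notin> \<real>\<^sub>\<le>\<^sub>0" "k > 0"
  shows "norm (L k x) < 2 * Re (L k x)"
  using norm_cube_root_less[of "2 * trilog (x ^ k)"] assms
  by (simp add: L_eq_trilog norm_divide divide_strict_right_mono complex_nonpos_Reals_iff)

lemma norm_L_le: "norm (L k x) \<le> 2 * Re (L k x)"
  using norm_L_eq[of x k] norm_L_less[of x k]
  by (cases "k = 0"; cases "trilog (x ^ k) \<in> \<real>\<^sub>\<le>\<^sub>0") (simp_all add: L_def)

lemma Re_L_nonneg: "Re (L k x) \<ge> 0"
  using norm_L_le[of k x] norm_ge_zero[of "L k x"] by linarith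

lemma Re_L_eq_norm:
  assumes "trilog (x ^ k) \<in> \<real>\<^sub>\<ge>\<^sub>0"
  shows "Re (L k x) = norm (L k x)"
  using Re_cube_root_nonneg_Reals[of "2 * trilog (x ^ k)"] assms
  by (simp add: L_eq_trilog norm_divide complex_nonneg_Reals_iff)

lemma norm_L_less_norm_L_1:
  assumes "0 < norm x" "norm x < 1" "k \<ge> 2"
  shows "norm (L k x) < norm (L 1 x)"
proof (rule power_less_imp_less_base)
  have "norm (x ^ k) \<le> norm x"
    using assms power_decreasing[of 1 k "norm x"] by (simp add: norm_power)
  moreover from this have "norm (trilog (x ^ k)) \<le> 4 / 3 * norm (x ^ k)"
    using assms by (intro norm_trilog_bounds) auto
  ultimately have "2 * norm (trilog (x ^ k)) / real k ^ 3 \<le> 2 * (4 / 3 * norm x) / 2 ^ 3"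
    using assms by (intro frac_le power_mono) auto
  also have "\<dots> < 2 * (2 / 3 * norm x)"
    using assms by simp
  also have "\<dots> \<le> 2 * norm (trilog (x ^ 1))"
    using norm_trilog_bounds(1)[of x] assms by simp
  finally show "norm (L k x) ^ 3 < norm (L 1 x) ^ 3"
    by (simp only: norm_L_cubed of_nat_1 power_one div_by_1)
qed simp

lemma continuous_on_L:
  assumes "\<And>x. x \<in> X \<Longrightarrow> norm x \<le> 1" "\<And>x. x \<in> X \<Longrightarrow> trilog (x ^ k) \<notin> \<real>\<^sub>\<le>\<^sub>0" "k > 0"
  shows "continuous_on X (L k)"
  unfolding L_eq_trilog[abs_def] using assms
  by (intro continuous_intros)
     (auto simp: complex_nonpos_Reals_iff norm_power power_le_one)

section \<open>The phases\<close>

lemma phaseD: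
  assumes "x \<in> phase m"
  shows "0 < norm x" "norm x < 1" "k \<ge> 1 \<Longrightarrow> k \<noteq> m \<Longrightarrow> Re (L k x) < Re (L m x)"
  using assms by (auto simp: phase_def punctured_disk_def)

text \<open>\<open>crossing r\<close> has the sign of \<open>Re (L 2 (- r)) - Re (L 1 (- r))\<close>; dividing by \<open>r\<close> makes
  it increasing.\<close>

definition crossing :: "real \<Rightarrow> real" where
  "crossing r = (trilog (r ^ 2) + trilog (- r)) / r"

lemma crossing_sums:
  assumes "0 < r" "r \<le> 1"
  shows "(\<lambda>n. (r ^ (2 * n + 1) - (- r) ^ n) / real (Suc n) ^ 3) sums crossing r"
proof -
  have "(\<lambda>n. ((r ^ 2) ^ Suc n / real (Suc n) ^ 3 + (- r) ^ Suc n / real (Suc n) ^ 3) / r)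
      sums crossing r"
    unfolding crossing_def using assms
    by (intro sums_divide sums_add trilog_sums[of "r ^ 2" for r :: real, unfolded of_nat_id]
          trilog_sums[of "- r" for r :: real, unfolded of_nat_id])
       (auto simp: power_le_one)
  moreover have "((r ^ 2) ^ Suc n / real (Suc n) ^ 3 + (- r) ^ Suc n / real (Suc n) ^ 3) / r
      = (r ^ (2 * n + 1) - (- r) ^ n) / real (Suc n) ^ 3" for n
  proof -
    have "(r ^ 2) ^ Suc n = r * r ^ (2 * n + 1)"
      by (simp only: power_mult[symmetric] power_Suc[symmetric]) simp
    thus ?thesis
      using assms by (simp add: add_divide_distrib[symmetric] diff_divide_distrib del: of_nat_Suc)
  qed
  ultimately show ?thesis by simp
qed

lemma abs_power_diff_le:
  fixes a b :: real
  assumes "\<bar>a\<bar> \<le> 1" "\<bar>b\<bar> \<le> 1"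
  shows "\<bar>a ^ n - b ^ n\<bar> \<le> real n * \<bar>a - b\<bar>"
  using norm_power_diff[of a b n] assms by simp

lemma crossing_strict_mono:
  assumes "0 < r" "r < s" "s \<le> 1"
  shows "crossing r < crossing s"
proof -
  define d where "d n = (s ^ (2 * n + 1) - (- s) ^ n) / real (Suc n) ^ 3
      - (r ^ (2 * n + 1) - (- r) ^ n) / real (Suc n) ^ 3" for n
  define e where "e n = ((- r) ^ n - (- s) ^ n) / real (Suc n) ^ 3" for n
  have d: "d sums (crossing s - crossing r)"
    unfolding d_def using assms by (intro sums_diff crossing_sums) auto
  have e_bound: "norm (e (Suc n)) \<le> (s - r) / real (Suc (Suc n)) ^ 2" for n
  proof -
    have "\<bar>(- r) ^ Suc n - (- s) ^ Suc n\<bar> \<le> real (Suc n) * \<bar>- r - - s\<bar>"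
      using assms by (intro abs_power_diff_le) auto
    also have "\<dots> \<le> real (Suc (Suc n)) * (s - r)"
      using assms by (intro mult_mono) auto
    finally have "norm (e (Suc n)) \<le> real (Suc (Suc n)) * (s - r) / real (Suc (Suc n)) ^ 3"
      unfolding e_def real_norm_def abs_divide by (simp add: divide_right_mono del: power_Suc)
    thus ?thesis
      by (simp add: power3_eq_cube power2_eq_square del: of_nat_Suc)
  qed
  have e: "summable e" "\<bar>suminf e\<bar> \<le> 2 / 3 * (s - r)"
    using inverse_square_bounded_suminf[of e, OF e_bound] by (simp_all add: e_def)
  have "s - r = (\<Sum>n<1. d n - e n)"
    by (simp add: d_def e_def)
  also have "\<dots> \<le> (\<Sum>n. d n - e n)"
  proof (rule sum_le_suminf)
    show "summable (\<lambda>n. d n - e n)"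
      using d e by (intro summable_diff) (auto simp: sums_iff)
    have "d n - e n = (s ^ (2 * n + 1) - r ^ (2 * n + 1)) / real (Suc n) ^ 3" for n
      by (simp add: d_def e_def diff_divide_distrib)
    thus "0 \<le> d n - e n" if "n \<in> - {..<1}" for n
      using assms by (simp add: power_mono mult_mono)
  qed simp
  also have "\<dots> = crossing s - crossing r - suminf e"
    using d e by (simp add: suminf_diff[symmetric] sums_iff)
  finally have "s - r + suminf e \<le> crossing s - crossing r"
    by simp
  moreover have "- (2 / 3 * (s - r)) \<le> suminf e"
    using e(2) by (simp only: abs_le_iff minus_le_iff)
  ultimately show ?thesis
    using assms by argo
qed

lemma continuous_on_crossing: "continuous_on {0<..1} crossing"
  unfolding crossing_def[abs_def] by (intro continuous_intros) (auto simp: power_le_one)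

lemma crossing_quarter_neg: "crossing (1 / 4) < 0"
  using trilog_real_bounds(2)[of "1 / 16"] trilog_real_bounds(2)[of "- (1 / 4)"]
  by (simp add: crossing_def power2_eq_square)

lemma crossing_1_pos: "crossing 1 > 0"
proof -
  have sums: "(\<lambda>n. (1 - (- 1) ^ n) / real (Suc n) ^ 3) sums crossing 1"
    using crossing_sums[of 1] by simp
  have "0 < (\<Sum>n<2. (1 - (- 1) ^ n) / real (Suc n) ^ 3)"
    by (simp add: numeral_2_eq_2)
  also have "\<dots> \<le> (\<Sum>n. (1 - (- 1) ^ n) / real (Suc n) ^ 3)"
    using sums by (intro sum_le_suminf) (auto simp: sums_iff minus_one_power_iff)
  finally show ?thesis using sums by (simp add: sums_iff)
qed

lemma ex_crossing_root: "\<exists>r. 0 < r \<and> r < 1 \<and> crossing r = 0"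
proof -
  have "continuous_on {1 / 4..1} crossing"
    by (rule continuous_on_subset[OF continuous_on_crossing]) auto
  then obtain r where r: "1 / 4 \<le> r" "r \<le> 1" "crossing r = 0"
    using IVT'[of crossing "1 / 4" 0 1] crossing_quarter_neg crossing_1_pos by force
  moreover have "r \<noteq> 1" using r(3) crossing_1_pos by auto
  ultimately show ?thesis by (intro exI[of _ r]) auto
qed

lemma crossing_eq_iff:
  assumes "0 < r" "r < 1" "0 < s" "s < 1"
  shows "crossing r = crossing s \<longleftrightarrow> r = s"
  using crossing_strict_mono[of r s] crossing_strict_mono[of s r] assms
  by (cases r s rule: linorder_cases) auto

lemma Re_L_negative_cubes:
  assumes "0 < r" "r < 1"
  shows "(2 * Re (L 2 (- of_real r))) ^ 3 - (2 * Re (L 1 (- of_real r))) ^ 3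
    = 2 * (r * crossing r)"
proof -
  have r2: "0 < r ^ 2" "r ^ 2 < 1" using assms by (auto simp: power_less_one_iff)
  have signs: "trilog (- r) < 0" "trilog (r ^ 2) > 0"
    using trilog_sign(2)[of r] trilog_sign(1)[of "r ^ 2"] assms r2 by auto
  have trilog: "trilog (- complex_of_real r) = of_real (trilog (- r))"
      "trilog (complex_of_real r ^ 2) = of_real (trilog (r ^ 2))"
    using trilog_of_real[of "- r"] trilog_of_real[of "r ^ 2"] assms r2 by auto
  have "2 * Re (L 1 (- of_real r)) = norm (L 1 (- of_real r))"
    using signs by (subst norm_L_eq) (simp_all add: trilog)
  hence "(2 * Re (L 1 (- of_real r))) ^ 3 = 2 * - trilog (- r)"
    using signs norm_L_cubed[of 1 "- of_real r"] by (simp add: trilog)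
  moreover have "Re (L 2 (- of_real r)) = norm (L 2 (- of_real r))"
    using signs by (subst Re_L_eq_norm) (simp_all add: trilog)
  hence "(2 * Re (L 2 (- of_real r))) ^ 3 = 2 * trilog (r ^ 2)"
    using signs norm_L_cubed[of 2 "- of_real r"] by (simp add: trilog power_mult_distrib)
  ultimately show ?thesis
    using assms by (simp add: crossing_def)
qed

lemma Re_L_negative_iff:
  assumes "0 < r" "r < 1"
  shows "Re (L 1 (- of_real r)) < Re (L 2 (- of_real r)) \<longleftrightarrow> crossing r > 0"
    and "Re (L 1 (- of_real r)) = Re (L 2 (- of_real r)) \<longleftrightarrow> crossing r = 0"
proof -
  let ?a = "2 * Re (L 1 (- of_real r))" and ?b = "2 * Re (L 2 (- of_real r))"
  have "?a ^ 3 < ?b ^ 3 \<longleftrightarrow> ?a < ?b" "?a ^ 3 = ?b ^ 3 \<longleftrightarrow> ?a = ?b"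
    using Re_L_nonneg[of 1] Re_L_nonneg[of 2] power_eq_iff_eq_base[of 3 ?a ?b]
    by (auto intro!: power_strict_mono dest: power_less_imp_less_base)
  moreover have "?a ^ 3 < ?b ^ 3 \<longleftrightarrow> r * crossing r > 0" "?a ^ 3 = ?b ^ 3 \<longleftrightarrow> r * crossing r = 0"
    using Re_L_negative_cubes[OF assms] by linarith+
  ultimately show "Re (L 1 (- of_real r)) < Re (L 2 (- of_real r)) \<longleftrightarrow> crossing r > 0"
    and "Re (L 1 (- of_real r)) = Re (L 2 (- of_real r)) \<longleftrightarrow> crossing r = 0"
    using assms by (auto simp: zero_less_mult_iff)
qed

lemma Re_L_2_less_Re_L_1_positive:
  assumes "0 < t" "t < 1"
  shows "Re (L 2 (of_real t)) < Re (L 1 (of_real t))"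
proof -
  have "trilog (complex_of_real t ^ 1) \<in> \<real>\<^sub>\<ge>\<^sub>0"
    using trilog_of_real[of t] trilog_sign(1)[of t] assms by simp
  hence "Re (L 1 (of_real t)) = norm (L 1 (of_real t))"
    by (rule Re_L_eq_norm)
  thus ?thesis
    using norm_L_less_norm_L_1[of "of_real t" 2] complex_Re_le_cmod[of "L 2 (of_real t)"] assms
    by simp
qed

lemma xstar_eq:
  assumes r: "0 < r" "r < 1" "crossing r = 0"
  shows "xstar = - r"
  unfolding xstar_def
proof (rule the_equality)
  show "complex_of_real (- r) \<in> punctured_disk \<and>
      Re (L 1 (complex_of_real (- r))) = Re (L 2 (complex_of_real (- r)))"
    using r Re_L_negative_iff(2)[of r] by (simp add: punctured_disk_def)
  fix t assume t: "complex_of_real t \<in> punctured_disk \<and>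
      Re (L 1 (complex_of_real t)) = Re (L 2 (complex_of_real t))"
  hence "\<bar>t\<bar> < 1" "t \<noteq> 0" by (auto simp: punctured_disk_def)
  moreover have "\<not> t > 0"
    using t Re_L_2_less_Re_L_1_positive[of t] \<open>\<bar>t\<bar> < 1\<close> by auto
  ultimately have "0 < - t" "- t < 1" by auto
  thus "t = - r"
    using t Re_L_negative_iff(2)[of "- t"] crossing_eq_iff[of "- t" r] r by auto
qed

lemma xstar_le_negative_real_phase_1:
  assumes "complex_of_real t \<in> phase 1" "t < 0"
  shows "xstar \<le> t"
proof -
  obtain r where r: "0 < r" "r < 1" "crossing r = 0"
    using ex_crossing_root by blast
  have t: "0 < - t" "- t < 1" using phaseD(2)[OF assms(1)] assms(2) by auto
  have "\<not> r < - t"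
  proof
    assume "r < - t"
    hence "crossing (- t) > 0"
      using crossing_strict_mono[of r "- t"] r t by simp
    hence "Re (L 1 (of_real t)) < Re (L 2 (of_real t))"
      using Re_L_negative_iff(1)[of "- t"] t by simp
    thus False using phaseD(3)[OF assms(1), of 2] by simp
  qed
  thus ?thesis using xstar_eq[OF r] by simp
qed

lemma trilog_notin_nonpos_Reals_phase_1:
  assumes "x \<in> phase 1" "x \<notin> complex_of_real ` {xstar..0}"
  shows "trilog x \<notin> \<real>\<^sub>\<le>\<^sub>0"
proof
  assume "trilog x \<in> \<real>\<^sub>\<le>\<^sub>0"
  hence "x \<in> \<real>\<^sub>\<le>\<^sub>0"
    using nonpos_Reals_if_trilog_nonpos_Reals phaseD(2)[OF assms(1)] by simp
  then obtain t where t: "x = of_real t" "t \<le> 0"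
    by (auto simp: nonpos_Reals_def)
  moreover have "t \<noteq> 0" using t phaseD(1)[OF assms(1)] by auto
  ultimately have "xstar \<le> t"
    using xstar_le_negative_real_phase_1[of t] assms(1) by simp
  thus False using t assms(2) by auto
qed

lemma trilog_notin_nonpos_Reals_phase_2:
  assumes "x \<in> phase 2"
  shows "trilog (x ^ 2) \<notin> \<real>\<^sub>\<le>\<^sub>0"
proof
  assume "trilog (x ^ 2) \<in> \<real>\<^sub>\<le>\<^sub>0"
  hence "2 * Re (L 2 x) = norm (L 2 x)"
    by (simp add: norm_L_eq)
  also have "\<dots> < norm (L 1 x)"
    using phaseD[OF assms] by (intro norm_L_less_norm_L_1) auto
  also have "\<dots> \<le> 2 * Re (L 1 x)"
    by (rule norm_L_le)
  finally show False using phaseD(3)[OF assms, of 1] by simp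
qed

section \<open>The coefficient integral\<close>

lemma has_integral_exp_int_multiple:
  fixes k :: int and t :: real
  shows "((\<lambda>v. exp (of_int k * (of_real t + \<i> * of_real v))) has_integral
    (if k = 0 then 2 * of_real pi else 0)) {-pi..pi}"
proof (cases "k = 0")
  case True
  have "((\<lambda>v. 1 :: complex) has_integral (pi - (- pi)) *\<^sub>R 1) {-pi..pi}"
    using has_integral_const_real[of "1 :: complex" "-pi" pi] by simp
  thus ?thesis using True by (simp add: scaleR_conv_of_real)
next
  case False
  let ?e = "\<lambda>z. exp (of_int k * (of_real t + \<i> * z))"
  define F where "F z = ?e z / (of_int k * \<i>)" for z
  have "((\<lambda>v. ?e (of_real v)) has_integral (F (of_real pi) - F (of_real (- pi)))) {-pi..pi}"
  proof (rule fundamental_theorem_of_calculus)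
    fix v :: real
    have "(F has_field_derivative ?e (of_real v)) (at (of_real v))"
      unfolding F_def[abs_def] using False by (auto intro!: derivative_eq_intros)
    thus "((\<lambda>v. F (of_real v)) has_vector_derivative ?e (of_real v)) (at v within {-pi..pi})"
      by (rule has_vector_derivative_real_field)
  qed simp
  moreover have "?e (of_real pi) = ?e (of_real (- pi))"
  proof -
    have "of_int k * (of_real t + \<i> * of_real pi)
        = of_int k * (of_real t + \<i> * of_real (- pi)) + (of_int (2 * k) * pi) * \<i>"
      by (simp add: algebra_simps)
    thus ?thesis by (metis exp_eq)
  qed
  ultimately show ?thesis using False by (simp add: F_def)
qed

lemma has_integral_suminf:
  fixes f :: "nat \<Rightarrow> real \<Rightarrow> 'a :: banach"
  assumes integral: "\<And>m. (f m has_integral I m) {a..b}"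
    and continuous: "\<And>m. continuous_on {a..b} (f m)"
    and bound: "\<And>m v. v \<in> {a..b} \<Longrightarrow> norm (f m v) \<le> M m" "summable M"
    and sums: "I sums J"
  shows "((\<lambda>v. \<Sum>m. f m v) has_integral J) {a..b}"
proof -
  have "uniform_limit {a..b} (\<lambda>N v. \<Sum>m<N. f m v) (\<lambda>v. \<Sum>m. f m v) sequentially"
    by (rule Weierstrass_m_test[OF bound])
  moreover have "continuous_on {a..b} (\<lambda>v. \<Sum>m<N. f m v)" for N
    by (intro continuous_intros continuous)
  ultimately obtain I' J' where lim: "\<And>N. ((\<lambda>v. \<Sum>m<N. f m v) has_integral I' N) {a..b}"
      "((\<lambda>v. \<Sum>m. f m v) has_integral J') {a..b}" "I' \<longlonglongrightarrow> J'"
    by (rule uniform_limit_integral) auto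
  have "((\<lambda>v. \<Sum>m<N. f m v) has_integral (\<Sum>m<N. I m)) {a..b}" for N
    by (intro has_integral_sum integral) auto
  hence "I' = (\<lambda>N. \<Sum>m<N. I m)"
    using has_integral_unique[OF lim(1)] by blast
  hence "J' = J"
    using lim(3) sums LIMSEQ_unique by (auto simp: sums_def)
  thus ?thesis using lim(2) by simp
qed

lemma power_series_coefficient_integral:
  fixes a :: "nat \<Rightarrow> complex" and t :: real
  defines "s \<equiv> \<lambda>v. of_real t + \<i> * of_real v"
  assumes \<epsilon>: "norm \<epsilon> = 1" and summable: "summable (\<lambda>m. norm (a m) * exp (- t) ^ m)"
  shows "((\<lambda>v. exp (of_nat n * s v) * (\<Sum>m. a m * (\<epsilon> * exp (- s v)) ^ m))
    has_integral (2 * of_real pi * (\<epsilon> ^ n * a n))) {-pi..pi}"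
proof -
  define f where "f m v = a m * \<epsilon> ^ m * exp (of_int (int n - int m) * s v)" for m v
  have f_eq: "f m v = exp (of_nat n * s v) * (a m * (\<epsilon> * exp (- s v)) ^ m)" for m v
  proof -
    have "exp (of_int (int n - int m) * s v) = exp (of_nat n * s v) * exp (of_nat m * - s v)"
      by (simp add: exp_add[symmetric] algebra_simps)
    thus ?thesis
      by (simp only: f_def power_mult_distrib exp_of_nat_mult mult_ac)
  qed
  have norm_f: "norm (f m v) = exp (real n * t) * (norm (a m) * exp (- t) ^ m)" for m v
    unfolding f_eq by (simp add: norm_mult norm_power \<epsilon> s_def)
  have "((\<lambda>v. \<Sum>m. f m v) has_integral (2 * of_real pi * (\<epsilon> ^ n * a n))) {-pi..pi}"
  proof (rule has_integral_suminf)
    show "(f m has_integral (if m = n then 2 * of_real pi * (\<epsilon> ^ m * a m) else 0)) {-pi..pi}" for m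
      using has_integral_mult_right[OF has_integral_exp_int_multiple[of "int n - int m" t],
          of "a m * \<epsilon> ^ m"]
      by (cases "m = n") (simp_all add: f_def[abs_def] s_def mult_ac)
    show "continuous_on {-pi..pi} (f m)" for m
      unfolding f_def s_def by (intro continuous_intros)
    show "norm (f m v) \<le> exp (real n * t) * (norm (a m) * exp (- t) ^ m)" for m v
      by (simp only: norm_f order_refl)
    show "summable (\<lambda>m. exp (real n * t) * (norm (a m) * exp (- t) ^ m))"
      by (intro summable_mult summable)
  qed (rule sums_single)
  moreover have "(\<Sum>m. f m v) = exp (of_nat n * s v) * (\<Sum>m. a m * (\<epsilon> * exp (- s v)) ^ m)" for v
  proof -
    have "summable (\<lambda>m. norm (a m * (\<epsilon> * exp (- s v)) ^ m))"
      using summable by (simp add: norm_mult norm_power \<epsilon> s_def)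
    thus ?thesis
      unfolding f_eq by (rule suminf_mult[OF summable_norm_cancel])
  qed
  ultimately show ?thesis by simp
qed

lemma trace_poly_integral:
  fixes x \<epsilon> :: complex and t :: real
  defines "s \<equiv> \<lambda>v. of_real t + \<i> * of_real v"
  assumes x: "norm x < 1" and t: "t > 0" and \<epsilon>: "norm \<epsilon> = 1"
  shows "((\<lambda>v. exp (log_gf x (\<epsilon> * exp (- s v)) + of_nat n * s v))
    has_integral (2 * of_real pi * (\<epsilon> ^ n * trace_poly n x))) {-pi..pi}"
proof -
  have "summable (\<lambda>m. norm (trace_poly m x) * exp (- t) ^ m)"
    using summable_norm_trace_gf[of x "of_real (exp (- t))"] x t
    by (simp add: norm_mult norm_power del: of_real_exp)
  from power_series_coefficient_integral[OF \<epsilon> this, of n]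
  show ?thesis
  proof (rule has_integral_eq[rotated])
    fix v
    have "norm (\<epsilon> * exp (- s v)) < 1"
      using \<epsilon> t by (simp add: norm_mult s_def)
    from trace_gf[OF x this]
    show "exp (of_nat n * (of_real t + \<i> * of_real v))
          * (\<Sum>m. trace_poly m x * (\<epsilon> * exp (- (of_real t + \<i> * of_real v))) ^ m)
        = exp (log_gf x (\<epsilon> * exp (- s v)) + of_nat n * s v)"
      by (simp add: sums_iff exp_add s_def mult.commute)
  qed
qed

section \<open>The Koebe function near a root of unity\<close>

definition koebe :: "complex \<Rightarrow> complex \<Rightarrow> complex" where
  "koebe \<eta> z = \<eta> * exp (- z) / (1 - \<eta> * exp (- z)) ^ 2"

definition cone :: "real \<Rightarrow> complex set" where
  "cone M = {s. Re s > 0 \<and> norm s \<le> M * Re s}"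

lemma of_nat_mult_in_cone: "s \<in> cone M \<Longrightarrow> of_nat (Suc k) * s \<in> cone M"
  by (simp add: cone_def norm_mult mult.left_commute[of M] del: of_nat_Suc)

lemma log_gf_koebe_sums:
  assumes "norm x < 1" "Re s > 0" "norm \<epsilon> = 1"
  shows "(\<lambda>k. x ^ Suc k / of_nat (Suc k) * koebe (\<epsilon> ^ Suc k) (of_nat (Suc k) * s))
    sums log_gf x (\<epsilon> * exp (- s))"
proof -
  have "log_gf_term x (\<epsilon> * exp (- s)) k
      = x ^ Suc k / of_nat (Suc k) * koebe (\<epsilon> ^ Suc k) (of_nat (Suc k) * s)" for k
  proof -
    have "(\<epsilon> * exp (- s)) ^ Suc k = \<epsilon> ^ Suc k * exp (- (of_nat (Suc k) * s))"
      unfolding power_mult_distrib exp_of_nat_mult[symmetric] by simp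
    thus ?thesis by (simp only: log_gf_term_def koebe_def)
  qed
  moreover have "log_gf_term x (\<epsilon> * exp (- s)) sums log_gf x (\<epsilon> * exp (- s))"
    using assms by (intro log_gf_sums) (simp_all add: norm_mult)
  ultimately show ?thesis by (simp only: cong: sums_cong)
qed

lemma norm_koebe_le:
  assumes "norm \<eta> = 1" "Re z > 0"
  shows "norm (koebe \<eta> z) \<le> 4 / Re z ^ 2"
proof -
  define t where "t = Re z"
  define e where "e = exp (- t / 2)"
  have t: "t > 0" and e: "0 < e" "e < 1" and exp_t: "exp (- t) = e ^ 2"
    using assms by (auto simp: t_def e_def power2_eq_square exp_add[symmetric])
  have "e * (1 + t / 2) \<le> e * exp (t / 2)"
    using e by (intro mult_left_mono exp_ge_add_one_self) auto
  hence "e * (t / 2) \<le> 1 - e"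
    by (simp add: e_def exp_add[symmetric] algebra_simps)
  also have "\<dots> \<le> 1 - e ^ 2" using e by (simp add: power2_eq_square mult_left_le)
  also have "\<dots> \<le> norm (1 - \<eta> * exp (- z))"
    using norm_triangle_ineq2[of 1 "\<eta> * exp (- z)"] assms exp_t by (simp add: norm_mult t_def)
  finally have "(e * (t / 2)) ^ 2 \<le> norm (1 - \<eta> * exp (- z)) ^ 2"
    using e t by (intro power_mono) auto
  hence "norm (koebe \<eta> z) \<le> e ^ 2 / (e * (t / 2)) ^ 2"
    unfolding koebe_def norm_divide norm_power
    using assms e exp_t t by (intro frac_le) (auto simp: norm_mult t_def)
  also have "\<dots> = 4 / t ^ 2" using e t by (simp add: power_mult_distrib power_divide)
  finally show ?thesis by (simp add: t_def)
qed

lemma exp_norm_le_3: "norm z \<le> 1 \<Longrightarrow> exp (norm z) \<le> 3"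
  using exp_le order_trans by (metis exp_le_cancel_iff)

lemma norm_exp_minus_taylor_5_le:
  fixes z :: complex
  assumes "norm z \<le> 1"
  shows "norm (exp z - (\<Sum>i\<le>5. z ^ i / fact i)) \<le> norm z ^ 6 / 40"
proof -
  have "norm (exp z - (\<Sum>i\<le>5. z ^ i / fact i)) \<le> exp (norm z) * norm z ^ 6 / fact 5"
    using Taylor_exp_field[of z 5] by (simp add: eval_nat_numeral)
  also have "\<dots> \<le> 3 * norm z ^ 6 / fact 5"
    using exp_norm_le_3[OF assms] by (intro divide_right_mono mult_right_mono) auto
  finally show ?thesis by (simp add: fact_numeral)
qed

lemma norm_exp_add_exp_minus_expansion_le:
  fixes z :: complex
  assumes "norm z \<le> 1"
  shows "norm (exp z + exp (- z) - 2 - z ^ 2 - z ^ 4 / 12) \<le> norm z ^ 6 / 20"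
proof -
  have "exp z + exp (- z) - 2 - z ^ 2 - z ^ 4 / 12
      = (exp z - (\<Sum>i\<le>5. z ^ i / fact i)) + (exp (- z) - (\<Sum>i\<le>5. (- z) ^ i / fact i))"
    by (simp add: eval_nat_numeral fact_numeral algebra_simps)
  also have "norm \<dots> \<le> norm z ^ 6 / 40 + norm (- z) ^ 6 / 40"
    using assms by (intro norm_triangle_le add_mono norm_exp_minus_taylor_5_le) auto
  finally show ?thesis by simp
qed

lemma norm_exp_add_exp_minus_ge:
  fixes z :: complex
  assumes "norm z \<le> 1"
  shows "norm z ^ 2 / 2 \<le> norm (exp z + exp (- z) - 2)"
proof -
  define R where "R = exp z + exp (- z) - 2 - z ^ 2 - z ^ 4 / 12"
  have "norm (z ^ 2) \<le> norm (exp z + exp (- z) - 2) + norm (z ^ 4 / 12 + R)"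
    using norm_triangle_ineq4[of "exp z + exp (- z) - 2" "z ^ 4 / 12 + R"] by (simp add: R_def)
  also have "norm (z ^ 4 / 12 + R) \<le> norm z ^ 4 / 12 + norm z ^ 6 / 20"
    using norm_exp_add_exp_minus_expansion_le[OF assms]
    by (intro norm_triangle_le add_mono) (auto simp: R_def norm_divide norm_power)
  also have "\<dots> \<le> norm z ^ 2 / 12 + norm z ^ 2 / 20"
    using assms by (intro add_mono divide_right_mono power_decreasing) auto
  finally show ?thesis
    using zero_le_power2[of "norm z"] unfolding norm_power by linarith
qed

lemma koebe_1_eq: "koebe 1 z = 1 / (exp z + exp (- z) - 2)"
proof -
  have "(1 - exp (- z)) ^ 2 = exp (- z) * (exp z + exp (- z) - 2)"
    by (simp add: power2_eq_square algebra_simps exp_add[symmetric])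
  thus ?thesis by (simp add: koebe_def)
qed

lemma norm_koebe_1_expansion_le:
  assumes "norm z \<le> 1" "z \<noteq> 0"
  shows "norm (koebe 1 z - 1 / z ^ 2 + 1 / 12) \<le> norm z"
proof -
  define r where "r = norm z"
  define D where "D = exp z + exp (- z) - 2"
  define R where "R = D - z ^ 2 - z ^ 4 / 12"
  define E where "E = - R + z ^ 6 / 144 + z ^ 2 * R / 12"
  have r: "0 < r" "r \<le> 1" using assms by (auto simp: r_def)
  have D: "r ^ 2 / 2 \<le> norm D" and R: "norm R \<le> r ^ 6 / 20"
    unfolding D_def R_def r_def
    using norm_exp_add_exp_minus_ge norm_exp_add_exp_minus_expansion_le assms(1) by auto
  have "D \<noteq> 0" using D r by auto
  have "z ^ 2 - D + z ^ 2 * D / 12 = E"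
    by (simp add: R_def E_def field_simps power_add[symmetric])
  hence eq: "koebe 1 z - 1 / z ^ 2 + 1 / 12 = E / (z ^ 2 * D)"
    unfolding koebe_1_eq D_def[symmetric] using \<open>D \<noteq> 0\<close> assms(2) by (simp add: field_simps)
  have "norm E \<le> norm R + norm (z ^ 6 / 144) + norm (z ^ 2 * R / 12)"
    unfolding E_def by (intro norm_triangle_le[OF add_mono] norm_triangle_le[OF add_mono]) auto
  also have "\<dots> = norm R + r ^ 6 / 144 + r ^ 2 * norm R / 12"
    by (simp add: norm_mult norm_divide norm_power r_def)
  also have "\<dots> \<le> r ^ 6 / 20 + r ^ 6 / 144 + 1 * (r ^ 6 / 20) / 12"
    using R r by (intro add_mono divide_right_mono mult_mono) (auto simp: power_le_one)
  also have "\<dots> \<le> r ^ 6 / 2" using r by simp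
  finally have "norm (koebe 1 z - 1 / z ^ 2 + 1 / 12) \<le> (r ^ 6 / 2) / (r ^ 2 * (r ^ 2 / 2))"
    unfolding eq norm_divide norm_mult norm_power r_def[symmetric]
    using r D by (intro frac_le mult_left_mono mult_pos_pos) auto
  also have "\<dots> = r ^ 2" using r by (simp add: power_add[symmetric] field_simps)
  also have "\<dots> \<le> r" using r by (simp add: power2_eq_square mult_left_le)
  finally show ?thesis by (simp add: r_def)
qed

lemma norm_one_plus_exp_minus_ge_1:
  fixes z :: complex
  assumes "norm z \<le> 1"
  shows "1 \<le> norm (1 + exp (- z))"
proof -
  have "\<bar>Im z\<bar> \<le> 1" using assms abs_Im_le_cmod[of z] by linarith
  moreover have "1 < pi / 2" using pi_gt3 by linarith
  ultimately have "cos (Im z) > 0" by (intro cos_gt_zero_pi) auto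
  hence "1 \<le> Re (1 + exp (- z))" by (simp add: Re_exp)
  thus ?thesis using complex_Re_le_cmod order_trans by blast
qed

lemma norm_koebe_minus_1_expansion_le:
  assumes "norm z \<le> 1"
  shows "norm (koebe (- 1) z + 1 / 4) \<le> 3 * norm z"
proof -
  note ge_1 = norm_one_plus_exp_minus_ge_1[OF assms]
  hence "1 + exp (- z) \<noteq> 0" by auto
  hence "koebe (- 1) z + 1 / 4 = (1 - exp (- z)) ^ 2 / (4 * (1 + exp (- z)) ^ 2)"
    by (simp add: koebe_def divide_simps) (simp add: power2_eq_square algebra_simps)
  hence "norm (koebe (- 1) z + 1 / 4) = norm (1 - exp (- z)) ^ 2 / (4 * norm (1 + exp (- z)) ^ 2)"
    by (simp add: norm_divide norm_mult norm_power)
  also have "\<dots> \<le> (3 * norm z) ^ 2 / (4 * 1 ^ 2)"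
  proof (intro frac_le mult_left_mono power_mono ge_1)
    have "norm (exp (- z) - 1) \<le> exp (norm z) * norm z"
      using Taylor_exp_field[of "- z" 0] by simp
    also have "\<dots> \<le> 3 * norm z"
      by (intro mult_right_mono exp_norm_le_3 assms) simp
    finally show "norm (1 - exp (- z)) \<le> 3 * norm z" by (simp add: norm_minus_commute)
  qed auto
  also have "\<dots> \<le> 3 * norm z"
    using assms mult_left_le[of "norm z" "norm z"] norm_ge_zero[of z]
    by (simp add: power2_eq_square del: norm_ge_zero)
  finally show ?thesis .
qed

lemma norm_koebe_minus_le_on_cone:
  assumes z: "z \<in> cone M" and \<eta>: "norm \<eta> = 1"
    and near: "norm z \<le> 1 \<Longrightarrow> norm (koebe \<eta> z - m) \<le> 3 * norm z"
    and far: "norm z > 1 \<Longrightarrow> norm m \<le> 3"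
  shows "norm (koebe \<eta> z - m) \<le> (4 * M ^ 2 + 3) * norm z"
proof (cases "norm z \<le> 1")
  case True
  have "3 * norm z \<le> (4 * M ^ 2 + 3) * norm z" by (intro mult_right_mono) auto
  thus ?thesis using near[OF True] by linarith
next
  case False
  have Re: "Re z > 0" "1 \<le> M * Re z" using z False by (auto simp: cone_def)
  hence "1 \<le> (M * Re z) ^ 2" by (simp add: one_le_power)
  hence "4 / Re z ^ 2 \<le> 4 * M ^ 2"
    using Re by (simp add: power_mult_distrib divide_simps)
  hence "norm (koebe \<eta> z - m) \<le> 4 * M ^ 2 + 3"
    using norm_triangle_ineq4[of "koebe \<eta> z" m] norm_koebe_le[OF \<eta> Re(1)] far False by simp
  also have "\<dots> \<le> (4 * M ^ 2 + 3) * norm z"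
    using False mult_left_mono[of 1 "norm z" "4 * M ^ 2 + 3"] by simp
  finally show ?thesis .
qed

lemma norm_koebe_1_minus_le_on_cone:
  assumes "z \<in> cone M"
  shows "norm (koebe 1 z - (1 / z ^ 2 - 1 / 12)) \<le> (4 * M ^ 2 + 3) * norm z"
proof (rule norm_koebe_minus_le_on_cone[OF assms])
  have "z \<noteq> 0" using assms by (auto simp: cone_def)
  show "norm (koebe 1 z - (1 / z ^ 2 - 1 / 12)) \<le> 3 * norm z" if "norm z \<le> 1"
    using norm_koebe_1_expansion_le[OF that \<open>z \<noteq> 0\<close>] norm_ge_zero[of z]
    by (simp add: algebra_simps del: norm_ge_zero)
  assume "norm z > 1"
  hence "norm (1 / z ^ 2) \<le> 1"
    using one_le_power[of "norm z" 2] by (simp add: norm_divide norm_power divide_le_eq_1)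
  thus "norm (1 / z ^ 2 - 1 / 12) \<le> 3"
    using norm_triangle_ineq4[of "1 / z ^ 2" "1 / 12"] by simp
qed simp

lemma norm_koebe_minus_1_minus_le_on_cone:
  assumes "z \<in> cone M"
  shows "norm (koebe (- 1) z - (- 1 / 4)) \<le> (4 * M ^ 2 + 3) * norm z"
  by (rule norm_koebe_minus_le_on_cone[OF assms])
     (use norm_koebe_minus_1_expansion_le in auto)

section \<open>Expansions at 1 and -1\<close>

lemma sums_multiples:
  fixes f :: "nat \<Rightarrow> 'a :: real_normed_vector"
  assumes "q > 0" and sums: "(\<lambda>j. f (q * Suc j)) sums s"
  shows "(\<lambda>k. if q dvd Suc k then f (Suc k) else 0) sums s"
proof (rule sums_mono_reindex[THEN iffD1])
  let ?g = "\<lambda>j. q * Suc j - 1"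
  show "strict_mono ?g"
    using assms(1) by (auto simp: strict_mono_Suc_iff)
  have Suc_g: "Suc (?g j) = q * Suc j" for j
    using assms(1) by simp
  show "(if q dvd Suc n then f (Suc n) else 0) = 0" if "n \<notin> range ?g" for n
  proof -
    have False if "q dvd Suc n"
    proof -
      obtain j where "Suc n = q * j" using \<open>q dvd Suc n\<close> by blast
      moreover from this obtain i where "j = Suc i" by (cases j) auto
      ultimately have "n = ?g i" by simp
      thus False using \<open>n \<notin> range ?g\<close> by blast
    qed
    thus ?thesis by auto
  qed
  show "(\<lambda>j. if q dvd Suc (?g j) then f (Suc (?g j)) else 0) sums s"
    using sums unfolding Suc_g by simp
qed

lemma trilog_sums_multiples:
  fixes x :: "'a :: {real_normed_field, banach}"
  assumes "norm x \<le> 1" "q > 0"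
  shows "(\<lambda>k. if q dvd Suc k then x ^ Suc k / of_nat (Suc k) ^ 3 else 0)
    sums (trilog (x ^ q) / of_nat q ^ 3)"
proof (rule sums_multiples[OF assms(2)])
  have "(\<lambda>j. (x ^ q) ^ Suc j / of_nat (Suc j) ^ 3 / of_nat q ^ 3)
      sums (trilog (x ^ q) / of_nat q ^ 3)"
    using assms by (intro sums_divide trilog_sums) (auto simp: norm_power power_le_one)
  thus "(\<lambda>j. x ^ (q * Suc j) / of_nat (q * Suc j) ^ 3) sums (trilog (x ^ q) / of_nat q ^ 3)"
    by (simp only: power_mult of_nat_mult power_mult_distrib divide_divide_eq_left mult.commute)
qed

lemma Ln_one_minus_sums_multiples:
  assumes "norm x < 1" "q > 0"
  shows "(\<lambda>k. if q dvd Suc k then x ^ Suc k / of_nat (Suc k) else 0)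
    sums (- Ln (1 - x ^ q) / of_nat q)"
proof (rule sums_multiples[OF assms(2)])
  have "(\<lambda>j. (x ^ q) ^ Suc j / of_nat (Suc j) / of_nat q) sums (- Ln (1 - x ^ q) / of_nat q)"
    using assms by (intro sums_divide Ln_one_minus_sums) (auto simp: norm_power power_less_one_iff)
  thus "(\<lambda>j. x ^ (q * Suc j) / of_nat (q * Suc j)) sums (- Ln (1 - x ^ q) / of_nat q)"
    by (simp only: power_mult of_nat_mult divide_divide_eq_left mult.commute)
qed

lemma norm_log_gf_minus_le:
  assumes r: "r < 1" and x: "norm x \<le> r" and s: "Re s > 0" and \<epsilon>: "norm \<epsilon> = 1" and "0 \<le> B"
    and m: "\<And>k. norm (koebe (\<epsilon> ^ Suc k) (of_nat (Suc k) * s) - m k)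
      \<le> B * norm (of_nat (Suc k) * s)"
    and A: "(\<lambda>k. x ^ Suc k / of_nat (Suc k) * m k) sums A"
  shows "norm (log_gf x (\<epsilon> * exp (- s)) - A) \<le> B * (r / (1 - r)) * norm s"
proof -
  have "0 \<le> r" using x norm_ge_zero order_trans by blast
  define t where
    "t k = x ^ Suc k / of_nat (Suc k) * (koebe (\<epsilon> ^ Suc k) (of_nat (Suc k) * s) - m k)" for k
  have t: "t sums (log_gf x (\<epsilon> * exp (- s)) - A)"
    unfolding t_def right_diff_distrib
    using x r s \<epsilon> by (intro sums_diff log_gf_koebe_sums A) auto
  have norm_t: "norm (t k) \<le> B * norm s * r ^ Suc k" for k
  proof -
    have "norm (t k) \<le> (r ^ Suc k / real (Suc k)) * (B * norm (of_nat (Suc k) * s))"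
      unfolding t_def norm_mult[of "x ^ Suc k / of_nat (Suc k)"] norm_divide norm_power norm_of_nat
      using m[of k] x \<open>0 \<le> r\<close> by (intro mult_mono divide_right_mono power_mono) auto
    also have "\<dots> = B * norm s * r ^ Suc k"
      unfolding norm_mult norm_of_nat by (simp del: of_nat_Suc power_Suc)
    finally show ?thesis .
  qed
  have "(\<lambda>k. r ^ Suc k) sums (r / (1 - r))"
    using sums_mult[OF geometric_sums[of r], of r] r \<open>0 \<le> r\<close> by simp
  hence geometric: "(\<lambda>k. B * norm s * r ^ Suc k) sums (B * norm s * (r / (1 - r)))"
    by (rule sums_mult)
  have "norm (suminf t) \<le> (\<Sum>k. B * norm s * r ^ Suc k)"
    by (rule norm_suminf_le[OF norm_t sums_summable[OF geometric]])
  thus ?thesis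
    using t geometric by (simp add: sums_iff mult_ac)
qed

lemma log_gf_expansion_at_1:
  assumes r: "r < 1" and x: "norm x \<le> r" and s: "s \<in> cone M"
  shows "norm (log_gf x (1 * exp (- s)) - (L 1 x ^ 3 / (2 * s ^ 2) + Ln (1 - x) / 12))
    \<le> (4 * M ^ 2 + 3) * (r / (1 - r)) * norm s"
proof (rule norm_log_gf_minus_le[OF r x])
  let ?m = "\<lambda>k. 1 / (of_nat (Suc k) * s) ^ 2 - 1 / 12"
  show "norm (koebe (1 ^ Suc k) (of_nat (Suc k) * s) - ?m k)
      \<le> (4 * M ^ 2 + 3) * norm (of_nat (Suc k) * s)" for k
    using norm_koebe_1_minus_le_on_cone[OF of_nat_mult_in_cone[OF s]] by (simp only: power_one)
  show "Re s > 0" using s by (simp add: cone_def)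
  hence "s \<noteq> 0" by auto
  have "(\<lambda>k. x ^ Suc k / of_nat (Suc k) ^ 3 / s ^ 2 - x ^ Suc k / of_nat (Suc k) / 12)
      sums (trilog x / s ^ 2 - (- Ln (1 - x)) / 12)"
    using x r by (intro sums_diff sums_divide Ln_one_minus_sums trilog_sums) auto
  moreover have "x ^ Suc k / of_nat (Suc k) ^ 3 / s ^ 2 - x ^ Suc k / of_nat (Suc k) / 12
     = x ^ Suc k / of_nat (Suc k) * ?m k" for k
    using \<open>s \<noteq> 0\<close>
    by (simp add: field_simps power2_eq_square power3_eq_cube del: of_nat_Suc power_Suc)
  moreover have "trilog x / s ^ 2 = L 1 x ^ 3 / (2 * s ^ 2)"
    using L_cubed[of 1 x] by simp
  ultimately show "(\<lambda>k. x ^ Suc k / of_nat (Suc k) * ?m k)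
      sums (L 1 x ^ 3 / (2 * s ^ 2) + Ln (1 - x) / 12)"
    by simp
qed auto

lemma Ln_one_minus_div_one_plus:
  assumes "norm x < 1"
  shows "Ln ((1 - x) / (1 + x)) = 2 * Ln (1 - x) - Ln (1 - x ^ 2)"
proof -
  have Re: "Re (1 - x) > 0" "Re (1 + x) > 0"
    using assms abs_Re_le_cmod[of x] by auto
  hence nonzero: "1 - x \<noteq> 0" "1 + x \<noteq> 0" by (metis less_irrefl zero_complex.sel(1))+
  have Im: "\<bar>Im (Ln (1 - x))\<bar> < pi / 2" "\<bar>Im (Ln (1 + x))\<bar> < pi / 2"
    using Re_Ln_pos_lt nonzero Re by auto
  have "Ln ((1 - x) * (1 + x)) = Ln (1 - x) + Ln (1 + x)"
    using Im nonzero by (intro Ln_times_simple) auto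
  moreover have "(1 - x) * (1 + x) = 1 - x ^ 2" by (simp add: power2_eq_square algebra_simps)
  moreover have "Ln ((1 - x) / (1 + x)) = Ln (1 - x) - Ln (1 + x)"
  proof (rule Ln_unique)
    show "exp (Ln (1 - x) - Ln (1 + x)) = (1 - x) / (1 + x)"
      using nonzero by (simp add: exp_diff)
  qed (use Im in auto)
  ultimately show ?thesis by simp
qed

lemma log_gf_expansion_at_minus_1:
  assumes r: "r < 1" and x: "norm x \<le> r" and s: "s \<in> cone M"
  shows "norm (log_gf x (- 1 * exp (- s))
      - (L 2 x ^ 3 / (2 * s ^ 2) + (Ln (1 - x ^ 2) / 24 + Ln ((1 - x) / (1 + x)) / 8)))
    \<le> (4 * M ^ 2 + 3) * (r / (1 - r)) * norm s"
proof (rule norm_log_gf_minus_le[OF r x])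
  let ?m = "\<lambda>k. if 2 dvd Suc k then 1 / (of_nat (Suc k) * s) ^ 2 - 1 / 12 else - 1 / 4"
  let ?A = "L 2 x ^ 3 / (2 * s ^ 2) + (Ln (1 - x ^ 2) / 24 + Ln ((1 - x) / (1 + x)) / 8)"
  show "norm (koebe ((- 1) ^ Suc k) (of_nat (Suc k) * s) - ?m k)
      \<le> (4 * M ^ 2 + 3) * norm (of_nat (Suc k) * s)" for k
    using norm_koebe_1_minus_le_on_cone[OF of_nat_mult_in_cone[OF s, of k]]
      norm_koebe_minus_1_minus_le_on_cone[OF of_nat_mult_in_cone[OF s, of k]]
    by (simp add: minus_one_power_iff del: of_nat_Suc power_Suc)
  show "Re s > 0" using s by (simp add: cone_def)
  hence "s \<noteq> 0" by auto
  have x1: "norm x < 1" using x r by simp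
  let ?even = "\<lambda>j k. if 2 dvd Suc k then x ^ Suc k / of_nat (Suc k) ^ j else 0"
  have "(\<lambda>k. ?even 3 k / s ^ 2 - ?even 1 k / 12 - (x ^ Suc k / of_nat (Suc k) - ?even 1 k) / 4)
     sums (trilog (x ^ 2) / of_nat 2 ^ 3 / s ^ 2 - (- Ln (1 - x ^ 2) / of_nat 2) / 12
       - (- Ln (1 - x) - (- Ln (1 - x ^ 2) / of_nat 2)) / 4)"
    unfolding power_one_right using x1
    by (intro sums_diff sums_divide Ln_one_minus_sums Ln_one_minus_sums_multiples
          trilog_sums_multiples) auto
  moreover have "?even 3 k / s ^ 2 - ?even 1 k / 12 - (x ^ Suc k / of_nat (Suc k) - ?even 1 k) / 4
     = x ^ Suc k / of_nat (Suc k) * ?m k" for k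
    using \<open>s \<noteq> 0\<close>
    by (simp add: field_simps power2_eq_square power3_eq_cube del: of_nat_Suc power_Suc)
  moreover have "trilog (x ^ 2) / of_nat 2 ^ 3 / s ^ 2 - (- Ln (1 - x ^ 2) / of_nat 2) / 12
       - (- Ln (1 - x) - (- Ln (1 - x ^ 2) / of_nat 2)) / 4 = ?A"
    unfolding L_cubed Ln_one_minus_div_one_plus[OF x1] using \<open>s \<noteq> 0\<close> by (simp add: field_simps)
  ultimately show "(\<lambda>k. x ^ Suc k / of_nat (Suc k) * ?m k) sums ?A"
    by (simp only:)
qed auto

section \<open>The saddle of \<open>c\<^sup>3 / \<sigma>\<^sup>2\<close>\<close>

text \<open>On a vertical line, \<open>Re (c\<^sup>3 / \<sigma>\<^sup>2)\<close> is maximal at height \<open>Im \<sigma> / Re \<sigma> = Im c / Re c\<close>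
  as soon as \<open>\<bar>Arg c\<bar> \<le> pi / 3\<close>, that is \<open>norm c \<le> 2 * Re c\<close>, which is what the principal cube root
  guarantees.\<close>

definition saddle_defect :: "real \<Rightarrow> real \<Rightarrow> real" where
  "saddle_defect p y = (y - p) ^ 2 * (3 - p ^ 2 + (y + p) ^ 2) / (1 + y ^ 2) ^ 2"

lemma Re_cube_div_square_slopes:
  "Re (Complex 1 p ^ 3 / Complex 1 y ^ 2) = 1 - saddle_defect p y"
proof -
  have "1 + y ^ 2 \<noteq> 0" by (simp add: add_nonneg_eq_0_iff)
  have "Complex 1 y * Complex 1 (- y) = of_real (1 + y ^ 2)"
    by (simp add: complex_eq_iff power2_eq_square)
  hence denominator: "Complex 1 y ^ 2 * Complex 1 (- y) ^ 2 = of_real ((1 + y ^ 2) ^ 2)"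
    by (metis of_real_power power_mult_distrib)
  have "Complex 1 y \<noteq> 0" "Complex 1 (- y) \<noteq> 0" by (auto simp: complex_eq_iff)
  hence "Complex 1 p ^ 3 / Complex 1 y ^ 2
      = Complex 1 p ^ 3 * Complex 1 (- y) ^ 2 / of_real ((1 + y ^ 2) ^ 2)"
    unfolding denominator[symmetric] by simp
  hence "Re (Complex 1 p ^ 3 / Complex 1 y ^ 2)
      = Re (Complex 1 p ^ 3 * Complex 1 (- y) ^ 2) / (1 + y ^ 2) ^ 2"
    by (simp only: Re_divide_of_real)
  also have "Re (Complex 1 p ^ 3 * Complex 1 (- y) ^ 2)
      = (1 + y ^ 2) ^ 2 - (y - p) ^ 2 * (3 - p ^ 2 + (y + p) ^ 2)"
    by (simp add: power2_eq_square power3_eq_cube algebra_simps)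
  also have "\<dots> / (1 + y ^ 2) ^ 2 = 1 - saddle_defect p y"
    using \<open>1 + y ^ 2 \<noteq> 0\<close> by (simp add: saddle_defect_def diff_divide_distrib)
  finally show ?thesis .
qed

lemma Re_cube_div_square:
  assumes "Re c > 0" "Re \<sigma> > 0"
  shows "Re (c ^ 3 / \<sigma> ^ 2)
    = Re c ^ 3 / Re \<sigma> ^ 2 * (1 - saddle_defect (Im c / Re c) (Im \<sigma> / Re \<sigma>))"
proof -
  have "z = of_real (Re z) * Complex 1 (Im z / Re z)" if "Re z > 0" for z
    using that by (auto simp: complex_eq_iff)
  from this[OF assms(1)] this[OF assms(2)]
  have "c ^ 3 / \<sigma> ^ 2 = of_real (Re c ^ 3 / Re \<sigma> ^ 2)
      * (Complex 1 (Im c / Re c) ^ 3 / Complex 1 (Im \<sigma> / Re \<sigma>) ^ 2)"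
    by (metis of_real_divide of_real_power power_mult_distrib times_divide_times_eq)
  thus ?thesis
    by (simp only: Re_complex_of_real Im_complex_of_real times_complex.sel mult_zero_left diff_zero
        Re_cube_div_square_slopes)
qed

lemma slope_square_le_3:
  assumes "norm c \<le> 2 * Re c" "Re c > 0"
  shows "(Im c / Re c) ^ 2 \<le> 3"
proof -
  have "norm c ^ 2 \<le> (2 * Re c) ^ 2" using assms by (intro power_mono) auto
  hence "Im c ^ 2 \<le> 3 * Re c ^ 2" unfolding cmod_power2 power_mult_distrib by simp
  thus ?thesis using assms(2) by (simp add: power_divide divide_le_eq)
qed

lemma slope_square_less_3:
  assumes "norm c < 2 * Re c"
  shows "(Im c / Re c) ^ 2 < 3"
proof -
  have "Re c > 0" using assms norm_ge_zero[of c] by linarith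
  have "norm c ^ 2 < (2 * Re c) ^ 2" using assms by (intro power_strict_mono) auto
  hence "Im c ^ 2 < 3 * Re c ^ 2" unfolding cmod_power2 power_mult_distrib by simp
  thus ?thesis using \<open>Re c > 0\<close> by (simp add: power_divide divide_less_eq)
qed

lemma saddle_defect_nonneg: "p ^ 2 \<le> 3 \<Longrightarrow> 0 \<le> saddle_defect p y"
  by (simp add: saddle_defect_def)

lemma saddle_defect_ge_bounded:
  assumes p: "p ^ 2 < 3" and "0 \<le> \<eta>" "\<bar>y - p\<bar> \<ge> \<eta>" "\<bar>y\<bar> \<le> 4"
  shows "\<eta> ^ 2 * (3 - p ^ 2) / 289 \<le> saddle_defect p y"
proof -
  have "\<eta> ^ 2 \<le> (y - p) ^ 2"
    using assms by (metis abs_le_square_iff abs_of_nonneg)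
  moreover have "y ^ 2 \<le> 4 ^ 2" using assms by (metis abs_le_square_iff abs_numeral)
  hence "(1 + y ^ 2) ^ 2 \<le> 17 ^ 2" by (intro power_mono) auto
  moreover have "0 < (1 + y ^ 2) ^ 2" by (intro zero_less_power add_pos_nonneg) auto
  ultimately show ?thesis
    unfolding saddle_defect_def using p by (intro frac_le mult_mono) auto
qed

lemma saddle_defect_ge_unbounded:
  assumes p: "p ^ 2 < 3" and "\<bar>y\<bar> > 4"
  shows "1 / 64 \<le> saddle_defect p y"
proof -
  have "\<bar>p\<bar> \<le> 2" using p abs_le_square_iff[of p 2] by simp
  hence "\<bar>y\<bar> / 2 \<le> \<bar>y - p\<bar>" "\<bar>y\<bar> / 2 \<le> \<bar>y + p\<bar>" using assms by linarith+
  from this[THEN power_mono, of 2]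
  have "y ^ 2 / 4 \<le> (y - p) ^ 2" "y ^ 2 / 4 \<le> (y + p) ^ 2"
    by (auto simp: power_divide)
  hence "y ^ 2 / 4 * (y ^ 2 / 4) \<le> (y - p) ^ 2 * (3 - p ^ 2 + (y + p) ^ 2)"
    using p by (intro mult_mono) auto
  moreover have "1 \<le> y ^ 2" using assms abs_le_square_iff[of 1 y] by simp
  hence "(1 + y ^ 2) ^ 2 \<le> (2 * y ^ 2) ^ 2" by (intro power_mono) auto
  moreover have "0 < (1 + y ^ 2) ^ 2" by (intro zero_less_power add_pos_nonneg) auto
  ultimately have "y ^ 2 / 4 * (y ^ 2 / 4) / (2 * y ^ 2) ^ 2 \<le> saddle_defect p y"
    unfolding saddle_defect_def using p by (intro frac_le) auto
  moreover have "y ^ 2 / 4 * (y ^ 2 / 4) / (2 * y ^ 2) ^ 2 = 1 / 64"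
    using assms(2) by (simp add: power2_eq_square)
  ultimately show ?thesis by simp
qed

lemma saddle_defect_gap:
  assumes "p ^ 2 < 3" "\<eta> > 0"
  shows "\<exists>\<delta>>0. \<forall>y. \<bar>y - p\<bar> \<ge> \<eta> \<longrightarrow> \<delta> \<le> saddle_defect p y"
proof (intro exI conjI allI impI)
  let ?\<delta> = "min (\<eta> ^ 2 * (3 - p ^ 2) / 289) (1 / 64)"
  show "?\<delta> > 0" using assms by simp
  show "?\<delta> \<le> saddle_defect p y" if "\<bar>y - p\<bar> \<ge> \<eta>" for y
    using saddle_defect_ge_bounded[OF assms(1) _ that] saddle_defect_ge_unbounded[OF assms(1), of y]
      assms(2) by (cases "\<bar>y\<bar> \<le> 4") (auto simp: min_le_iff_disj)
qed

lemma Re_cube_div_square_le: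
  assumes "norm c \<le> 2 * Re c" "Re \<sigma> > 0"
  shows "Re (c ^ 3 / \<sigma> ^ 2) \<le> Re c ^ 3 / Re \<sigma> ^ 2"
proof (cases "Re c > 0")
  case True
  have "Re c ^ 3 / Re \<sigma> ^ 2 * (1 - saddle_defect (Im c / Re c) (Im \<sigma> / Re \<sigma>))
      \<le> Re c ^ 3 / Re \<sigma> ^ 2 * 1"
    using True saddle_defect_nonneg[OF slope_square_le_3[OF assms(1) True]]
    by (intro mult_left_mono) auto
  thus ?thesis using True assms(2) by (simp add: Re_cube_div_square)
next
  case False
  hence "norm c \<le> 0" using assms(1) by linarith
  thus ?thesis by simp
qed

lemma Re_cube_div_square_gap:
  assumes "norm c < 2 * Re c" "\<eta> > 0"
  shows "\<exists>\<delta>>0. \<forall>\<sigma>. Re \<sigma> > 0 \<longrightarrow> \<bar>Im \<sigma> / Re \<sigma> - Im c / Re c\<bar> \<ge> \<eta> \<longrightarrow>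
    Re (c ^ 3 / \<sigma> ^ 2) \<le> (1 - \<delta>) * (Re c ^ 3 / Re \<sigma> ^ 2)"
proof -
  have "Re c > 0" using assms(1) norm_ge_zero[of c] by linarith
  obtain \<delta> where \<delta>: "\<delta> > 0"
      "\<And>y. \<bar>y - Im c / Re c\<bar> \<ge> \<eta> \<Longrightarrow> \<delta> \<le> saddle_defect (Im c / Re c) y"
    using saddle_defect_gap[OF slope_square_less_3[OF assms(1)] assms(2)] by blast
  have "Re c ^ 3 / Re \<sigma> ^ 2 * (1 - saddle_defect (Im c / Re c) (Im \<sigma> / Re \<sigma>))
      \<le> Re c ^ 3 / Re \<sigma> ^ 2 * (1 - \<delta>)"
    if "Re \<sigma> > 0" "\<bar>Im \<sigma> / Re \<sigma> - Im c / Re c\<bar> \<ge> \<eta>" for \<sigma>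
    using \<delta>(2)[OF that(2)] \<open>Re c > 0\<close> by (intro mult_left_mono) auto
  thus ?thesis
    using \<delta>(1) \<open>Re c > 0\<close> by (intro exI[of _ \<delta>]) (simp add: Re_cube_div_square mult.commute)
qed

section \<open>Polar behaviour at the unit circle\<close>

definition primitive_root :: "nat \<Rightarrow> complex \<Rightarrow> bool" where
  "primitive_root q w \<longleftrightarrow> q > 0 \<and> (\<forall>k. w ^ k = 1 \<longleftrightarrow> q dvd k)"

lemma ex_primitive_root:
  assumes "m > 0" "w ^ m = 1"
  shows "\<exists>q. primitive_root q w"
proof -
  define q where "q = (LEAST q. q > 0 \<and> w ^ q = 1)"
  have q: "q > 0" "w ^ q = 1"
    using LeastI[of "\<lambda>q. q > 0 \<and> w ^ q = 1" m] assms by (auto simp: q_def)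
  have "w ^ k = 1 \<longleftrightarrow> q dvd k" for k
  proof
    assume "w ^ k = 1"
    moreover have "w ^ k = (w ^ q) ^ (k div q) * w ^ (k mod q)"
      by (simp add: power_mult[symmetric] power_add[symmetric])
    ultimately have "w ^ (k mod q) = 1" using q by simp
    moreover have "k mod q < q" using q by simp
    ultimately have "k mod q = 0"
      using not_less_Least[of "k mod q" "\<lambda>q. q > 0 \<and> w ^ q = 1"] by (auto simp: q_def)
    thus "q dvd k" by auto
  next
    assume "q dvd k"
    thus "w ^ k = 1" using q by (auto simp: power_mult)
  qed
  thus ?thesis using q by (auto simp: primitive_root_def)
qed

text \<open>Only the terms with \<open>w ^ Suc k = 1\<close> have a pole of order two at the point \<open>w\<close>, and
  \<open>polar_coeff w x\<close> is the sum of their leading coefficients.\<close>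

definition polar_coeff :: "complex \<Rightarrow> complex \<Rightarrow> complex" where
  "polar_coeff w x = (\<Sum>k. if w ^ Suc k = 1 then x ^ Suc k / of_nat (Suc k) ^ 3 else 0)"

lemma polar_coeff_primitive_root:
  assumes "primitive_root q w" "norm x \<le> 1"
  shows "polar_coeff w x = L q x ^ 3 / 2"
proof -
  have "w ^ k = 1 \<longleftrightarrow> q dvd k" "q > 0" for k
    using assms(1) by (auto simp: primitive_root_def)
  thus ?thesis
    using trilog_sums_multiples[OF assms(2), of q]
    unfolding polar_coeff_def by (simp only: sums_iff L_cubed) simp
qed

lemma polar_coeff_not_root:
  assumes "\<And>k. k > 0 \<Longrightarrow> w ^ k \<noteq> 1"
  shows "polar_coeff w x = 0"
proof -
  have "w ^ Suc k \<noteq> 1" for k using assms[of "Suc k"] by simp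
  thus ?thesis by (simp add: polar_coeff_def del: power_Suc)
qed

lemma filterlim_power2_at_infinity:
  assumes "filterlim N at_top F"
  shows "filterlim (\<lambda>j. complex_of_real (N j ^ 2)) at_infinity F"
proof -
  have "filterlim (\<lambda>j. N j ^ 2) at_infinity F"
    by (intro filterlim_at_top_imp_at_infinity filterlim_pow_at_top assms) simp
  thus ?thesis
    by (simp add: filterlim_at_infinity[OF order_refl] norm_power)
qed

lemma koebe_scaled_tendsto:
  assumes z: "(z \<longlongrightarrow> 0) F" "\<forall>\<^sub>F j in F. z j \<noteq> 0" and N: "filterlim N at_top F"
  shows "((\<lambda>j. (koebe w (z j) - (if w = 1 then 1 / z j ^ 2 else 0)) / of_real (N j ^ 2))
    \<longlongrightarrow> 0) F"
proof (cases "w = 1")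
  case True
  have "\<forall>\<^sub>F j in F. norm (z j) < 1"
    using tendstoD[OF z(1), of 1] by simp
  hence "\<forall>\<^sub>F j in F. norm ((koebe 1 (z j) - 1 / z j ^ 2) / of_real (N j ^ 2)) \<le> 2 / N j ^ 2"
    using z(2)
  proof eventually_elim
    case (elim j)
    have "norm (koebe 1 (z j) - 1 / z j ^ 2)
        \<le> norm (koebe 1 (z j) - 1 / z j ^ 2 + 1 / 12) + norm (1 / 12 :: complex)"
      using norm_triangle_ineq4[of "koebe 1 (z j) - 1 / z j ^ 2 + 1 / 12" "1 / 12"] by simp
    also have "\<dots> \<le> 1 + 1 / 12"
      using norm_koebe_1_expansion_le[of "z j"] elim by simp
    finally show ?case
      by (simp add: norm_divide norm_power divide_right_mono)
  qed
  moreover have "((\<lambda>j. 2 / N j ^ 2) \<longlongrightarrow> 0) F"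
    by (intro tendsto_divide_0[OF tendsto_const] filterlim_at_top_imp_at_infinity
          filterlim_pow_at_top N) simp
  ultimately show ?thesis
    using True by (simp add: Lim_null_comparison)
next
  case False
  have "((\<lambda>j. koebe w (z j)) \<longlongrightarrow> w * exp (- 0) / (1 - w * exp (- 0)) ^ 2) F"
    unfolding koebe_def using False by (intro tendsto_intros z(1)) simp
  thus ?thesis
    using False tendsto_divide_0[OF _ filterlim_power2_at_infinity[OF N]] by simp
qed

context
  fixes F :: "'a filter" and xs \<sigma> :: "'a \<Rightarrow> complex" and N :: "'a \<Rightarrow> real"
    and x w :: complex and b r :: real
  assumes xs: "(xs \<longlongrightarrow> x) F" "norm x \<le> r" "\<forall>\<^sub>F j in F. norm (xs j) \<le> r" "r < 1"
    and N: "filterlim N at_top F"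
    and \<sigma>: "((\<lambda>j. \<sigma> j / of_real (N j)) \<longlongrightarrow> 0) F" "\<forall>\<^sub>F j in F. Re (\<sigma> j) \<ge> b" "b > 0"
    and w: "norm w = 1"
begin

definition koebe_arg :: "nat \<Rightarrow> 'a \<Rightarrow> complex" where
  "koebe_arg k j = of_nat (Suc k) * (\<sigma> j / of_real (N j))"

definition koebe_polar :: "nat \<Rightarrow> 'a \<Rightarrow> complex" where
  "koebe_polar k j = (if w ^ Suc k = 1 then 1 / koebe_arg k j ^ 2 else 0) / of_real (N j ^ 2)"

definition scaled_term :: "nat \<Rightarrow> 'a \<Rightarrow> complex" where
  "scaled_term k j = xs j ^ Suc k / of_nat (Suc k)
     * (koebe (w ^ Suc k) (koebe_arg k j) / of_real (N j ^ 2))"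

definition polar_term :: "nat \<Rightarrow> 'a \<Rightarrow> complex" where
  "polar_term k j = x ^ Suc k / of_nat (Suc k) * koebe_polar k j"

lemma eventually_in_range: "\<forall>\<^sub>F j in F. norm (xs j) \<le> r \<and> N j > 0 \<and> Re (\<sigma> j) \<ge> b"
  using xs(3) \<sigma>(2) N by (auto simp: filterlim_at_top_dense eventually_conj_iff)

lemma Re_koebe_arg: "Re (koebe_arg k j) = real (Suc k) * (Re (\<sigma> j) / N j)"
  by (simp add: koebe_arg_def Re_divide_of_real del: of_nat_Suc)

lemma koebe_arg_lower_bound:
  assumes "N j > 0" "Re (\<sigma> j) \<ge> b"
  shows "b / N j \<le> Re (koebe_arg k j)"
proof -
  have "1 * (b / N j) \<le> real (Suc k) * (Re (\<sigma> j) / N j)"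
    using assms \<sigma>(3) by (intro mult_mono divide_right_mono) auto
  thus ?thesis by (simp add: Re_koebe_arg del: of_nat_Suc)
qed

lemma div_square_koebe_arg_le:
  assumes "N j > 0" "Re (\<sigma> j) \<ge> b" "0 \<le> c" "b / N j \<le> t"
  shows "c / t ^ 2 / N j ^ 2 \<le> c / b ^ 2"
proof -
  have "c / t ^ 2 \<le> c / (b / N j) ^ 2"
    using assms \<sigma>(3) by (intro divide_left_mono power_mono mult_pos_pos zero_less_power)
      (auto intro: less_le_trans[of 0 "b / N j"])
  hence "c / t ^ 2 / N j ^ 2 \<le> c / (b / N j) ^ 2 / N j ^ 2"
    by (rule divide_right_mono) simp
  thus ?thesis using assms(1) by (simp add: power_divide)
qed

lemma norm_koebe_polar_le:
  assumes "N j > 0" "Re (\<sigma> j) \<ge> b"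
  shows "norm (koebe_polar k j) \<le> 1 / b ^ 2"
proof -
  have "b / N j \<le> norm (koebe_arg k j)"
    using koebe_arg_lower_bound[OF assms] complex_Re_le_cmod order_trans by blast
  from div_square_koebe_arg_le[OF assms _ this, of 1] show ?thesis
    by (simp add: koebe_polar_def norm_divide norm_power)
qed

lemma koebe_minus_koebe_polar_tendsto:
  "((\<lambda>j. koebe (w ^ Suc k) (koebe_arg k j) / of_real (N j ^ 2) - koebe_polar k j) \<longlongrightarrow> 0) F"
  unfolding koebe_polar_def diff_divide_distrib[symmetric]
proof (rule koebe_scaled_tendsto[OF _ _ N])
  show "(koebe_arg k \<longlongrightarrow> 0) F"
    unfolding koebe_arg_def by (intro tendsto_mult_right_zero \<sigma>(1))
  show "\<forall>\<^sub>F j in F. koebe_arg k j \<noteq> 0"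
    using eventually_in_range
  proof eventually_elim
    case (elim j)
    hence "0 < b / N j" using \<sigma>(3) by simp
    also have "\<dots> \<le> Re (koebe_arg k j)"
      using koebe_arg_lower_bound elim by simp
    finally show ?case by auto
  qed
qed

lemma scaled_term_minus_polar_term_tendsto: "((\<lambda>j. scaled_term k j - polar_term k j) \<longlongrightarrow> 0) F"
proof -
  let ?x = "\<lambda>z::complex. z ^ Suc k / of_nat (Suc k)"
  have x: "((\<lambda>j. ?x (xs j)) \<longlongrightarrow> ?x x) F"
    by (intro tendsto_intros xs(1)) (simp del: of_nat_Suc)
  have "((\<lambda>j. ?x (xs j) * (koebe (w ^ Suc k) (koebe_arg k j) / of_real (N j ^ 2) - koebe_polar k j))
      \<longlongrightarrow> 0) F"
    using tendsto_mult[OF x koebe_minus_koebe_polar_tendsto] by simp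
  moreover have "((\<lambda>j. (?x (xs j) - ?x x) * koebe_polar k j) \<longlongrightarrow> 0) F"
  proof (rule Lim_null_comparison)
    show "\<forall>\<^sub>F j in F. norm ((?x (xs j) - ?x x) * koebe_polar k j)
        \<le> norm (?x (xs j) - ?x x) * (1 / b ^ 2)"
      using eventually_in_range
      by eventually_elim (simp only: norm_mult mult_left_mono norm_koebe_polar_le norm_ge_zero)
    show "((\<lambda>j. norm (?x (xs j) - ?x x) * (1 / b ^ 2)) \<longlongrightarrow> 0) F"
      by (intro tendsto_mult_left_zero tendsto_norm_zero LIM_zero x)
  qed
  ultimately have "((\<lambda>j. ?x (xs j) * (koebe (w ^ Suc k) (koebe_arg k j) / of_real (N j ^ 2)
      - koebe_polar k j) + (?x (xs j) - ?x x) * koebe_polar k j) \<longlongrightarrow> 0) F"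
    by (rule tendsto_add_zero)
  thus ?thesis
    by (simp add: scaled_term_def polar_term_def algebra_simps del: power_Suc of_nat_Suc)
qed

lemma norm_scaled_term_le:
  assumes "norm (xs j) \<le> r" "N j > 0" "Re (\<sigma> j) \<ge> b"
  shows "norm (scaled_term k j) \<le> r ^ Suc k * (4 / b ^ 2)"
proof -
  have "0 < b / N j" using assms(2) \<sigma>(3) by simp
  hence "Re (koebe_arg k j) > 0"
    using koebe_arg_lower_bound[OF assms(2,3)] less_le_trans by blast
  hence "norm (koebe (w ^ Suc k) (koebe_arg k j)) / N j ^ 2 \<le> 4 / Re (koebe_arg k j) ^ 2 / N j ^ 2"
    by (intro divide_right_mono norm_koebe_le) (simp_all add: norm_power w del: power_Suc)
  also have "\<dots> \<le> 4 / b ^ 2"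
    by (intro div_square_koebe_arg_le koebe_arg_lower_bound assms) simp
  finally have "norm (koebe (w ^ Suc k) (koebe_arg k j) / of_real (N j ^ 2)) \<le> 4 / b ^ 2"
    by (simp add: norm_divide norm_power)
  thus ?thesis
    unfolding scaled_term_def norm_mult[of "xs j ^ Suc k / of_nat (Suc k)"]
    using order_trans[OF norm_ge_zero assms(1)]
    by (intro mult_mono norm_power_div_of_nat_le assms) auto
qed

lemma norm_polar_term_le:
  assumes "N j > 0" "Re (\<sigma> j) \<ge> b"
  shows "norm (polar_term k j) \<le> r ^ Suc k * (1 / b ^ 2)"
  unfolding polar_term_def norm_mult[of "x ^ Suc k / of_nat (Suc k)"]
  using order_trans[OF norm_ge_zero xs(2)]
  by (intro mult_mono norm_power_div_of_nat_le norm_koebe_polar_le assms xs(2)) auto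

lemma scaled_term_sums:
  assumes "norm (xs j) \<le> r" "N j > 0" "Re (\<sigma> j) \<ge> b"
  shows "(\<lambda>k. scaled_term k j)
    sums (log_gf (xs j) (w * exp (- (\<sigma> j / of_real (N j)))) / of_real (N j ^ 2))"
proof -
  have "Re (\<sigma> j / of_real (N j)) > 0"
    using assms(2,3) \<sigma>(3) by (simp add: Re_divide_of_real)
  moreover have "norm (xs j) < 1" using assms(1) xs(4) by linarith
  ultimately show ?thesis
    using sums_divide[OF log_gf_koebe_sums[OF _ _ w]]
    unfolding scaled_term_def koebe_arg_def times_divide_eq_right[of "xs j ^ _ / _"] by blast
qed

lemma summable_polar_term:
  assumes "N j > 0" "Re (\<sigma> j) \<ge> b"
  shows "summable (\<lambda>k. polar_term k j)"
proof -
  have "norm r < 1" using order_trans[OF norm_ge_zero xs(2)] xs(4) by simp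
  hence "summable (\<lambda>k. r ^ Suc k * (1 / b ^ 2))"
    by (intro summable_mult2 summable_power_Suc)
  thus ?thesis
    by (rule summable_comparison_test'[of _ 0]) (rule norm_polar_term_le[OF assms])
qed

lemma suminf_polar_term:
  assumes "N j > 0" "Re (\<sigma> j) \<ge> b"
  shows "(\<Sum>k. polar_term k j) = polar_coeff w x / \<sigma> j ^ 2"
proof -
  have "\<sigma> j \<noteq> 0" using assms \<sigma>(3) by auto
  have "polar_term k j
      = (if w ^ Suc k = 1 then x ^ Suc k / of_nat (Suc k) ^ 3 else 0) / \<sigma> j ^ 2" for k
    using assms(1) by (simp add: polar_term_def koebe_polar_def koebe_arg_def power_divide
        power_mult_distrib power2_eq_square power3_eq_cube del: of_nat_Suc power_Suc)
  hence "(\<lambda>k. polar_term k j * \<sigma> j ^ 2)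
      = (\<lambda>k. if w ^ Suc k = 1 then x ^ Suc k / of_nat (Suc k) ^ 3 else 0)"
    using \<open>\<sigma> j \<noteq> 0\<close> by simp
  hence "polar_coeff w x = (\<Sum>k. polar_term k j) * \<sigma> j ^ 2"
    unfolding polar_coeff_def
    using suminf_mult2[OF summable_polar_term[OF assms], of "\<sigma> j ^ 2"] by simp
  thus ?thesis using \<open>\<sigma> j \<noteq> 0\<close> by simp
qed

lemma log_gf_minus_polar_tendsto:
  assumes "F \<noteq> bot"
  shows "((\<lambda>j. log_gf (xs j) (w * exp (- (\<sigma> j / of_real (N j)))) / of_real (N j ^ 2)
    - polar_coeff w x / \<sigma> j ^ 2) \<longlongrightarrow> 0) F"
proof -
  have "((\<lambda>j. \<Sum>k. scaled_term k j - polar_term k j) \<longlongrightarrow> (\<Sum>k::nat. 0)) F"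
  proof (rule tannerys_theorem[THEN conjunct2, THEN conjunct2])
    have "norm r < 1" using order_trans[OF norm_ge_zero xs(2)] xs(4) by simp
    thus "summable (\<lambda>k. r ^ Suc k * (4 / b ^ 2) + r ^ Suc k * (1 / b ^ 2))"
      by (intro summable_add summable_mult2 summable_power_Suc)
    have "\<forall>\<^sub>F (k, j) in sequentially \<times>\<^sub>F F. norm (xs j) \<le> r \<and> N j > 0 \<and> Re (\<sigma> j) \<ge> b"
      by (rule eventually_prod2[THEN iffD2, OF _ eventually_in_range]) simp
    thus "\<forall>\<^sub>F (k, j) in sequentially \<times>\<^sub>F F.
        norm (scaled_term k j - polar_term k j) \<le> r ^ Suc k * (4 / b ^ 2) + r ^ Suc k * (1 / b ^ 2)"
    proof (rule eventually_mono, clarify)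
      fix k j assume "norm (xs j) \<le> r" "N j > 0" "Re (\<sigma> j) \<ge> b"
      thus "norm (scaled_term k j - polar_term k j)
          \<le> r ^ Suc k * (4 / b ^ 2) + r ^ Suc k * (1 / b ^ 2)"
        by (intro norm_triangle_le_diff add_mono norm_scaled_term_le norm_polar_term_le)
    qed
  qed (use scaled_term_minus_polar_term_tendsto assms in auto)
  moreover have "\<forall>\<^sub>F j in F. (\<Sum>k. scaled_term k j - polar_term k j)
      = log_gf (xs j) (w * exp (- (\<sigma> j / of_real (N j)))) / of_real (N j ^ 2)
        - polar_coeff w x / \<sigma> j ^ 2"
    using eventually_in_range
  proof eventually_elim
    case (elim j)
    thus ?case
      using scaled_term_sums[of j] summable_polar_term[of j] suminf_polar_term[of j]
      by (simp add: sums_iff suminf_diff[symmetric])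
  qed
  ultimately show ?thesis
    using Lim_transform_eventually by fastforce
qed

end

section \<open>Minor arcs\<close>

definition circle_point :: "nat \<Rightarrow> real \<Rightarrow> complex \<Rightarrow> real \<Rightarrow> complex" where
  "circle_point q N x v = of_real (Re (L q x) / N) + \<i> * of_real v"

lemma exp_minus_i_times_eq_1_imp_zero:
  assumes "exp (- (\<i> * complex_of_real v)) = 1" "v \<in> {-pi..pi}"
  shows "v = 0"
proof -
  obtain n :: int where n: "- v = of_int (2 * n) * pi" using assms(1) by (auto simp: exp_eq_1)
  have "\<bar>of_int (2 * n)\<bar> * pi = \<bar>- v\<bar>"
    unfolding n abs_mult by simp
  hence "\<bar>of_int (2 * n)\<bar> * pi \<le> 1 * pi"
    using assms(2) by auto
  hence "\<bar>of_int (2 * n) :: real\<bar> \<le> 1" using pi_gt_zero by (simp only: mult_le_cancel_right_pos)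
  hence "n = 0" by linarith
  thus ?thesis using n by simp
qed

locale dominant_root =
  fixes q :: nat and \<epsilon> :: complex and X :: "complex set"
  assumes primitive_root: "primitive_root q \<epsilon>"
    and unique_root: "primitive_root q w \<Longrightarrow> w = \<epsilon>"
    and compact: "compact X"
    and norm_less_1: "x \<in> X \<Longrightarrow> norm x < 1"
    and continuous_L: "continuous_on X (L q)"
    and sector: "x \<in> X \<Longrightarrow> norm (L q x) < 2 * Re (L q x)"
    and dominant: "x \<in> X \<Longrightarrow> k \<ge> 1 \<Longrightarrow> k \<noteq> q \<Longrightarrow> Re (L k x) < Re (L q x)"
begin

lemma norm_root: "norm \<epsilon> = 1"
proof -
  have "\<epsilon> ^ q = 1" "q > 0" using primitive_root by (auto simp: primitive_root_def)
  hence "norm \<epsilon> ^ q = 1 ^ q" by (metis norm_one norm_power power_one)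
  thus ?thesis using \<open>q > 0\<close> by (metis norm_ge_zero power_eq_imp_eq_base zero_le_one)
qed

lemma Re_L_pos: "x \<in> X \<Longrightarrow> Re (L q x) > 0"
  using sector[of x] norm_ge_zero[of "L q x"] by linarith

lemma polar_gap_off_root:
  assumes x: "x \<in> X" and "w \<noteq> \<epsilon>"
  shows "\<exists>\<rho><1. \<forall>\<sigma>. Re \<sigma> > 0 \<longrightarrow>
    Re (polar_coeff w x / \<sigma> ^ 2) \<le> \<rho> * (Re (L q x) ^ 3 / (2 * Re \<sigma> ^ 2))"
proof (cases "\<exists>m>0. w ^ m = 1")
  case False
  hence "polar_coeff w x = 0" by (intro polar_coeff_not_root) blast
  thus ?thesis by (intro exI[of _ 0]) simp
next
  case True
  then obtain k where k: "primitive_root k w" using ex_primitive_root by blast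
  hence "k \<noteq> q" using unique_root assms(2) by blast
  moreover have "k \<ge> 1" using k by (simp add: primitive_root_def)
  ultimately have less: "Re (L k x) < Re (L q x)" using dominant[OF x] by blast
  define \<rho> where "\<rho> = (Re (L k x) / Re (L q x)) ^ 3"
  have "Re (L k x) / Re (L q x) < 1"
    using less Re_L_pos[OF x] by simp
  hence "\<rho> < 1 ^ 3"
    unfolding \<rho>_def using Re_L_nonneg[of k x] Re_L_pos[OF x] by (intro power_strict_mono) auto
  moreover have "Re (polar_coeff w x / \<sigma> ^ 2) \<le> \<rho> * (Re (L q x) ^ 3 / (2 * Re \<sigma> ^ 2))"
    if "Re \<sigma> > 0" for \<sigma>
  proof -
    have "polar_coeff w x / \<sigma> ^ 2 = L k x ^ 3 / \<sigma> ^ 2 / of_real 2"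
      by (simp add: polar_coeff_primitive_root[OF k less_imp_le[OF norm_less_1[OF x]]])
    hence "Re (polar_coeff w x / \<sigma> ^ 2) = Re (L k x ^ 3 / \<sigma> ^ 2) / 2"
      by (simp only: Re_divide_of_real)
    also have "\<dots> \<le> Re (L k x) ^ 3 / Re \<sigma> ^ 2 / 2"
      using Re_cube_div_square_le[OF norm_L_le that] by (intro divide_right_mono) auto
    also have "\<dots> = \<rho> * (Re (L q x) ^ 3 / (2 * Re \<sigma> ^ 2))"
      using Re_L_pos[OF x] by (simp add: \<rho>_def power_divide)
    finally show ?thesis .
  qed
  ultimately show ?thesis by auto
qed

lemma polar_gap_at_root:
  assumes x: "x \<in> X" and "\<eta> > 0"
  shows "\<exists>\<rho><1. \<forall>\<sigma>. Re \<sigma> > 0 \<longrightarrow> \<bar>Im \<sigma> / Re \<sigma> - Im (L q x) / Re (L q x)\<bar> \<ge> \<eta> \<longrightarrow>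
    Re (polar_coeff \<epsilon> x / \<sigma> ^ 2) \<le> \<rho> * (Re (L q x) ^ 3 / (2 * Re \<sigma> ^ 2))"
proof -
  obtain \<delta> where \<delta>: "\<delta> > 0"
      "\<And>\<sigma>. Re \<sigma> > 0 \<Longrightarrow> \<bar>Im \<sigma> / Re \<sigma> - Im (L q x) / Re (L q x)\<bar> \<ge> \<eta> \<Longrightarrow>
        Re (L q x ^ 3 / \<sigma> ^ 2) \<le> (1 - \<delta>) * (Re (L q x) ^ 3 / Re \<sigma> ^ 2)"
    using Re_cube_div_square_gap[OF sector[OF x] assms(2)] by blast
  have half: "Re (polar_coeff \<epsilon> x / \<sigma> ^ 2) = Re (L q x ^ 3 / \<sigma> ^ 2) / 2" for \<sigma>
  proof -
    have "polar_coeff \<epsilon> x / \<sigma> ^ 2 = L q x ^ 3 / \<sigma> ^ 2 / of_real 2"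
      by (simp add: polar_coeff_primitive_root[OF primitive_root less_imp_le[OF norm_less_1[OF x]]])
    thus ?thesis by (simp only: Re_divide_of_real)
  qed
  have "Re (polar_coeff \<epsilon> x / \<sigma> ^ 2) \<le> (1 - \<delta>) * (Re (L q x) ^ 3 / (2 * Re \<sigma> ^ 2))"
    if "Re \<sigma> > 0" "\<bar>Im \<sigma> / Re \<sigma> - Im (L q x) / Re (L q x)\<bar> \<ge> \<eta>" for \<sigma>
    unfolding half using divide_right_mono[OF \<delta>(2)[OF that], of 2] by simp
  thus ?thesis
    using \<delta>(1) by (intro exI[of _ "1 - \<delta>"]) simp
qed

context
  fixes xs :: "nat \<Rightarrow> complex" and vs N :: "nat \<Rightarrow> real" and x :: complex and v \<eta> :: real
  assumes xs: "xs \<longlonglongrightarrow> x" "\<And>j. xs j \<in> X" and x: "x \<in> X"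
    and vs: "vs \<longlonglongrightarrow> v" and v: "v \<in> {-pi..pi}" and N: "filterlim N at_top sequentially"
    and \<eta>: "\<eta> > 0" and far: "\<And>j. \<bar>N j * vs j - Im (L q (xs j))\<bar> \<ge> \<eta>"
begin

definition rescaled_point :: "nat \<Rightarrow> complex" where
  "rescaled_point j = of_real (Re (L q (xs j))) + \<i> * of_real (N j * (vs j - v))"

lemma rescaled_point_sel:
  "Re (rescaled_point j) = Re (L q (xs j))" "Im (rescaled_point j) = N j * (vs j - v)"
  by (simp_all add: rescaled_point_def)

lemma L_tendsto: "(\<lambda>j. L q (xs j)) \<longlonglongrightarrow> L q x"
  using xs x by (intro continuous_on_tendsto_compose[OF continuous_L]) auto

lemma Re_L_tendsto: "(\<lambda>j. Re (L q (xs j))) \<longlonglongrightarrow> Re (L q x)"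
  by (intro tendsto_intros L_tendsto)

lemma eventually_N_pos: "\<forall>\<^sub>F j in sequentially. N j > 0"
  using N by (simp add: filterlim_at_top_dense)

lemma eventually_slope_far:
  assumes "v = 0"
  shows "\<forall>\<^sub>F j in sequentially.
    \<bar>Im (rescaled_point j) / Re (rescaled_point j) - Im (L q x) / Re (L q x)\<bar>
      \<ge> \<eta> / (4 * Re (L q x))"
proof -
  define a where "a = Re (L q x)"
  have a: "a > 0" using Re_L_pos[OF x] by (simp add: a_def)
  have "(\<lambda>j. Im (L q (xs j)) / Re (L q (xs j))) \<longlonglongrightarrow> Im (L q x) / a"
    using a by (auto simp: a_def intro!: tendsto_intros L_tendsto)
  hence "\<forall>\<^sub>F j in sequentially.
      dist (Im (L q (xs j)) / Re (L q (xs j))) (Im (L q x) / a) < \<eta> / (4 * a)"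
    using \<eta> a by (intro tendstoD) auto
  moreover have "\<forall>\<^sub>F j in sequentially. Re (L q (xs j)) < 2 * a"
    using order_tendstoD(2)[OF Re_L_tendsto, of "2 * a"] a by (simp add: a_def)
  ultimately have "\<forall>\<^sub>F j in sequentially.
      \<eta> / (4 * a) \<le> \<bar>N j * vs j / Re (L q (xs j)) - Im (L q x) / a\<bar>"
  proof eventually_elim
    case (elim j)
    note pos = Re_L_pos[OF xs(2)[of j]]
    have "\<eta> / (4 * a) + \<eta> / (4 * a) = \<eta> / (2 * a)" by simp
    also have "\<dots> \<le> \<eta> / Re (L q (xs j))"
      using elim pos \<eta> a by (intro divide_left_mono) auto
    also have "\<dots> \<le> \<bar>N j * vs j - Im (L q (xs j))\<bar> / Re (L q (xs j))"
      using far[of j] pos by (intro divide_right_mono) auto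
    also have "\<dots> = \<bar>N j * vs j / Re (L q (xs j)) - Im (L q (xs j)) / Re (L q (xs j))\<bar>"
      using pos by (simp add: diff_divide_distrib[symmetric])
    finally show ?case
      using elim(1) unfolding dist_real_def by linarith
  qed
  thus ?thesis
    unfolding rescaled_point_sel by (simp add: a_def assms)
qed

lemma eventually_polar_gap:
  "\<exists>\<rho><1. \<forall>\<^sub>F j in sequentially.
    Re (polar_coeff (\<epsilon> * exp (- (\<i> * of_real v))) x / rescaled_point j ^ 2)
      \<le> \<rho> * (Re (L q x) ^ 3 / (2 * Re (L q (xs j)) ^ 2))"
proof (cases "exp (- (\<i> * complex_of_real v)) = 1")
  case False
  hence "\<epsilon> * exp (- (\<i> * of_real v)) \<noteq> \<epsilon>"
    using norm_root by auto
  from polar_gap_off_root[OF x this] show ?thesis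
    using Re_L_pos[OF xs(2)] rescaled_point_sel(1) by (metis (mono_tags, lifting) always_eventually)
next
  case True
  hence "v = 0" using exp_minus_i_times_eq_1_imp_zero v by blast
  have "\<eta> / (4 * Re (L q x)) > 0" using \<eta> Re_L_pos[OF x] by simp
  from polar_gap_at_root[OF x this] obtain \<rho> where \<rho>: "\<rho> < 1"
      "\<And>\<sigma>. Re \<sigma> > 0 \<Longrightarrow>
        \<bar>Im \<sigma> / Re \<sigma> - Im (L q x) / Re (L q x)\<bar> \<ge> \<eta> / (4 * Re (L q x)) \<Longrightarrow>
        Re (polar_coeff \<epsilon> x / \<sigma> ^ 2) \<le> \<rho> * (Re (L q x) ^ 3 / (2 * Re \<sigma> ^ 2))"
    by blast
  have "\<forall>\<^sub>F j in sequentially. Re (polar_coeff \<epsilon> x / rescaled_point j ^ 2)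
      \<le> \<rho> * (Re (L q x) ^ 3 / (2 * Re (rescaled_point j) ^ 2))"
    using eventually_slope_far[OF \<open>v = 0\<close>]
  proof eventually_elim
    case (elim j)
    thus ?case
      using Re_L_pos[OF xs(2)[of j]] by (intro \<rho>(2)) (auto simp: rescaled_point_sel(1))
  qed
  thus ?thesis
    using \<rho>(1) True by (auto simp: rescaled_point_sel)
qed

lemma eventually_rescaled_point:
  "\<forall>\<^sub>F j in sequentially. rescaled_point j / of_real (N j)
    = circle_point q (N j) (xs j) (vs j) - \<i> * of_real v"
  using eventually_N_pos
  by eventually_elim (simp add: rescaled_point_def circle_point_def field_simps)

lemma rescaled_point_tendsto: "(\<lambda>j. rescaled_point j / of_real (N j)) \<longlonglongrightarrow> 0"
proof -
  have "(\<lambda>j. Re (L q (xs j)) / N j) \<longlonglongrightarrow> 0"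
    by (rule tendsto_divide_0[OF Re_L_tendsto filterlim_at_top_imp_at_infinity[OF N]])
  hence "(\<lambda>j. circle_point q (N j) (xs j) (vs j) - \<i> * of_real v)
      \<longlonglongrightarrow> of_real 0 + \<i> * of_real v - \<i> * of_real v"
    unfolding circle_point_def by (intro tendsto_intros vs)
  thus ?thesis
    using eventually_rescaled_point by (simp add: tendsto_cong)
qed

lemma log_gf_minus_polar_along_sequence:
  "(\<lambda>j. log_gf (xs j) (\<epsilon> * exp (- circle_point q (N j) (xs j) (vs j))) / of_real (N j ^ 2)
    - polar_coeff (\<epsilon> * exp (- (\<i> * of_real v))) x / rescaled_point j ^ 2) \<longlonglongrightarrow> 0"
proof -
  define w where "w = \<epsilon> * exp (- (\<i> * of_real v))"
  define r where "r = (1 + norm x) / 2"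
  have r: "norm x < r" "r < 1" using norm_less_1[OF x] by (auto simp: r_def)
  have "\<forall>\<^sub>F j in sequentially. norm (xs j) \<le> r"
    using order_tendstoD(2)[OF tendsto_norm[OF xs(1)] r(1)] by eventually_elim simp
  moreover have "\<forall>\<^sub>F j in sequentially. Re (L q x) / 2 \<le> Re (rescaled_point j)"
    using order_tendstoD(1)[OF Re_L_tendsto, of "Re (L q x) / 2"] Re_L_pos[OF x]
    by (auto simp: rescaled_point_sel elim: eventually_mono)
  moreover have "norm w = 1" by (simp add: w_def norm_mult norm_root)
  ultimately have "(\<lambda>j. log_gf (xs j) (w * exp (- (rescaled_point j / of_real (N j))))
      / of_real (N j ^ 2) - polar_coeff w x / rescaled_point j ^ 2) \<longlonglongrightarrow> 0"
    using log_gf_minus_polar_tendsto[OF xs(1) _ _ r(2) N, of rescaled_point "Re (L q x) / 2" w]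
      rescaled_point_tendsto r(1) Re_L_pos[OF x] by simp
  moreover have "\<forall>\<^sub>F j in sequentially.
      log_gf (xs j) (w * exp (- (rescaled_point j / of_real (N j)))) / of_real (N j ^ 2)
        - polar_coeff w x / rescaled_point j ^ 2
      = log_gf (xs j) (\<epsilon> * exp (- circle_point q (N j) (xs j) (vs j))) / of_real (N j ^ 2)
        - polar_coeff w x / rescaled_point j ^ 2"
    using eventually_rescaled_point
  proof eventually_elim
    case (elim j)
    hence "w * exp (- (rescaled_point j / of_real (N j)))
        = \<epsilon> * exp (- circle_point q (N j) (xs j) (vs j))"
      by (simp add: w_def mult.assoc exp_add[symmetric])
    thus ?case by (simp only:)
  qed
  ultimately show ?thesis
    unfolding w_def[symmetric] by (rule Lim_transform_eventually)
qed

lemma minor_arc_along_sequence: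
  "\<exists>\<delta>>0. \<forall>\<^sub>F j in sequentially. Re (log_gf (xs j) (\<epsilon> * exp (- circle_point q (N j) (xs j) (vs j))))
    \<le> (Re (L q (xs j)) / 2 - \<delta>) * N j ^ 2"
proof -
  define a where "a = Re (L q x)"
  define A where "A j = Re (L q (xs j))" for j
  have a: "a > 0" using Re_L_pos[OF x] by (simp add: a_def)
  define G where "G j = log_gf (xs j) (\<epsilon> * exp (- circle_point q (N j) (xs j) (vs j)))" for j
  define P where "P j = polar_coeff (\<epsilon> * exp (- (\<i> * of_real v))) x / rescaled_point j ^ 2" for j
  obtain \<rho> where "\<rho> < 1" and gap: "\<forall>\<^sub>F j in sequentially.
      Re (P j) \<le> \<rho> * (a ^ 3 / (2 * A j ^ 2))"
    using eventually_polar_gap unfolding P_def a_def A_def by blast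
  define \<delta> where "\<delta> = (1 - \<rho>) * a / 4"
  have "\<delta> > 0" using \<open>\<rho> < 1\<close> a by (simp add: \<delta>_def)
  have A: "A \<longlonglongrightarrow> a" unfolding A_def a_def by (rule Re_L_tendsto)
  define E where "E j = Re (G j / of_real (N j ^ 2) - P j)" for j
  have E: "E \<longlonglongrightarrow> 0"
    unfolding E_def G_def P_def using tendsto_Re[OF log_gf_minus_polar_along_sequence] by simp
  have "(\<lambda>j. A j / 2 - (E j + \<rho> * (a ^ 3 / (2 * A j ^ 2))))
      \<longlonglongrightarrow> a / 2 - (0 + \<rho> * (a ^ 3 / (2 * a ^ 2)))"
    using a by (intro tendsto_intros A E) auto
  moreover have "a / 2 - (0 + \<rho> * (a ^ 3 / (2 * a ^ 2))) = 2 * \<delta>"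
    using a by (simp add: \<delta>_def power2_eq_square power3_eq_cube field_simps)
  ultimately have "\<forall>\<^sub>F j in sequentially. \<delta> < A j / 2 - (E j + \<rho> * (a ^ 3 / (2 * A j ^ 2)))"
    using \<open>\<delta> > 0\<close> by (intro order_tendstoD(1)) auto
  hence "\<forall>\<^sub>F j in sequentially. Re (G j) \<le> (A j / 2 - \<delta>) * N j ^ 2"
    using gap eventually_N_pos
  proof eventually_elim
    case (elim j)
    hence "Re (G j / of_real (N j ^ 2)) \<le> A j / 2 - \<delta>" by (simp add: E_def)
    thus ?case
      using elim(3) by (simp only: Re_divide_of_real pos_divide_le_eq zero_less_power)
  qed
  thus ?thesis using \<open>\<delta> > 0\<close> unfolding G_def A_def by blast
qed

end

lemma minor_arcs:
  assumes \<eta>: "\<eta> > 0"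
  shows "\<exists>\<delta>>0. \<exists>N0. \<forall>N\<ge>N0. \<forall>x\<in>X. \<forall>v\<in>{-pi..pi}. \<bar>N * v - Im (L q x)\<bar> \<ge> \<eta> \<longrightarrow>
    Re (log_gf x (\<epsilon> * exp (- circle_point q N x v))) \<le> (Re (L q x) / 2 - \<delta>) * N ^ 2"
proof (rule ccontr)
  define bad where "bad \<delta> N x v \<longleftrightarrow> x \<in> X \<and> v \<in> {-pi..pi} \<and> \<bar>N * v - Im (L q x)\<bar> \<ge> \<eta> \<and>
      Re (log_gf x (\<epsilon> * exp (- circle_point q N x v))) > (Re (L q x) / 2 - \<delta>) * N ^ 2" for \<delta> N x v
  assume "\<not> ?thesis"
  hence "\<exists>N x v. N \<ge> M \<and> bad \<delta> N x v" if "\<delta> > 0" for \<delta> M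
    using that unfolding bad_def by (metis not_le)
  hence "\<forall>j. \<exists>N x v. N \<ge> real j \<and> bad (1 / real (Suc j)) N x v"
    by simp
  then obtain N xs vs where N: "\<And>j. N j \<ge> real j"
      and bad: "\<And>j. bad (1 / real (Suc j)) (N j) (xs j) (vs j)"
    by metis
  have "seq_compact (X \<times> {-pi..pi})"
    using compact by (intro compact_imp_seq_compact compact_Times) auto
  moreover have "\<forall>j. (xs j, vs j) \<in> X \<times> {-pi..pi}" using bad by (auto simp: bad_def)
  ultimately obtain x v \<phi> where "x \<in> X" "v \<in> {-pi..pi}" "strict_mono \<phi>"
      and lim: "((\<lambda>j. (xs j, vs j)) \<circ> \<phi>) \<longlonglongrightarrow> (x, v)"
    by (rule seq_compactE) auto
  have "(\<lambda>j. xs (\<phi> j)) \<longlonglongrightarrow> x" "(\<lambda>j. vs (\<phi> j)) \<longlonglongrightarrow> v"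
    using tendsto_fst[OF lim] tendsto_snd[OF lim] by (auto simp: o_def)
  moreover have "filterlim N at_top sequentially"
    by (rule filterlim_at_top_mono[OF filterlim_real_sequentially]) (use N in auto)
  hence "filterlim (\<lambda>j. N (\<phi> j)) at_top sequentially"
    by (rule filterlim_compose[OF _ filterlim_subseq[OF \<open>strict_mono \<phi>\<close>]])
  ultimately obtain \<delta> where "\<delta> > 0" and good: "\<forall>\<^sub>F j in sequentially.
      Re (log_gf (xs (\<phi> j)) (\<epsilon> * exp (- circle_point q (N (\<phi> j)) (xs (\<phi> j)) (vs (\<phi> j)))))
        \<le> (Re (L q (xs (\<phi> j))) / 2 - \<delta>) * N (\<phi> j) ^ 2"
    using minor_arc_along_sequence[OF _ _ \<open>x \<in> X\<close> _ \<open>v \<in> {-pi..pi}\<close> _ \<eta>,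
        of "\<lambda>j. xs (\<phi> j)" "\<lambda>j. vs (\<phi> j)" "\<lambda>j. N (\<phi> j)"] bad
    unfolding bad_def by blast
  have "(\<lambda>j. 1 / real (Suc (\<phi> j))) \<longlonglongrightarrow> 0"
    using LIMSEQ_subseq_LIMSEQ[OF LIMSEQ_Suc[OF lim_1_over_n] \<open>strict_mono \<phi>\<close>] by (simp add: o_def)
  from order_tendstoD(2)[OF this \<open>\<delta> > 0\<close>] good
  have "\<forall>\<^sub>F j in sequentially. False"
  proof eventually_elim
    case (elim j)
    have "(Re (L q (xs (\<phi> j))) / 2 - \<delta>) * N (\<phi> j) ^ 2
        \<le> (Re (L q (xs (\<phi> j))) / 2 - 1 / real (Suc (\<phi> j))) * N (\<phi> j) ^ 2"
      using elim(1) by (intro mult_right_mono) auto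
    thus False using elim(2) bad[of "\<phi> j"] by (simp add: bad_def)
  qed
  thus False by simp
qed

end

section \<open>Gaussian integrals with complex parameter\<close>

definition gauss_prim :: "complex \<Rightarrow> complex" where
  "gauss_prim z = contour_integral (linepath 0 z) (\<lambda>w. exp (- (w ^ 2)))"

lemma ex_gauss_prim_eq:
  "\<exists>P. (\<forall>z. (P has_field_derivative exp (- (z ^ 2))) (at z)) \<and> (\<forall>z. gauss_prim z = P z - P 0)"
proof -
  have "(\<lambda>z::complex. exp (- (z ^ 2))) holomorphic_on UNIV" by (intro holomorphic_intros)
  then obtain P :: "complex \<Rightarrow> complex"
    where P: "\<And>z. (P has_field_derivative exp (- (z ^ 2))) (at z)"
    using holomorphic_convex_primitive'[of UNIV "\<lambda>z. exp (- (z ^ 2))"] by auto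
  have "gauss_prim z = P z - P 0" for z
    unfolding gauss_prim_def
    using contour_integral_unique[OF contour_integral_primitive[of UNIV P _ "linepath 0 z"]] P
    by simp
  thus ?thesis using P by blast
qed

lemma gauss_prim_has_field_derivative:
  "(gauss_prim has_field_derivative exp (- (z ^ 2))) (at z)"
proof -
  obtain P where P: "\<And>z. (P has_field_derivative exp (- (z ^ 2))) (at z)"
      and "\<And>z. gauss_prim z = P z - P 0"
    using ex_gauss_prim_eq by blast
  hence eq: "gauss_prim = (\<lambda>z. P z - P 0)" by blast
  show ?thesis unfolding eq by (auto intro!: derivative_eq_intros P)
qed

lemma gauss_prim_0 [simp]: "gauss_prim 0 = 0"
  by (simp add: gauss_prim_def)

lemma gauss_prim_minus: "gauss_prim (- z) = - gauss_prim z"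
proof -
  have "((\<lambda>z. gauss_prim z + gauss_prim (- z)) has_field_derivative 0) (at z)" for z
  proof -
    have "((\<lambda>z. gauss_prim (- z)) has_field_derivative exp (- ((- z) ^ 2)) * (- 1)) (at z)"
      by (rule DERIV_chain2[OF gauss_prim_has_field_derivative]) (auto intro!: derivative_eq_intros)
    from DERIV_add[OF gauss_prim_has_field_derivative this] show ?thesis by simp
  qed
  then obtain C where "\<And>z. gauss_prim z + gauss_prim (- z) = C"
    using has_field_derivative_zero_constant[of UNIV "\<lambda>z. gauss_prim z + gauss_prim (- z)"] by auto
  from this[of z] this[of 0] show ?thesis
    by (simp add: eq_neg_iff_add_eq_0 add.commute)
qed

lemma gauss_prim_of_real:
  assumes "T \<ge> 0"
  shows "gauss_prim (of_real T) = of_real (LINT t:{0..T}|lborel. exp (- t\<^sup>2))"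
proof -
  have "((\<lambda>t. exp (- (of_real t ^ 2))) has_integral
      (gauss_prim (of_real T) - gauss_prim (of_real 0))) {0..T}"
    by (rule fundamental_theorem_of_calculus[OF assms
          has_vector_derivative_real_field[OF gauss_prim_has_field_derivative]])
  hence complex: "((\<lambda>t. complex_of_real (exp (- t\<^sup>2))) has_integral gauss_prim (of_real T)) {0..T}"
    by (simp add: exp_of_real[symmetric])
  have "continuous_on {0..T} (\<lambda>t::real. exp (- t\<^sup>2))" by (intro continuous_intros)
  hence "set_integrable lborel {0..T} (\<lambda>t::real. exp (- t\<^sup>2))"
    unfolding set_integrable_def by (intro borel_integrable_compact) auto
  from set_borel_integral_eq_integral[OF this]
  have "((\<lambda>t. exp (- t\<^sup>2)) has_integral (LINT t:{0..T}|lborel. exp (- t\<^sup>2))) {0..T}"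
    by (simp add: has_integral_iff)
  from has_integral_unique[OF complex has_integral_of_real[OF this]] show ?thesis .
qed

lemma gauss_prim_tendsto: "((\<lambda>T. gauss_prim (of_real T)) \<longlongrightarrow> of_real (sqrt pi / 2)) at_top"
proof -
  let ?f = "\<lambda>x::real. indicator {0..} x *\<^sub>R exp (- x\<^sup>2)"
  have f: "integrable lborel ?f" "(\<integral>x. ?f x \<partial>lborel) = sqrt pi / 2"
    using gaussian_moment_0 by (simp_all only: has_bochner_integral_iff)
  have "((\<lambda>T. \<integral>x. indicator {..T} x *\<^sub>R ?f x \<partial>lborel) \<longlongrightarrow> sqrt pi / 2) at_top"
    using tendsto_integral_at_top[OF sets_lborel f(1)] unfolding f(2) .
  moreover have "(\<integral>x. indicator {..T} x *\<^sub>R ?f x \<partial>lborel)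
      = (LINT t:{0..T}|lborel. exp (- t\<^sup>2))" for T
    unfolding set_lebesgue_integral_def
    by (intro Bochner_Integration.integral_cong refl) (auto simp: indicator_def)
  ultimately have "((\<lambda>T. complex_of_real (LINT t:{0..T}|lborel. exp (- t\<^sup>2)))
      \<longlongrightarrow> of_real (sqrt pi / 2)) at_top"
    by (intro tendsto_of_real) simp
  thus ?thesis
    by (rule Lim_transform_eventually)
       (use eventually_ge_at_top[of 0] in eventually_elim, simp add: gauss_prim_of_real)
qed

lemma gauss_prim_scaled_has_vector_derivative:
  "((\<lambda>t. gauss_prim (b * of_real t)) has_vector_derivative exp (- ((b * of_real t) ^ 2)) * b)
    (at t within S)"
proof (rule has_vector_derivative_real_field)
  show "((\<lambda>z. gauss_prim (b * z)) has_field_derivative exp (- ((b * of_real t) ^ 2)) * b)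
      (at (of_real t))"
    by (rule DERIV_chain2[OF gauss_prim_has_field_derivative]) (auto intro!: derivative_eq_intros)
qed

lemma Re_square_mult_of_real: "Re ((b * of_real t) ^ 2) = Re (b ^ 2) * t ^ 2"
  by (simp add: power2_eq_square algebra_simps)

lemma exp_minus_le_inverse:
  fixes y :: real
  assumes "y > 0"
  shows "exp (- y) \<le> 1 / y"
proof -
  have "y \<le> exp y" using exp_ge_add_one_self[of y] by linarith
  thus ?thesis using assms by (simp add: exp_minus field_simps)
qed

lemma norm_gauss_prim_diff_le:
  assumes b: "Re (b ^ 2) > 0" and T: "0 < T" "T \<le> S"
  shows "norm (gauss_prim (b * of_real S) - gauss_prim (b * of_real T)) \<le> norm b / (Re (b ^ 2) * T)"
proof -
  let ?f = "\<lambda>t. exp (- ((b * of_real t) ^ 2)) * b"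
  let ?g = "\<lambda>t. norm b / Re (b ^ 2) * (1 / t ^ 2)"
  have f: "(?f has_integral (gauss_prim (b * of_real S) - gauss_prim (b * of_real T))) {T..S}"
    using T(2) by (intro fundamental_theorem_of_calculus gauss_prim_scaled_has_vector_derivative)
  have g: "(?g has_integral (norm b / Re (b ^ 2) * (- 1 / S - (- 1 / T)))) {T..S}"
    using T by (intro has_integral_mult_right fundamental_theorem_of_calculus)
       (auto simp: has_real_derivative_iff_has_vector_derivative[symmetric] power2_eq_square
         intro!: derivative_eq_intros)
  have "norm (?f t) \<le> ?g t" if "t \<in> {T..S}" for t
  proof -
    have "Re (b ^ 2) * t ^ 2 > 0" using b that T by simp
    hence "exp (- (Re (b ^ 2) * t ^ 2)) * norm b \<le> 1 / (Re (b ^ 2) * t ^ 2) * norm b"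
      by (intro mult_right_mono exp_minus_le_inverse) auto
    thus ?thesis
      by (simp add: norm_mult Re_square_mult_of_real del: power_mult_distrib)
  qed
  from integral_norm_bound_integral[OF has_integral_integrable[OF f]
      has_integral_integrable[OF g] this]
  have "norm (gauss_prim (b * of_real S) - gauss_prim (b * of_real T))
      \<le> norm b / Re (b ^ 2) * (- 1 / S - (- 1 / T))"
    by (simp only: integral_unique[OF f] integral_unique[OF g])
  also have "\<dots> \<le> norm b / Re (b ^ 2) * (1 / T)"
    using b T by (intro mult_left_mono) auto
  finally show ?thesis by simp
qed

lemma Re_square_le_on_segment_to_norm:
  assumes "Re b > 0" "z \<in> closed_segment b (of_real (norm b))"
  shows "Re (b ^ 2) \<le> Re (z ^ 2)"
proof -
  obtain u where u: "0 \<le> u" "u \<le> 1" and z: "z = (1 - u) *\<^sub>R b + u *\<^sub>R of_real (norm b)"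
    using assms(2) by (auto simp: closed_segment_def)
  have "Re z - Re b = u * (norm b - Re b)" "Im z = (1 - u) * Im b"
    by (simp_all add: z algebra_simps)
  moreover have "0 \<le> u * (norm b - Re b)"
    using u complex_Re_le_cmod[of b] by simp
  ultimately have "Re b \<le> Re z" "\<bar>Im z\<bar> \<le> \<bar>Im b\<bar>"
    using u by (auto simp: abs_mult mult_left_le_one_le)
  hence "Re b ^ 2 \<le> Re z ^ 2" "Im z ^ 2 \<le> Im b ^ 2"
    using assms(1) by (auto intro: power_mono simp: abs_le_square_iff)
  thus ?thesis by (simp add: power2_eq_square)
qed

lemma norm_gauss_prim_minus_gauss_prim_norm_le:
  assumes "Re b > 0"
  shows "norm (gauss_prim b - gauss_prim (of_real (norm b)))
    \<le> exp (- Re (b ^ 2)) * norm (b - of_real (norm b))"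
proof (rule field_differentiable_bound[OF convex_closed_segment])
  fix z assume z: "z \<in> closed_segment b (of_real (norm b))"
  show "(gauss_prim has_field_derivative exp (- (z ^ 2)))
      (at z within closed_segment b (of_real (norm b)))"
    by (rule has_field_derivative_at_within[OF gauss_prim_has_field_derivative])
  show "norm (exp (- (z ^ 2))) \<le> exp (- Re (b ^ 2))"
    using Re_square_le_on_segment_to_norm[OF assms z] by simp
qed auto

lemma gauss_prim_tendsto_ray:
  assumes "Re b > 0" "Re (b ^ 2) > 0"
  shows "((\<lambda>S. gauss_prim (b * of_real S)) \<longlongrightarrow> of_real (sqrt pi / 2)) at_top"
proof -
  define \<kappa> where "\<kappa> = Re (b ^ 2)"
  define \<beta> where "\<beta> = norm b"
  have \<kappa>: "\<kappa> > 0" and \<beta>: "\<beta> > 0" using assms by (auto simp: \<kappa>_def \<beta>_def)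
  have "\<forall>\<^sub>F S in at_top. norm (gauss_prim (b * of_real S) - gauss_prim (of_real (\<beta> * S)))
      \<le> exp (- (\<kappa> * S ^ 2)) * (norm (b - of_real \<beta>) * S)"
    using eventually_gt_at_top[of 0]
  proof eventually_elim
    case (elim S)
    have "norm (b * of_real S) = \<beta> * S"
      using elim by (simp add: norm_mult \<beta>_def)
    moreover have "b * of_real S - of_real (\<beta> * S) = (b - of_real \<beta>) * of_real S"
      by (simp add: algebra_simps)
    ultimately show ?case
      using norm_gauss_prim_minus_gauss_prim_norm_le[of "b * of_real S"] assms(1) elim
      by (simp only: Re_square_mult_of_real \<kappa>_def norm_mult norm_of_real) simp
  qed
  moreover have "((\<lambda>S. exp (- (\<kappa> * S ^ 2)) * (norm (b - of_real \<beta>) * S)) \<longlongrightarrow> 0) at_top"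
    using \<kappa> by real_asymp
  ultimately have "((\<lambda>S. gauss_prim (b * of_real S) - gauss_prim (of_real (\<beta> * S))) \<longlongrightarrow> 0) at_top"
    by (rule Lim_null_comparison)
  moreover have "((\<lambda>S. gauss_prim (of_real (\<beta> * S))) \<longlongrightarrow> of_real (sqrt pi / 2)) at_top"
    by (rule filterlim_compose[OF gauss_prim_tendsto]) (use \<beta> in real_asymp)
  ultimately show ?thesis using tendsto_add by fastforce
qed

lemma norm_gauss_prim_minus_limit_le:
  assumes "Re b > 0" "Re (b ^ 2) > 0" "T > 0"
  shows "norm (gauss_prim (b * of_real T) - of_real (sqrt pi / 2)) \<le> norm b / (Re (b ^ 2) * T)"
proof (rule tendsto_upperbound)
  show "((\<lambda>S. norm (gauss_prim (b * of_real T) - gauss_prim (b * of_real S)))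
      \<longlongrightarrow> norm (gauss_prim (b * of_real T) - of_real (sqrt pi / 2))) at_top"
    by (intro tendsto_intros gauss_prim_tendsto_ray assms)
  show "\<forall>\<^sub>F S in at_top. norm (gauss_prim (b * of_real T) - gauss_prim (b * of_real S))
      \<le> norm b / (Re (b ^ 2) * T)"
    using eventually_ge_at_top[of T]
    by eventually_elim
       (use norm_gauss_prim_diff_le[OF assms(2,3)] in \<open>simp add: norm_minus_commute\<close>)
qed simp

lemma Re_csqrt_pos:
  assumes "Re w > 0"
  shows "Re (csqrt w) > 0"
proof -
  have "Re (csqrt w) \<noteq> 0"
  proof
    assume "Re (csqrt w) = 0"
    hence "Re (csqrt w ^ 2) \<le> 0" by (simp add: power2_eq_square)
    thus False using assms by simp
  qed
  thus ?thesis using csqrt_principal[of w] by auto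
qed

definition gaussian :: "complex \<Rightarrow> real \<Rightarrow> complex" where
  "gaussian w t = exp (- (w * of_real (t ^ 2)))"

lemma has_integral_gaussian:
  assumes w: "w \<noteq> 0" and "K > 0" "h \<ge> 0"
  shows "((\<lambda>v. gaussian w (K * (v - m))) has_integral
    2 * gauss_prim (csqrt w * of_real (K * h)) / (csqrt w * of_real K)) {m - h..m + h}"
proof -
  define b where "b = csqrt w"
  have b: "b \<noteq> 0" "b ^ 2 = w" using w by (simp_all add: b_def)
  define P where "P v = gauss_prim (b * of_real (K * (v - m))) / (b * of_real K)" for v
  have "((\<lambda>v. gaussian w (K * (v - m))) has_integral P (m + h) - P (m - h))
      {m - h..m + h}"
  proof (rule fundamental_theorem_of_calculus)
    fix v
    have "((\<lambda>v. gauss_prim (b * of_real (K * (v - m)))) has_vector_derivative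
        K *\<^sub>R (exp (- ((b * of_real (K * (v - m))) ^ 2)) * b)) (at v within {m - h..m + h})"
      by (rule vector_diff_chain_within[OF _ gauss_prim_scaled_has_vector_derivative,
            unfolded o_def])
         (auto simp: has_real_derivative_iff_has_vector_derivative[symmetric]
            intro!: derivative_eq_intros)
    from has_vector_derivative_divide[OF this, of "b * of_real K"]
    show "(P has_vector_derivative gaussian w (K * (v - m)))
        (at v within {m - h..m + h})"
      unfolding P_def gaussian_def using b assms(2)
      by (simp add: scaleR_conv_of_real power_mult_distrib)
  qed (use assms in simp)
  moreover have "P (m + h) - P (m - h)
      = 2 * gauss_prim (b * of_real (K * h)) / (b * of_real K)"
    using gauss_prim_minus[of "b * of_real (K * h)"]
    by (simp add: P_def diff_divide_distrib[symmetric])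
  ultimately show ?thesis by (simp add: b_def)
qed

lemma norm_gaussian_integral_error_le:
  assumes w: "Re w > 0" and K: "K > 0" and h: "h > 0"
  shows "norm (2 * gauss_prim (csqrt w * of_real (K * h)) / (csqrt w * of_real K)
    - of_real (sqrt pi) / (csqrt w * of_real K)) \<le> 2 / (Re w * h * K ^ 2)"
proof -
  define b where "b = csqrt w"
  have b: "Re b > 0" "b ^ 2 = w" using Re_csqrt_pos[OF w] by (simp_all add: b_def del: csqrt.simps)
  hence "b \<noteq> 0" by auto
  let ?e = "gauss_prim (b * of_real (K * h)) - of_real (sqrt pi / 2)"
  have "2 * gauss_prim (b * of_real (K * h)) / (b * of_real K)
      - of_real (sqrt pi) / (b * of_real K) = ?e * (2 / (b * of_real K))"
    using \<open>b \<noteq> 0\<close> K by (simp add: field_simps)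
  hence "norm (2 * gauss_prim (b * of_real (K * h)) / (b * of_real K)
      - of_real (sqrt pi) / (b * of_real K)) = norm ?e * (2 / (norm b * K))"
    using K by (simp only: norm_mult norm_divide norm_of_real norm_numeral abs_of_pos)
  also have "\<dots> \<le> norm b / (Re w * (K * h)) * (2 / (norm b * K))"
    using norm_gauss_prim_minus_limit_le[of b "K * h"] b w K h by (intro mult_right_mono) auto
  also have "\<dots> = 2 / (Re w * h * K ^ 2)"
    using \<open>b \<noteq> 0\<close> by (simp add: power2_eq_square)
  finally show ?thesis by (simp only: b_def)
qed

section \<open>The saddle point\<close>

lemma norm_integral_le:
  fixes f :: "real \<Rightarrow> complex"
  assumes "f integrable_on {a..b}" "a \<le> b" "0 \<le> B" "\<And>v. v \<in> {a..b} \<Longrightarrow> norm (f v) \<le> B"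
  shows "norm (integral {a..b} f) \<le> B * (b - a)"
  using has_integral_bound[of B f "integral {a..b} f" a b] assms
  by (simp add: integrable_integral)

lemma norm_integral_minus_subinterval_le:
  fixes f :: "real \<Rightarrow> complex"
  assumes f: "f integrable_on {a..b}" and order: "a \<le> l" "l \<le> u" "u \<le> b" and "0 \<le> B"
    and bound: "\<And>v. v \<in> {a..l} \<union> {u..b} \<Longrightarrow> norm (f v) \<le> B"
  shows "norm (integral {a..b} f - integral {l..u} f) \<le> B * (b - a)"
proof -
  have sub: "f integrable_on {a..l}" "f integrable_on {l..b}" "f integrable_on {u..b}"
    by (rule integrable_on_subinterval[OF f]; use order in auto)+
  have "integral {a..b} f - integral {l..u} f = integral {a..l} f + integral {u..b} f"
    using Henstock_Kurzweil_Integration.integral_combine[OF _ _ f, of l]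
      Henstock_Kurzweil_Integration.integral_combine[OF _ _ sub(2), of u] order
    by (simp add: algebra_simps)
  also have "norm \<dots> \<le> B * (l - a) + B * (b - u)"
    using sub order \<open>0 \<le> B\<close> bound by (intro norm_triangle_le add_mono norm_integral_le) auto
  also have "\<dots> = B * (b - a) - B * (u - l)"
    by (simp add: algebra_simps)
  also have "\<dots> \<le> B * (b - a)"
    using order \<open>0 \<le> B\<close> by simp
  finally show ?thesis .
qed

lemma norm_integral_le_arctan:
  fixes f :: "real \<Rightarrow> complex"
  assumes f: "(f has_integral I) {l..u}" and "l \<le> u" "K > 0" "0 \<le> B"
    and bound: "\<And>v. v \<in> {l..u} \<Longrightarrow> norm (f v) \<le> B * (1 / (1 + (K * (v - m)) ^ 2))"
  shows "norm I \<le> B * (pi / K)"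
proof -
  define A where "A v = arctan (K * (v - m)) / K" for v
  have "((\<lambda>v. 1 / (1 + (K * (v - m)) ^ 2)) has_integral (A u - A l)) {l..u}"
  proof (rule fundamental_theorem_of_calculus[OF \<open>l \<le> u\<close>])
    fix v
    have "(A has_real_derivative (inverse (1 + (K * (v - m)) ^ 2) * K) / K) (at v within {l..u})"
      unfolding A_def[abs_def] by (rule DERIV_cdivide) (auto intro!: derivative_eq_intros)
    thus "(A has_vector_derivative 1 / (1 + (K * (v - m)) ^ 2)) (at v within {l..u})"
      unfolding has_real_derivative_iff_has_vector_derivative[symmetric]
      using \<open>K > 0\<close> by (simp add: inverse_eq_divide)
  qed
  hence g: "((\<lambda>v. B * (1 / (1 + (K * (v - m)) ^ 2))) has_integral (B * (A u - A l))) {l..u}"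
    by (rule has_integral_mult_right)
  have "norm I \<le> B * (A u - A l)"
    using integral_norm_bound_integral[OF has_integral_integrable[OF f]
        has_integral_integrable[OF g] bound]
    by (simp only: integral_unique[OF f] integral_unique[OF g])
  also have "\<dots> \<le> B * (pi / K)"
  proof (intro mult_left_mono)
    have "arctan (K * (u - m)) - arctan (K * (l - m)) \<le> pi"
      using arctan_ubound[of "K * (u - m)"] arctan_lbound[of "K * (l - m)"] by linarith
    thus "A u - A l \<le> pi / K"
      unfolding A_def diff_divide_distrib[symmetric] using \<open>K > 0\<close> by (simp add: divide_right_mono)
  qed (rule \<open>0 \<le> B\<close>)
  finally show ?thesis .
qed

lemma saddle_integral:
  fixes f :: "real \<Rightarrow> complex" and w E I :: complex
  assumes f: "(f has_integral I) {a..b}" and w: "Re w > 0" and K: "K > 0" and h: "h > 0"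
    and inside: "a \<le> m - h" "m + h \<le> b" and nonneg: "0 \<le> A" "0 \<le> B"
    and major: "\<And>v. \<bar>v - m\<bar> \<le> h \<Longrightarrow> norm (f v - E * gaussian w (K * (v - m)))
      \<le> norm E * A * (1 / (1 + (K * (v - m)) ^ 2))"
    and minor: "\<And>v. v \<in> {a..b} \<Longrightarrow> \<bar>v - m\<bar> \<ge> h \<Longrightarrow> norm (f v) \<le> norm E * B"
  shows "norm (I - E * (of_real (sqrt pi) / (csqrt w * of_real K)))
    \<le> norm E * (B * (b - a) + A * (pi / K) + 2 / (Re w * h * K ^ 2))"
proof -
  define J where "J = 2 * gauss_prim (csqrt w * of_real (K * h)) / (csqrt w * of_real K)"
  define G where "G = of_real (sqrt pi) / (csqrt w * of_real K)"
  have integrable: "f integrable_on {a..b}" using f by (rule has_integral_integrable)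
  have "w \<noteq> 0" using w by auto
  have "norm (f v) \<le> norm E * B" if "v \<in> {a..m - h} \<union> {m + h..b}" for v
    using that inside h by (intro minor) auto
  hence "norm (I - integral {m - h..m + h} f) \<le> norm E * B * (b - a)"
    unfolding integral_unique[OF f, symmetric]
    using inside h \<open>0 \<le> B\<close> by (intro norm_integral_minus_subinterval_le integrable) auto
  moreover have "norm (integral {m - h..m + h} f - E * J) \<le> norm E * A * (pi / K)"
  proof (rule norm_integral_le_arctan[where m = m, OF _ _ K])
    show "((\<lambda>v. f v - E * gaussian w (K * (v - m))) has_integral
        (integral {m - h..m + h} f - E * J)) {m - h..m + h}"
      unfolding J_def using has_integral_gaussian[OF \<open>w \<noteq> 0\<close> K, of h m] h inside
      by (intro has_integral_diff has_integral_mult_right integrable_integral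
            integrable_on_subinterval[OF integrable]) auto
  qed (use major h nonneg in auto)
  moreover have "norm (E * J - E * G) \<le> norm E * (2 / (Re w * h * K ^ 2))"
    unfolding right_diff_distrib[symmetric] norm_mult J_def G_def
    by (intro mult_left_mono norm_gaussian_integral_error_le w K h) simp
  ultimately have "norm ((I - integral {m - h..m + h} f)
      + (integral {m - h..m + h} f - E * J) + (E * J - E * G))
      \<le> norm E * B * (b - a) + norm E * A * (pi / K) + norm E * (2 / (Re w * h * K ^ 2))"
    by (intro norm_triangle_le add_mono)
  thus ?thesis
    unfolding G_def by (simp add: algebra_simps)
qed

lemma bounded_if_tendsto_0_at_top:
  fixes g :: "real \<Rightarrow> real"
  assumes "(g \<longlongrightarrow> 0) at_top" "continuous_on {0..} g"
  shows "\<exists>C. \<forall>t\<ge>0. g t \<le> C"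
proof -
  have "\<forall>\<^sub>F t in at_top. g t < 1"
    using assms(1) by (rule order_tendstoD(2)) simp
  then obtain T where T: "\<And>t. t \<ge> T \<Longrightarrow> g t < 1"
    by (auto simp: eventually_at_top_linorder)
  have "bounded (g ` {0..T})"
    by (intro compact_imp_bounded compact_continuous_image continuous_on_subset[OF assms(2)]) auto
  then obtain C where C: "\<And>t. t \<in> {0..T} \<Longrightarrow> \<bar>g t\<bar> \<le> C"
    unfolding bounded_real by blast
  have "g t \<le> max 1 C" if "t \<ge> 0" for t
    using T[of t] C[of t] that by (cases "t \<le> T") (auto simp: abs_le_iff)
  thus ?thesis by blast
qed

lemma gaussian_decay:
  fixes \<kappa> :: real
  assumes "\<kappa> > 0"
  obtains C where "\<And>t. (1 + \<bar>t\<bar> ^ 3) * exp (- (\<kappa> * t ^ 2)) \<le> C * (1 / (1 + t ^ 2))"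
proof -
  let ?g = "\<lambda>t::real. (1 + t ^ 3) * exp (- (\<kappa> * t ^ 2)) * (1 + t ^ 2)"
  have "(?g \<longlongrightarrow> 0) at_top"
    using assms by real_asymp
  moreover have "continuous_on {0..} ?g"
    by (intro continuous_intros)
  ultimately obtain C where C: "\<And>t. t \<ge> 0 \<Longrightarrow> ?g t \<le> C"
    using bounded_if_tendsto_0_at_top[of ?g] by blast
  have "(1 + \<bar>t\<bar> ^ 3) * exp (- (\<kappa> * t ^ 2)) \<le> C * (1 / (1 + t ^ 2))" for t
    using C[of "\<bar>t\<bar>"] by (simp add: pos_le_divide_eq add_pos_nonneg)
  thus ?thesis using that by blast
qed

lemma norm_exp_minus_1_le: "norm (exp z - 1) \<le> norm z * exp (norm z)" for z :: complex
  using Taylor_exp_field[of z 0] by (simp add: mult.commute)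

lemma norm_gaussian_perturbation_le:
  fixes G D :: complex
  assumes G: "norm G \<le> exp (- (2 * \<kappa> * t ^ 2))"
    and D: "norm D \<le> (A * \<bar>t\<bar> ^ 3 + B) / N" "norm D \<le> \<kappa> * t ^ 2 + B"
    and "0 \<le> A" "0 \<le> B" "N > 0"
  shows "norm (G * (exp D - 1))
    \<le> exp B * (A + B) / N * ((1 + \<bar>t\<bar> ^ 3) * exp (- (\<kappa> * t ^ 2)))"
proof -
  have "A * \<bar>t\<bar> ^ 3 + B \<le> (A + B) * (1 + \<bar>t\<bar> ^ 3)"
    using assms by (simp add: algebra_simps)
  hence bound: "norm D \<le> (A + B) * (1 + \<bar>t\<bar> ^ 3) / N"
    using D(1) divide_right_mono[of _ _ N] \<open>N > 0\<close> by (meson less_imp_le order_trans)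
  have "norm (G * (exp D - 1)) \<le> exp (- (2 * \<kappa> * t ^ 2)) * (norm D * exp (norm D))"
    unfolding norm_mult by (intro mult_mono G norm_exp_minus_1_le) auto
  also have "\<dots> \<le> exp (- (2 * \<kappa> * t ^ 2))
      * ((A + B) * (1 + \<bar>t\<bar> ^ 3) / N * exp (\<kappa> * t ^ 2 + B))"
    using D(2) assms by (intro mult_left_mono mult_mono bound) auto
  also have "\<dots> = (A + B) * (1 + \<bar>t\<bar> ^ 3) / N
      * (exp (- (2 * \<kappa> * t ^ 2)) * exp (\<kappa> * t ^ 2 + B))"
    by (simp only: mult_ac)
  also have "exp (- (2 * \<kappa> * t ^ 2)) * exp (\<kappa> * t ^ 2 + B) = exp B * exp (- (\<kappa> * t ^ 2))"
    by (simp add: exp_add[symmetric])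
  finally show ?thesis by (simp add: mult_ac)
qed

definition saddle_exponent :: "complex \<Rightarrow> real \<Rightarrow> complex" where
  "saddle_exponent c b = c ^ 3 / (2 * (c + \<i> * of_real b) ^ 2) + (c + \<i> * of_real b)"

definition saddle_remainder :: "complex \<Rightarrow> real \<Rightarrow> complex" where
  "saddle_remainder c b = \<i> * of_real b ^ 3 * (c + 3 * (c + \<i> * of_real b))
     / (2 * (c + \<i> * of_real b) ^ 2 * c)"

lemma saddle_exponent_eq:
  assumes "c \<noteq> 0" "c + \<i> * of_real b \<noteq> 0"
  shows "saddle_exponent c b
    = 3 / 2 * c - 3 / (2 * c) * of_real b ^ 2 + saddle_remainder c b"
proof -
  define \<sigma> where "\<sigma> = c + \<i> * of_real b"
  have b: "of_real b = - \<i> * (\<sigma> - c)" by (simp add: \<sigma>_def)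
  have powers: "\<i> * (- \<i> * (\<sigma> - c)) ^ 3 = - ((\<sigma> - c) ^ 3)" "(- \<i> * (\<sigma> - c)) ^ 2 = - ((\<sigma> - c) ^ 2)"
    by (simp_all only: power_mult_distrib) (simp_all add: power3_eq_cube power2_eq_square)
  have "\<sigma> \<noteq> 0" using assms(2) by (simp add: \<sigma>_def)
  have "c ^ 3 / (2 * \<sigma> ^ 2) + \<sigma>
      = 3 / 2 * c + 3 / (2 * c) * (\<sigma> - c) ^ 2 - (\<sigma> - c) ^ 3 * (c + 3 * \<sigma>) / (2 * \<sigma> ^ 2 * c)"
    using assms(1) \<open>\<sigma> \<noteq> 0\<close>
    by (simp add: divide_simps) (simp add: power2_eq_square power3_eq_cube algebra_simps)
  thus ?thesis
    unfolding saddle_exponent_def saddle_remainder_def \<sigma>_def[symmetric] b powers by simp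
qed

lemma norm_saddle_remainder_le:
  assumes "a0 > 0" "a0 \<le> Re c" "norm c \<le> C0" "\<bar>b\<bar> \<le> 1"
  shows "norm (saddle_remainder c b) \<le> (4 * C0 + 3) / (2 * a0 ^ 3) * \<bar>b\<bar> ^ 3"
proof -
  define \<sigma> where "\<sigma> = c + \<i> * of_real b"
  have lower: "a0 \<le> norm c" "a0 \<le> norm \<sigma>"
    using assms(2) complex_Re_le_cmod[of c] complex_Re_le_cmod[of \<sigma>] by (auto simp: \<sigma>_def)
  have "norm \<sigma> \<le> norm c + 1"
    unfolding \<sigma>_def using assms(4) norm_triangle_ineq[of c "\<i> * of_real b"] by (simp add: norm_mult)
  hence upper: "norm (c + 3 * \<sigma>) \<le> 4 * C0 + 3"
    using norm_triangle_ineq[of c "3 * \<sigma>"] assms(3) by (simp add: norm_mult)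
  have "norm (saddle_remainder c b)
      = \<bar>b\<bar> ^ 3 * norm (c + 3 * \<sigma>) / (2 * norm \<sigma> ^ 2 * norm c)"
    by (simp add: saddle_remainder_def \<sigma>_def[symmetric] norm_mult norm_divide norm_power)
  also have "\<dots> \<le> \<bar>b\<bar> ^ 3 * (4 * C0 + 3) / (2 * a0 ^ 2 * a0)"
    using lower upper assms by (intro frac_le mult_mono power_mono mult_pos_pos) auto
  also have "\<dots> = (4 * C0 + 3) / (2 * a0 ^ 3) * \<bar>b\<bar> ^ 3"
    by (simp add: power2_eq_square power3_eq_cube mult_ac)
  finally show ?thesis .
qed

lemma Re_three_halves_div_ge:
  assumes "a0 > 0" "a0 \<le> Re c" "norm c \<le> C0"
  shows "Re (3 / (2 * c)) \<ge> 3 * a0 / (2 * C0 ^ 2)"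
proof -
  have "c \<noteq> 0" using assms by auto
  have "3 / (2 * c) = of_real (3 / 2) * inverse c" by (simp add: field_simps)
  hence "Re (3 / (2 * c)) = 3 / 2 * (Re c / norm c ^ 2)"
    by (simp only: times_complex.sel Re_complex_of_real Im_complex_of_real inverse_complex.sel
        cmod_power2)
  also have "\<dots> \<ge> 3 / 2 * (a0 / C0 ^ 2)"
    using assms \<open>c \<noteq> 0\<close> by (intro mult_left_mono frac_le power_mono) auto
  finally show ?thesis by simp
qed

lemma exp_saddle_exponent_minus_gaussian:
  fixes c R :: complex and b N :: real
  assumes "Re c > 0"
  defines "G \<equiv> gaussian (3 / (2 * c)) (N * b)"
  shows "exp (of_real (N ^ 2) * saddle_exponent c b + R) - exp (of_real (N ^ 2) * (3 / 2 * c)) * G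
    = exp (of_real (N ^ 2) * (3 / 2 * c))
      * (G * (exp (of_real (N ^ 2) * saddle_remainder c b + R) - 1))"
proof -
  have "c \<noteq> 0" "c + \<i> * of_real b \<noteq> 0" using assms(1) by (auto simp: complex_eq_iff)
  hence "of_real (N ^ 2) * saddle_exponent c b + R
    = of_real (N ^ 2) * (3 / 2 * c) + (- (3 / (2 * c) * of_real ((N * b) ^ 2)))
      + (of_real (N ^ 2) * saddle_remainder c b + R)"
    by (subst saddle_exponent_eq) (simp_all add: power_mult_distrib algebra_simps)
  thus ?thesis
    unfolding G_def gaussian_def by (simp only: exp_add right_diff_distrib mult_1_right mult.assoc)
qed

lemma norm_saddle_perturbation_le:
  fixes c R :: complex and b N a0 C0 C1 :: real
  assumes c: "a0 > 0" "a0 \<le> Re c" "norm c \<le> C0" and N: "N \<ge> 1" and b: "\<bar>b\<bar> \<le> 1"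
    and R: "norm R \<le> C1 / N"
  defines "A1 \<equiv> (4 * C0 + 3) / (2 * a0 ^ 3)" and "D \<equiv> of_real (N ^ 2) * saddle_remainder c b + R"
  shows "norm D \<le> (A1 * \<bar>N * b\<bar> ^ 3 + C1) / N"
    and "A1 * \<bar>b\<bar> \<le> \<kappa> \<Longrightarrow> norm D \<le> \<kappa> * (N * b) ^ 2 + C1"
proof -
  have "norm (saddle_remainder c b) \<le> A1 * \<bar>b\<bar> ^ 3"
    unfolding A1_def by (rule norm_saddle_remainder_le[OF c b])
  hence "norm (of_real (N ^ 2) * saddle_remainder c b) \<le> N ^ 2 * (A1 * \<bar>b\<bar> ^ 3)"
    unfolding norm_mult norm_of_real by (simp add: mult_left_mono)
  also have "N ^ 2 * (A1 * \<bar>b\<bar> ^ 3) = A1 * \<bar>N * b\<bar> ^ 3 / N"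
    using N by (simp add: abs_mult power_mult_distrib power2_eq_square power3_eq_cube)
  finally have "norm D \<le> A1 * \<bar>N * b\<bar> ^ 3 / N + norm R"
    unfolding D_def by (intro norm_triangle_le add_right_mono)
  thus cubic: "norm D \<le> (A1 * \<bar>N * b\<bar> ^ 3 + C1) / N"
    using R by (simp add: add_divide_distrib)
  assume \<kappa>: "A1 * \<bar>b\<bar> \<le> \<kappa>"
  have "A1 * \<bar>N * b\<bar> ^ 3 / N = A1 * \<bar>b\<bar> * (N * b) ^ 2"
    using N by (simp add: abs_mult power_mult_distrib power2_eq_square power3_eq_cube)
  also have "\<dots> \<le> \<kappa> * (N * b) ^ 2"
    using \<kappa> by (intro mult_right_mono) auto
  moreover have "0 \<le> C1 / N" using R norm_ge_zero order_trans by blast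
  hence "C1 / N \<le> C1" using N divide_left_mono[of 1 N C1] by (simp add: zero_le_divide_iff)
  ultimately show "norm D \<le> \<kappa> * (N * b) ^ 2 + C1"
    using cubic by (simp add: add_divide_distrib)
qed

lemma norm_gaussian_le:
  assumes "\<kappa> \<le> Re w"
  shows "norm (gaussian w t) \<le> exp (- (\<kappa> * t ^ 2))"
proof -
  have "\<kappa> * t ^ 2 \<le> Re w * t ^ 2"
    by (intro mult_right_mono assms) simp
  also have "\<dots> = Re (w * of_real (t ^ 2))"
    by (simp only: times_complex.sel Re_complex_of_real Im_complex_of_real mult_zero_right
        diff_zero)
  finally show ?thesis
    by (simp only: gaussian_def norm_exp_eq_Re uminus_complex.sel exp_le_cancel_iff
        neg_le_iff_le)
qed

lemma norm_saddle_minus_gaussian_le: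
  fixes c R :: complex and b N a0 C0 C1 :: real
  assumes c: "a0 > 0" "a0 \<le> Re c" "norm c \<le> C0" and N: "N \<ge> 1" and b: "\<bar>b\<bar> \<le> 1"
    and R: "norm R \<le> C1 / N"
  defines "A \<equiv> (4 * C0 + 3) / (2 * a0 ^ 3)" and "\<kappa> \<equiv> 3 * a0 / (4 * C0 ^ 2)"
  assumes small: "A * \<bar>b\<bar> \<le> \<kappa>"
  shows "norm (exp (of_real (N ^ 2) * saddle_exponent c b + R)
      - exp (of_real (N ^ 2) * (3 / 2 * c)) * gaussian (3 / (2 * c)) (N * b))
    \<le> norm (exp (of_real (N ^ 2) * (3 / 2 * c)))
      * (exp C1 * (A + C1) / N * ((1 + \<bar>N * b\<bar> ^ 3) * exp (- (\<kappa> * (N * b) ^ 2))))"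
proof -
  define D where "D = of_real (N ^ 2) * saddle_remainder c b + R"
  have "norm D \<le> (A * \<bar>N * b\<bar> ^ 3 + C1) / N" "norm D \<le> \<kappa> * (N * b) ^ 2 + C1"
    using norm_saddle_perturbation_le[OF c N b R] small by (auto simp: A_def D_def)
  moreover have "0 \<le> C1 / N" using R norm_ge_zero order_trans by blast
  hence "0 \<le> C1" using N by (simp add: zero_le_divide_iff)
  moreover have "C0 \<ge> 0" using c(3) norm_ge_zero order_trans by blast
  hence "A \<ge> 0" using c(1) by (simp add: A_def)
  moreover have "norm (gaussian (3 / (2 * c)) (N * b)) \<le> exp (- (2 * \<kappa> * (N * b) ^ 2))"
    using Re_three_halves_div_ge[OF c] by (intro norm_gaussian_le) (simp add: \<kappa>_def)
  ultimately have "norm (gaussian (3 / (2 * c)) (N * b) * (exp D - 1))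
      \<le> exp C1 * (A + C1) / N * ((1 + \<bar>N * b\<bar> ^ 3) * exp (- (\<kappa> * (N * b) ^ 2)))"
    using N by (intro norm_gaussian_perturbation_le) auto
  moreover have "Re c > 0" using c by simp
  ultimately show ?thesis
    unfolding exp_saddle_exponent_minus_gaussian[OF \<open>Re c > 0\<close>] D_def[symmetric]
      norm_mult[of "exp (of_real (N ^ 2) * (3 / 2 * c))"]
    by (intro mult_left_mono) auto
qed

lemma saddle_major_arc:
  fixes a0 C0 C1 :: real
  assumes "a0 > 0" "C0 > 0" "C1 \<ge> 0"
  obtains \<eta> A where "0 < \<eta>" "\<eta> \<le> 1" "0 \<le> A"
    "\<And>c R b N. a0 \<le> Re c \<Longrightarrow> norm c \<le> C0 \<Longrightarrow> N \<ge> 1 \<Longrightarrow> \<bar>b\<bar> \<le> \<eta> \<Longrightarrow> norm R \<le> C1 / N \<Longrightarrow>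
      norm (exp (of_real (N ^ 2) * saddle_exponent c b + R)
        - exp (of_real (N ^ 2) * (3 / 2 * c)) * gaussian (3 / (2 * c)) (N * b))
      \<le> norm (exp (of_real (N ^ 2) * (3 / 2 * c))) * (A / N) * (1 / (1 + (N * b) ^ 2))"
proof -
  define A where "A = (4 * C0 + 3) / (2 * a0 ^ 3)"
  define \<kappa> where "\<kappa> = 3 * a0 / (4 * C0 ^ 2)"
  have pos: "A > 0" "\<kappa> > 0" using assms by (auto simp: A_def \<kappa>_def)
  define \<eta> where "\<eta> = min 1 (\<kappa> / A)"
  have \<eta>: "0 < \<eta>" "\<eta> \<le> 1" "A * \<eta> \<le> \<kappa>"
    using pos by (auto simp: \<eta>_def min_def field_simps)
  obtain C where decay: "\<And>t. (1 + \<bar>t\<bar> ^ 3) * exp (- (\<kappa> * t ^ 2)) \<le> C * (1 / (1 + t ^ 2))"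
    using gaussian_decay[OF pos(2)] by blast
  have "C \<ge> 1" using decay[of 0] by simp
  show ?thesis
  proof (rule that[of \<eta> "exp C1 * (A + C1) * C"])
    show "0 \<le> exp C1 * (A + C1) * C" using pos assms \<open>C \<ge> 1\<close> by simp
    fix c R :: complex and b N :: real
    assume c: "a0 \<le> Re c" "norm c \<le> C0" and N: "N \<ge> 1" and b: "\<bar>b\<bar> \<le> \<eta>"
      and R: "norm R \<le> C1 / N"
    have "A * \<bar>b\<bar> \<le> \<kappa>"
      using mult_left_mono[OF b less_imp_le[OF pos(1)]] \<eta>(3) by linarith
    hence "norm (exp (of_real (N ^ 2) * saddle_exponent c b + R)
          - exp (of_real (N ^ 2) * (3 / 2 * c)) * gaussian (3 / (2 * c)) (N * b))
        \<le> norm (exp (of_real (N ^ 2) * (3 / 2 * c)))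
          * (exp C1 * (A + C1) / N * ((1 + \<bar>N * b\<bar> ^ 3) * exp (- (\<kappa> * (N * b) ^ 2))))"
      unfolding A_def \<kappa>_def using b \<eta>(2) by (intro norm_saddle_minus_gaussian_le assms c N R) auto
    also have "\<dots> \<le> norm (exp (of_real (N ^ 2) * (3 / 2 * c)))
        * (exp C1 * (A + C1) / N * (C * (1 / (1 + (N * b) ^ 2))))"
      using pos assms N by (intro mult_left_mono decay) auto
    finally show "norm (exp (of_real (N ^ 2) * saddle_exponent c b + R)
        - exp (of_real (N ^ 2) * (3 / 2 * c)) * gaussian (3 / (2 * c)) (N * b))
      \<le> norm (exp (of_real (N ^ 2) * (3 / 2 * c))) * (exp C1 * (A + C1) * C / N)
        * (1 / (1 + (N * b) ^ 2))"
      by (simp add: mult.assoc)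
  qed (use \<eta> in auto)
qed

lemma saddle_integral_relative_error:
  fixes f :: "real \<Rightarrow> complex" and w E I :: complex and N \<eta> A B :: real
  defines "G \<equiv> E * (of_real (sqrt pi) / (csqrt w * of_real (N ^ 2)))"
  assumes f: "(f has_integral I) {-pi..pi}" and w: "Re w > 0" and N: "N > 0" and \<eta>: "\<eta> > 0"
    and inside: "-pi \<le> m - \<eta> / N" "m + \<eta> / N \<le> pi"
    and nonneg: "0 \<le> A" "0 \<le> B"
    and major: "\<And>v. \<bar>v - m\<bar> \<le> \<eta> / N \<Longrightarrow>
      norm (f v - E * gaussian w (N ^ 2 * (v - m)))
      \<le> norm E * (A / N) * (1 / (1 + (N ^ 2 * (v - m)) ^ 2))"
    and minor: "\<And>v. v \<in> {-pi..pi} \<Longrightarrow> \<bar>v - m\<bar> \<ge> \<eta> / N \<Longrightarrow> norm (f v) \<le> norm E * (B / N ^ 3)"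
  shows "norm (I - G)
    \<le> norm G * (norm (csqrt w) / sqrt pi * (B * (2 * pi) + A * pi + 2 / (Re w * \<eta>)) / N)"
proof -
  have "csqrt w \<noteq> 0" using w by auto
  have "norm (I - G) \<le> norm E * (B / N ^ 3 * (pi - - pi) + A / N * (pi / N ^ 2)
      + 2 / (Re w * (\<eta> / N) * (N ^ 2) ^ 2))"
    unfolding G_def by (rule saddle_integral[OF f w _ _ inside _ _ major minor])
      (use N \<eta> nonneg in auto)
  also have "Re w * (\<eta> / N) * (N ^ 2) ^ 2 = Re w * \<eta> * N ^ 3"
    using N by (simp add: power2_eq_square power3_eq_cube)
  also have "B / N ^ 3 * (pi - - pi) + A / N * (pi / N ^ 2) + 2 / (Re w * \<eta> * N ^ 3)
      = (B * (2 * pi) + A * pi + 2 / (Re w * \<eta>)) / N ^ 3"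
    by (simp add: add_divide_distrib power2_eq_square power3_eq_cube)
  also have "norm E * ((B * (2 * pi) + A * pi + 2 / (Re w * \<eta>)) / N ^ 3)
      = norm G * (norm (csqrt w) / sqrt pi * (B * (2 * pi) + A * pi + 2 / (Re w * \<eta>)) / N)"
  proof -
    have "norm G = norm E * (sqrt pi / (norm (csqrt w) * N ^ 2))"
      using N by (simp add: G_def norm_mult norm_divide norm_power)
    thus ?thesis
      using N \<open>csqrt w \<noteq> 0\<close> by (simp add: power2_eq_square power3_eq_cube)
  qed
  finally show ?thesis .
qed

section \<open>Uniform asymptotics\<close>

definition uniformly_asymptotic ::
    "complex set \<Rightarrow> (nat \<Rightarrow> complex \<Rightarrow> complex) \<Rightarrow> (nat \<Rightarrow> complex \<Rightarrow> complex) \<Rightarrow> bool" where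
  "uniformly_asymptotic X f g \<longleftrightarrow> (\<exists>(C :: real) (E :: nat \<Rightarrow> complex \<Rightarrow> complex).
     \<forall>\<^sub>F n in sequentially. \<forall>x\<in>X.
       f n x = g n x * (1 + E n x) \<and> norm (E n x) \<le> C * real n powr (- 1 / 3))"

lemma uniformly_asymptoticI:
  assumes error: "\<And>n x. n > 0 \<Longrightarrow> real n powr (1 / 3) \<ge> N0 \<Longrightarrow> x \<in> X \<Longrightarrow>
      norm (f n x - g n x) \<le> norm (g n x) * (K / real n powr (1 / 3))"
    and nonzero: "\<And>n x. n > 0 \<Longrightarrow> x \<in> X \<Longrightarrow> g n x \<noteq> 0"
  shows "uniformly_asymptotic X f g"
proof -
  define E where "E n x = f n x / g n x - 1" for n x
  have "filterlim (\<lambda>n. real n powr (1 / 3)) at_top sequentially" by real_asymp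
  hence "\<forall>\<^sub>F n in sequentially. real n powr (1 / 3) \<ge> N0" by (simp add: filterlim_at_top)
  hence "\<forall>\<^sub>F n in sequentially. \<forall>x\<in>X.
      f n x = g n x * (1 + E n x) \<and> norm (E n x) \<le> K * real n powr (- 1 / 3)"
    using eventually_gt_at_top[of 0]
  proof eventually_elim
    case (elim n)
    have "norm (E n x) \<le> K / real n powr (1 / 3)" if "x \<in> X" for x
    proof -
      have g: "g n x \<noteq> 0" using nonzero elim that by blast
      hence "norm (E n x) = norm (f n x - g n x) / norm (g n x)"
        by (simp add: E_def norm_divide[symmetric] diff_divide_distrib)
      thus ?thesis
        using error[OF elim(2,1) that] g by (simp add: divide_le_eq mult.commute)
    qed
    thus ?case
      using nonzero elim by (auto simp: E_def powr_minus_divide)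
  qed
  thus ?thesis unfolding uniformly_asymptotic_def by blast
qed

lemma uniformly_asymptotic_mult_left:
  assumes "uniformly_asymptotic X f g"
  shows "uniformly_asymptotic X (\<lambda>n x. c n * f n x) (\<lambda>n x. c n * g n x)"
proof -
  obtain C E where "\<forall>\<^sub>F n in sequentially. \<forall>x\<in>X.
      f n x = g n x * (1 + E n x) \<and> norm (E n x) \<le> C * real n powr (- 1 / 3)"
    using assms unfolding uniformly_asymptotic_def by blast
  hence "\<forall>\<^sub>F n in sequentially. \<forall>x\<in>X.
      c n * f n x = c n * g n x * (1 + E n x) \<and> norm (E n x) \<le> C * real n powr (- 1 / 3)"
    by eventually_elim (simp add: mult.assoc)
  thus ?thesis unfolding uniformly_asymptotic_def by blast
qed

lemma uniformly_asymptotic_cong_right: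
  assumes "uniformly_asymptotic X f g" "\<And>n x. x \<in> X \<Longrightarrow> g n x = g' n x"
  shows "uniformly_asymptotic X f g'"
  using assms by (simp add: uniformly_asymptotic_def cong: ball_cong)

definition saddle_main_term :: "nat \<Rightarrow> nat \<Rightarrow> complex \<Rightarrow> complex" where
  "saddle_main_term q n x = csqrt (L q x / of_real (6 * pi * real n powr (4 / 3)))
     * exp (3 / 2 * of_real (real n powr (2 / 3)) * L q x)"

lemma compact_continuous_norm_bounded:
  assumes "compact X" "continuous_on X (f :: _ \<Rightarrow> complex)"
  shows "\<exists>C>0. \<forall>x\<in>X. norm (f x) \<le> C"
proof -
  have "bounded (f ` X)"
    by (intro compact_imp_bounded compact_continuous_image assms)
  thus ?thesis by (simp add: bounded_pos)
qed

lemma compact_continuous_bounded_below_pos: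
  assumes "compact X" "continuous_on X f" "\<And>x. x \<in> X \<Longrightarrow> (0::real) < f x"
  shows "\<exists>a>0. \<forall>x\<in>X. a \<le> f x"
proof (cases "X = {}")
  case False
  thus ?thesis using continuous_attains_inf[OF assms(1) False assms(2)] assms(3) by blast
qed (auto intro!: exI[of _ 1])

lemma Re_three_halves_div_pos:
  assumes "Re c > 0"
  shows "Re (3 / (2 * c)) > 0"
proof -
  have "3 * Re c / (2 * (norm c) ^ 2) > 0"
    using assms by (intro divide_pos_pos) auto
  thus ?thesis
    using Re_three_halves_div_ge[of "Re c" c "norm c"] assms by linarith
qed

lemma saddle_error_constant_le:
  fixes c :: complex and a C0 \<eta> A B :: real
  defines "w \<equiv> 3 / (2 * c)"
  assumes "a > 0" "a \<le> Re c" "norm c \<le> C0" "\<eta> > 0" "A \<ge> 0" "B \<ge> 0"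
  shows "norm (csqrt w) / sqrt pi * (B * (2 * pi) + A * pi + 2 / (Re w * \<eta>))
    \<le> sqrt (3 / (2 * a)) / sqrt pi * (B * (2 * pi) + A * pi + 2 / (3 * a / (2 * C0 ^ 2) * \<eta>))"
proof (intro mult_left_mono divide_right_mono mult_mono add_left_mono)
  have "norm w \<le> 3 / (2 * a)"
    using assms complex_Re_le_cmod[of c] by (simp add: norm_divide norm_mult frac_le)
  thus "norm (csqrt w) \<le> sqrt (3 / (2 * a))" by (simp add: norm_csqrt)
  have "norm c > 0" using assms by auto
  hence "0 < 3 * a / (2 * C0 ^ 2)" using assms by (intro divide_pos_pos) auto
  moreover have "3 * a / (2 * C0 ^ 2) \<le> Re w"
    unfolding w_def by (rule Re_three_halves_div_ge) fact+
  ultimately show "2 / (Re w * \<eta>) \<le> 2 / (3 * a / (2 * C0 ^ 2) * \<eta>)"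
    using \<open>\<eta> > 0\<close> by (intro divide_left_mono mult_right_mono mult_pos_pos) auto
qed (use assms Re_three_halves_div_pos[of c] in \<open>auto simp del: csqrt.simps\<close>)

lemma csqrt_div_eq:
  assumes "Re c > 0" "N > 0"
  shows "csqrt (c / of_real (6 * pi * N ^ 4))
    = of_real (sqrt pi) / (csqrt (3 / (2 * c)) * of_real (N ^ 2)) / (2 * of_real pi)"
proof (rule csqrt_unique)
  define w where "w = 3 / (2 * c)"
  define k where "k = sqrt pi / (2 * pi * N ^ 2)"
  define z where "z = of_real k * inverse (csqrt w)"
  have z: "of_real (sqrt pi) / (csqrt w * of_real (N ^ 2)) / (2 * of_real pi) = z"
    by (simp add: z_def k_def field_simps del: csqrt.simps)
  have "c \<noteq> 0" using assms(1) by auto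
  have "k ^ 2 = 1 / (4 * pi * N ^ 4)"
    by (simp add: k_def power_divide power_mult_distrib power_mult[symmetric])
       (simp add: power2_eq_square)
  hence "z ^ 2 = of_real (1 / (4 * pi * N ^ 4)) * inverse w"
    unfolding z_def power_mult_distrib power_inverse power2_csqrt of_real_power[symmetric] by simp
  also have "\<dots> = c / of_real (6 * pi * N ^ 4)"
    using \<open>c \<noteq> 0\<close> assms(2) by (simp add: w_def field_simps)
  finally show "(of_real (sqrt pi) / (csqrt (3 / (2 * c)) * of_real (N ^ 2)) / (2 * of_real pi)) ^ 2
      = c / of_real (6 * pi * N ^ 4)"
    unfolding w_def[symmetric] z .
  have "Re w > 0"
    unfolding w_def by (rule Re_three_halves_div_pos[OF assms(1)])
  hence "Re (csqrt w) > 0" by (rule Re_csqrt_pos)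
  hence "Re (inverse (csqrt w)) > 0"
    by (simp only: inverse_complex.sel zero_less_divide_iff) (simp add: add_pos_nonneg)
  moreover have "k > 0" using assms(2) by (simp add: k_def)
  ultimately have "Re z > 0"
    by (simp only: z_def scaleR_conv_of_real[symmetric] scaleR_complex.sel mult_pos_pos)
  thus "0 < Re (of_real (sqrt pi) / (csqrt (3 / (2 * c)) * of_real (N ^ 2)) / (2 * of_real pi))
      \<or> Re (of_real (sqrt pi) / (csqrt (3 / (2 * c)) * of_real (N ^ 2)) / (2 * of_real pi)) = 0
        \<and> 0 \<le> Im (of_real (sqrt pi) / (csqrt (3 / (2 * c)) * of_real (N ^ 2)) / (2 * of_real pi))"
    unfolding w_def[symmetric] z by blast
qed

locale dominant_saddle = dominant_root +
  fixes B :: "complex \<Rightarrow> complex"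
  assumes continuous_B: "continuous_on X B"
    and expansion: "\<exists>C. \<forall>x\<in>X. \<forall>s\<in>cone M.
      norm (log_gf x (\<epsilon> * exp (- s)) - (L q x ^ 3 / (2 * s ^ 2) + B x)) \<le> C * norm s"
begin

definition integrand :: "real \<Rightarrow> complex \<Rightarrow> real \<Rightarrow> complex" where
  "integrand N x v = exp (log_gf x (\<epsilon> * exp (- circle_point q N x v))
     + of_real (N ^ 3) * circle_point q N x v)"

definition peak :: "real \<Rightarrow> complex \<Rightarrow> complex" where
  "peak N x = exp (B x) * exp (of_real (N ^ 2) * (3 / 2 * L q x))"

definition saddle_value :: "real \<Rightarrow> complex \<Rightarrow> complex" where
  "saddle_value N x
     = peak N x * (of_real (sqrt pi) / (csqrt (3 / (2 * L q x)) * of_real (N ^ 2)))"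

lemma integrand_has_integral:
  assumes "x \<in> X" "n > 0" "N > 0" "N ^ 3 = real n"
  shows "(integrand N x has_integral (2 * of_real pi * (\<epsilon> ^ n * Q n x))) {-pi..pi}"
proof -
  have "Re (L q x) / N > 0" using Re_L_pos[OF assms(1)] assms(3) by simp
  from trace_poly_integral[OF norm_less_1[OF assms(1)] this norm_root, of n]
  show ?thesis
    unfolding integrand_def circle_point_def assms(4) trace_poly_eq_Q[OF assms(2)] by simp
qed

definition offset :: "real \<Rightarrow> complex \<Rightarrow> real \<Rightarrow> real" where
  "offset N x v = v - Im (L q x) / N"

definition expansion_error :: "complex \<Rightarrow> complex \<Rightarrow> complex" where
  "expansion_error x s = log_gf x (\<epsilon> * exp (- s)) - (L q x ^ 3 / (2 * s ^ 2) + B x)"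

lemma L_bounds: "\<exists>a>0. \<exists>C>0. \<forall>x\<in>X. a \<le> Re (L q x) \<and> norm (L q x) \<le> C"
proof -
  have "\<exists>a>0. \<forall>x\<in>X. a \<le> Re (L q x)"
    by (intro compact_continuous_bounded_below_pos compact continuous_on_Re continuous_L Re_L_pos)
  thus ?thesis
    using compact_continuous_norm_bounded[OF compact continuous_L] by blast
qed

lemma abs_times_offset:
  assumes "N > 0"
  shows "\<bar>N * v - Im (L q x)\<bar> = N * \<bar>offset N x v\<bar>"
proof -
  have "N * v - Im (L q x) = N * offset N x v"
    using assms by (simp add: offset_def right_diff_distrib)
  thus ?thesis using assms by (simp add: abs_mult)
qed

lemma times_circle_point:
  assumes "N > 0"
  shows "of_real N * circle_point q N x v = L q x + \<i> * of_real (N * offset N x v)"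
  using assms by (simp add: complex_eq_iff offset_def circle_point_def field_simps)

lemma integrand_eq_saddle:
  assumes "x \<in> X" "N > 0"
  shows "integrand N x v = exp (B x) * exp (of_real (N ^ 2)
    * saddle_exponent (L q x) (N * offset N x v) + expansion_error x (circle_point q N x v))"
proof -
  define s where "s = circle_point q N x v"
  have "s \<noteq> 0"
    using Re_L_pos[OF assms(1)] assms(2) by (auto simp: s_def circle_point_def complex_eq_iff)
  hence quotient: "of_real (N ^ 2) * (L q x ^ 3 / (2 * (of_real N * s) ^ 2))
      = L q x ^ 3 / (2 * s ^ 2)"
    using assms(2) by (simp add: power_mult_distrib)
  have cube: "of_real (N ^ 2) * (of_real N * s) = of_real (N ^ 3) * s"
    by (simp add: power2_eq_square power3_eq_cube)
  show ?thesis
    unfolding saddle_exponent_def times_circle_point[OF assms(2), symmetric] integrand_def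
      expansion_error_def s_def[symmetric] distrib_left exp_add[symmetric] quotient cube
    by (simp add: add.commute)
qed

lemma circle_point_near_saddle:
  assumes "N > 0" "x \<in> X" "\<bar>N * offset N x v\<bar> \<le> 1"
    and "a > 0" "a \<le> Re (L q x)" "norm (L q x) \<le> C"
  shows "norm (circle_point q N x v) \<le> (C + 1) / N" "circle_point q N x v \<in> cone ((C + 1) / a)"
proof -
  let ?s = "circle_point q N x v"
  have "norm (of_real N * ?s) \<le> norm (L q x) + norm (\<i> * of_real (N * offset N x v))"
    unfolding times_circle_point[OF assms(1)] by (rule norm_triangle_ineq)
  also have "\<dots> \<le> C + 1"
    unfolding norm_mult norm_of_real using assms(3,6) by simp
  finally show bound: "norm ?s \<le> (C + 1) / N"
    using assms(1) by (simp add: norm_mult field_simps)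
  have "C \<ge> 0" using assms(6) norm_ge_zero order_trans by blast
  note bound
  also have "(C + 1) / N = (C + 1) / a * (a / N)" using assms(4) by simp
  also have "\<dots> \<le> (C + 1) / a * (Re (L q x) / N)"
    using assms \<open>C \<ge> 0\<close> by (intro mult_left_mono divide_right_mono) auto
  finally show "?s \<in> cone ((C + 1) / a)"
    using assms by (simp add: cone_def circle_point_def mult.commute)
qed

lemma norm_expansion_error_le:
  obtains C1 where "C1 \<ge> 0"
    "\<And>N x v. N \<ge> 1 \<Longrightarrow> x \<in> X \<Longrightarrow> \<bar>N * offset N x v\<bar> \<le> 1 \<Longrightarrow>
      norm (expansion_error x (circle_point q N x v)) \<le> C1 / N"
proof -
  obtain a C0 where a: "a > 0" "\<And>x. x \<in> X \<Longrightarrow> a \<le> Re (L q x)"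
      and C0: "C0 > 0" "\<And>x. x \<in> X \<Longrightarrow> norm (L q x) \<le> C0"
    using L_bounds by blast
  obtain C where error: "\<And>x s. x \<in> X \<Longrightarrow> s \<in> cone ((C0 + 1) / a) \<Longrightarrow>
      norm (expansion_error x s) \<le> C * norm s"
    using expansion unfolding expansion_error_def by blast
  have "norm (expansion_error x (circle_point q N x v)) \<le> \<bar>C\<bar> * (C0 + 1) / N"
    if N: "N \<ge> 1" and x: "x \<in> X" and v: "\<bar>N * offset N x v\<bar> \<le> 1" for N x v
  proof -
    let ?s = "circle_point q N x v"
    have near: "norm ?s \<le> (C0 + 1) / N" "?s \<in> cone ((C0 + 1) / a)"
      using circle_point_near_saddle[OF _ x v a(1) a(2)[OF x] C0(2)[OF x]] N by auto
    have "norm (expansion_error x ?s) \<le> \<bar>C\<bar> * norm ?s"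
      by (rule order_trans[OF error[OF x near(2)]]) (intro mult_right_mono, auto)
    also have "\<dots> \<le> \<bar>C\<bar> * ((C0 + 1) / N)"
      using near(1) by (intro mult_left_mono) auto
    finally show ?thesis by simp
  qed
  thus ?thesis
    using that[of "\<bar>C\<bar> * (C0 + 1)"] C0(1) by auto
qed

lemma major_arc:
  obtains \<eta> A where "0 < \<eta>" "\<eta> \<le> 1" "0 \<le> A"
    "\<And>N x v. N \<ge> 1 \<Longrightarrow> x \<in> X \<Longrightarrow> \<bar>offset N x v\<bar> \<le> \<eta> / N \<Longrightarrow>
      norm (integrand N x v - peak N x * gaussian (3 / (2 * L q x)) (N ^ 2 * offset N x v))
      \<le> norm (peak N x) * (A / N) * (1 / (1 + (N ^ 2 * offset N x v) ^ 2))"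
proof -
  obtain a C0 where a: "a > 0" "\<And>x. x \<in> X \<Longrightarrow> a \<le> Re (L q x)"
      and C0: "C0 > 0" "\<And>x. x \<in> X \<Longrightarrow> norm (L q x) \<le> C0"
    using L_bounds by blast
  obtain C1 where "C1 \<ge> 0" and error: "\<And>N x v. N \<ge> 1 \<Longrightarrow> x \<in> X \<Longrightarrow> \<bar>N * offset N x v\<bar> \<le> 1 \<Longrightarrow>
      norm (expansion_error x (circle_point q N x v)) \<le> C1 / N"
    using norm_expansion_error_le by blast
  obtain \<eta> A where \<eta>: "0 < \<eta>" "\<eta> \<le> 1" "0 \<le> A" and major:
    "\<And>c R b N. a \<le> Re c \<Longrightarrow> norm c \<le> C0 \<Longrightarrow> N \<ge> 1 \<Longrightarrow> \<bar>b\<bar> \<le> \<eta> \<Longrightarrow> norm R \<le> C1 / N \<Longrightarrow>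
      norm (exp (of_real (N ^ 2) * saddle_exponent c b + R)
        - exp (of_real (N ^ 2) * (3 / 2 * c)) * gaussian (3 / (2 * c)) (N * b))
      \<le> norm (exp (of_real (N ^ 2) * (3 / 2 * c))) * (A / N) * (1 / (1 + (N * b) ^ 2))"
    using saddle_major_arc[OF a(1) C0(1) \<open>C1 \<ge> 0\<close>] by blast
  show ?thesis
  proof (rule that[OF \<eta>])
    fix N v :: real and x
    assume N: "N \<ge> 1" and x: "x \<in> X" and v: "\<bar>offset N x v\<bar> \<le> \<eta> / N"
    define b where "b = N * offset N x v"
    define R where "R = expansion_error x (circle_point q N x v)"
    have b: "\<bar>b\<bar> \<le> \<eta>"
      using v N by (simp add: b_def abs_mult pos_le_divide_eq mult.commute)
    hence R: "norm R \<le> C1 / N"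
      unfolding R_def using \<eta>(2) by (intro error N x) (simp add: b_def)
    have scaled: "N ^ 2 * offset N x v = N * b" by (simp add: b_def power2_eq_square)
    have integrand: "integrand N x v
        = exp (B x) * exp (of_real (N ^ 2) * saddle_exponent (L q x) b + R)"
      unfolding b_def R_def using N by (intro integrand_eq_saddle x) simp
    have "norm (exp (B x)) * norm (exp (of_real (N ^ 2) * saddle_exponent (L q x) b + R)
          - exp (of_real (N ^ 2) * (3 / 2 * L q x)) * gaussian (3 / (2 * L q x)) (N * b))
        \<le> norm (exp (B x)) * (norm (exp (of_real (N ^ 2) * (3 / 2 * L q x))) * (A / N)
          * (1 / (1 + (N * b) ^ 2)))"
      by (intro mult_left_mono major a(2) C0(2) x N b R) simp
    thus "norm (integrand N x v
        - peak N x * gaussian (3 / (2 * L q x)) (N ^ 2 * offset N x v))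
      \<le> norm (peak N x) * (A / N) * (1 / (1 + (N ^ 2 * offset N x v) ^ 2))"
      unfolding scaled integrand peak_def norm_mult[symmetric]
      by (simp only: right_diff_distrib mult.assoc norm_mult)
  qed
qed

lemma exp_minus_scaled_square_le:
  fixes \<delta> N :: real
  assumes "\<delta> > 0" "N \<ge> 1"
  shows "exp (- (\<delta> * N ^ 2)) \<le> 4 / \<delta> ^ 2 / N ^ 3"
proof -
  have "exp (- (\<delta> * N ^ 2)) = exp (- (\<delta> * N ^ 2 / 2)) ^ 2"
    by (simp add: exp_of_nat_mult[symmetric])
  also have "\<dots> \<le> (1 / (\<delta> * N ^ 2 / 2)) ^ 2"
    using assms by (intro power_mono exp_minus_le_inverse) auto
  also have "\<dots> = 4 / \<delta> ^ 2 / N ^ 4"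
    by (simp add: power_divide power_mult_distrib power_mult[symmetric])
  also have "\<dots> \<le> 4 / \<delta> ^ 2 / N ^ 3"
    using assms by (intro divide_left_mono power_increasing mult_pos_pos) auto
  finally show ?thesis .
qed

lemma norm_integrand_le:
  assumes "N > 0" and bound:
    "Re (log_gf x (\<epsilon> * exp (- circle_point q N x v))) \<le> (Re (L q x) / 2 - \<delta>) * N ^ 2"
  shows "norm (integrand N x v) \<le> norm (peak N x) * (exp (norm (B x)) * exp (- (\<delta> * N ^ 2)))"
proof -
  have "Re (of_real (N ^ 3) * circle_point q N x v) = Re (L q x) * N ^ 2"
    using assms(1) by (simp add: circle_point_def power2_eq_square power3_eq_cube)
  hence "norm (integrand N x v) \<le> exp ((Re (L q x) / 2 - \<delta>) * N ^ 2 + Re (L q x) * N ^ 2)"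
    unfolding integrand_def norm_exp_eq_Re plus_complex.sel(1) using bound by simp
  also have "\<dots> \<le> exp ((Re (B x) + N ^ 2 * (3 / 2 * Re (L q x))) + (norm (B x) - \<delta> * N ^ 2))"
    using abs_Re_le_cmod[of "B x"] by (simp add: algebra_simps)
  also have "\<dots> = norm (peak N x) * (exp (norm (B x)) * exp (- (\<delta> * N ^ 2)))"
    by (simp add: peak_def norm_mult exp_add[symmetric] power2_eq_square)
  finally show ?thesis .
qed

lemma minor_arc:
  assumes "\<eta> > 0"
  obtains A N0 where "0 \<le> A"
    "\<And>N x v. N \<ge> N0 \<Longrightarrow> N \<ge> 1 \<Longrightarrow> x \<in> X \<Longrightarrow> v \<in> {-pi..pi} \<Longrightarrow> \<bar>offset N x v\<bar> \<ge> \<eta> / N \<Longrightarrow>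
      norm (integrand N x v) \<le> norm (peak N x) * (A / N ^ 3)"
proof -
  obtain B0 where B0: "\<And>x. x \<in> X \<Longrightarrow> norm (B x) \<le> B0"
    using compact_continuous_norm_bounded[OF compact continuous_B] by blast
  obtain \<delta> N0 where \<delta>: "\<delta> > 0" and minor:
    "\<And>N x v. N \<ge> N0 \<Longrightarrow> x \<in> X \<Longrightarrow> v \<in> {-pi..pi} \<Longrightarrow> \<bar>N * v - Im (L q x)\<bar> \<ge> \<eta> \<Longrightarrow>
      Re (log_gf x (\<epsilon> * exp (- circle_point q N x v))) \<le> (Re (L q x) / 2 - \<delta>) * N ^ 2"
    using minor_arcs[OF assms] by blast
  show ?thesis
  proof (rule that)
    show "0 \<le> exp B0 * (4 / \<delta> ^ 2)" by simp
    fix N v :: real and x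
    assume N: "N \<ge> N0" "N \<ge> 1" and x: "x \<in> X" and v: "v \<in> {-pi..pi}"
      and far: "\<bar>offset N x v\<bar> \<ge> \<eta> / N"
    have "\<bar>N * v - Im (L q x)\<bar> \<ge> \<eta>"
      using far N(2) by (simp add: abs_times_offset pos_divide_le_eq mult.commute)
    hence "norm (integrand N x v) \<le> norm (peak N x) * (exp (norm (B x)) * exp (- (\<delta> * N ^ 2)))"
      using N by (intro norm_integrand_le minor x v) auto
    also have "\<dots> \<le> norm (peak N x) * (exp B0 * (4 / \<delta> ^ 2 / N ^ 3))"
      using B0[OF x] by (intro mult_left_mono mult_mono exp_minus_scaled_square_le \<delta> N) auto
    finally show "norm (integrand N x v) \<le> norm (peak N x) * (exp B0 * (4 / \<delta> ^ 2) / N ^ 3)"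
      by simp
  qed
qed

lemma norm_coefficient_minus_saddle_value_le:
  obtains K N0 where "\<And>n N x. n > 0 \<Longrightarrow> N ^ 3 = real n \<Longrightarrow> N \<ge> N0 \<Longrightarrow> N \<ge> 1 \<Longrightarrow> x \<in> X \<Longrightarrow>
    norm (2 * of_real pi * (\<epsilon> ^ n * Q n x) - saddle_value N x)
      \<le> norm (saddle_value N x) * (K / N)"
proof -
  obtain a C0 where a: "a > 0" "\<And>x. x \<in> X \<Longrightarrow> a \<le> Re (L q x)"
      and C0: "C0 > 0" "\<And>x. x \<in> X \<Longrightarrow> norm (L q x) \<le> C0"
    using L_bounds by blast
  obtain \<eta> A where \<eta>: "0 < \<eta>" "\<eta> \<le> 1" "0 \<le> A" and major:
    "\<And>N x v. N \<ge> 1 \<Longrightarrow> x \<in> X \<Longrightarrow> \<bar>offset N x v\<bar> \<le> \<eta> / N \<Longrightarrow>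
      norm (integrand N x v - peak N x * gaussian (3 / (2 * L q x)) (N ^ 2 * offset N x v))
      \<le> norm (peak N x) * (A / N) * (1 / (1 + (N ^ 2 * offset N x v) ^ 2))"
    using major_arc by blast
  obtain A' N0 where A': "0 \<le> A'" and minor:
    "\<And>N x v. N \<ge> N0 \<Longrightarrow> N \<ge> 1 \<Longrightarrow> x \<in> X \<Longrightarrow> v \<in> {-pi..pi} \<Longrightarrow> \<bar>offset N x v\<bar> \<ge> \<eta> / N \<Longrightarrow>
      norm (integrand N x v) \<le> norm (peak N x) * (A' / N ^ 3)"
    using minor_arc[OF \<eta>(1)] by blast
  show ?thesis
  proof (rule that)
    fix n :: nat and N :: real and x
    assume n: "n > 0" "N ^ 3 = real n" and N: "N \<ge> max N0 ((C0 + 1) / pi)" "N \<ge> 1" and x: "x \<in> X"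
    define w where "w = 3 / (2 * L q x)"
    have "Re w > 0"
      unfolding w_def by (rule Re_three_halves_div_pos[OF Re_L_pos[OF x]])
    have "\<bar>Im (L q x) / N\<bar> + \<eta> / N \<le> (C0 + 1) / N"
      using N(2) abs_Im_le_cmod[of "L q x"] C0(2)[OF x] \<eta>(2)
      by (simp add: add_divide_distrib[symmetric] divide_right_mono)
    also have "\<dots> \<le> pi" using N by (simp add: field_simps)
    finally have inside: "-pi \<le> Im (L q x) / N - \<eta> / N" "Im (L q x) / N + \<eta> / N \<le> pi"
      by linarith+
    have "norm (2 * of_real pi * (\<epsilon> ^ n * Q n x) - saddle_value N x) \<le> norm (saddle_value N x)
        * (norm (csqrt w) / sqrt pi * (A' * (2 * pi) + A * pi + 2 / (Re w * \<eta>)) / N)"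
      unfolding saddle_value_def w_def
      by (rule saddle_integral_relative_error[OF integrand_has_integral[OF x n(1) _ n(2)]
            _ _ _ _ _ _ _ major[OF N(2) x, unfolded offset_def]
            minor[OF _ N(2) x, unfolded offset_def]])
        (use inside N \<eta> A' \<open>Re w > 0\<close> in \<open>auto simp: w_def\<close>)
    also have "\<dots> \<le> norm (saddle_value N x) * (sqrt (3 / (2 * a)) / sqrt pi
        * (A' * (2 * pi) + A * pi + 2 / (3 * a / (2 * C0 ^ 2) * \<eta>)) / N)"
      unfolding w_def using saddle_error_constant_le[of a "L q x" C0 \<eta> A A'] a C0 x N \<eta> A'
      by (intro mult_left_mono divide_right_mono) auto
    finally show "norm (2 * of_real pi * (\<epsilon> ^ n * Q n x) - saddle_value N x)
      \<le> norm (saddle_value N x) * (sqrt (3 / (2 * a)) / sqrt pi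
        * (A' * (2 * pi) + A * pi + 2 / (3 * a / (2 * C0 ^ 2) * \<eta>)) / N)" .
  qed
qed

lemma main_term_eq_saddle_value:
  assumes "x \<in> X" "n > 0"
  shows "exp (B x) * saddle_main_term q n x
    = saddle_value (real n powr (1 / 3)) x / (2 * of_real pi)"
proof -
  define N where "N = real n powr (1 / 3)"
  have N: "N > 0" using assms(2) by (simp add: N_def)
  have "N ^ k = real n powr (real k / 3)" for k
    using powr_realpow[OF N, of k] by (simp add: N_def powr_powr)
  from this[of 4] this[of 2]
  have powers: "real n powr (4 / 3) = N ^ 4" "real n powr (2 / 3) = N ^ 2" by auto
  show ?thesis
    unfolding saddle_main_term_def saddle_value_def peak_def powers N_def[symmetric]
      csqrt_div_eq[OF Re_L_pos[OF assms(1)] N]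
    by (simp add: mult_ac del: csqrt.simps)
qed

theorem coefficients_uniformly_asymptotic:
  "uniformly_asymptotic X (\<lambda>n x. \<epsilon> ^ n * Q n x) (\<lambda>n x. exp (B x) * saddle_main_term q n x)"
proof -
  obtain K N0 where error: "\<And>n N x. n > 0 \<Longrightarrow> N ^ 3 = real n \<Longrightarrow> N \<ge> N0 \<Longrightarrow> N \<ge> 1 \<Longrightarrow> x \<in> X \<Longrightarrow>
      norm (2 * of_real pi * (\<epsilon> ^ n * Q n x) - saddle_value N x)
        \<le> norm (saddle_value N x) * (K / N)"
    using norm_coefficient_minus_saddle_value_le by metis
  show ?thesis
  proof (rule uniformly_asymptoticI)
    fix n x assume n: "n > 0" and large: "real n powr (1 / 3) \<ge> max N0 1" and x: "x \<in> X"
    define N where "N = real n powr (1 / 3)"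
    have "N ^ 3 = real n"
      using n powr_realpow[of N 3] by (simp add: N_def powr_powr)
    hence "norm (2 * of_real pi * (\<epsilon> ^ n * Q n x) - saddle_value N x) / (2 * pi)
        \<le> norm (saddle_value N x) * (K / N) / (2 * pi)"
      using large n x by (intro divide_right_mono error) (auto simp: N_def)
    moreover have "\<epsilon> ^ n * Q n x - saddle_value N x / (2 * of_real pi)
        = (2 * of_real pi * (\<epsilon> ^ n * Q n x) - saddle_value N x) / (2 * of_real pi)"
      by (simp add: diff_divide_distrib)
    ultimately show "norm (\<epsilon> ^ n * Q n x - exp (B x) * saddle_main_term q n x)
        \<le> norm (exp (B x) * saddle_main_term q n x) * (K / real n powr (1 / 3))"
      unfolding main_term_eq_saddle_value[OF x n] N_def[symmetric]
      by (simp add: norm_divide norm_mult mult.commute)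
  next
    fix n :: nat and x assume n: "n > 0" and x: "x \<in> X"
    have "L q x \<noteq> 0" using Re_L_pos[OF x] by auto
    thus "exp (B x) * saddle_main_term q n x \<noteq> 0"
      using n by (simp add: saddle_main_term_def del: csqrt.simps)
  qed
qed

end

lemma dominant_root_phase:
  assumes "compact X" "X \<subseteq> phase q" "\<And>x. x \<in> X \<Longrightarrow> trilog (x ^ q) \<notin> \<real>\<^sub>\<le>\<^sub>0"
    and "primitive_root q \<epsilon>" "\<And>w. primitive_root q w \<Longrightarrow> w = \<epsilon>"
  shows "dominant_root q \<epsilon> X"
proof
  have q: "q > 0" using assms(4) by (simp add: primitive_root_def)
  show less_1: "norm x < 1" if "x \<in> X" for x
    using phaseD(2) assms(2) that by blast
  show "continuous_on X (L q)"
    using less_1 assms(3) q by (intro continuous_on_L) (auto simp: less_imp_le)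
  show "norm (L q x) < 2 * Re (L q x)" if "x \<in> X" for x
    by (rule norm_L_less[OF assms(3)[OF that] q])
  show "Re (L k x) < Re (L q x)" if "x \<in> X" "k \<ge> 1" "k \<noteq> q" for x k
    using phaseD(3) assms(2) that by blast
qed (rule assms; assumption)+

lemma primitive_root_1_iff: "primitive_root 1 w \<longleftrightarrow> w = 1"
  by (metis one_dvd power_one power_one_right primitive_root_def zero_less_one)

lemma primitive_root_2_iff: "primitive_root 2 w \<longleftrightarrow> w = - 1"
proof
  assume "primitive_root 2 w"
  hence "w ^ 2 = 1" "w ^ 1 \<noteq> 1"
    by (metis primitive_root_def dvd_refl, metis primitive_root_def odd_one)
  thus "w = - 1" by (auto simp: power2_eq_1_iff)
qed (auto simp: primitive_root_def minus_one_power_iff)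

lemma one_minus_notin_nonpos_Reals: "norm (z :: complex) < 1 \<Longrightarrow> 1 - z \<notin> \<real>\<^sub>\<le>\<^sub>0"
  using abs_Re_le_cmod[of z] by (auto simp: complex_nonpos_Reals_iff)

lemma compact_subset_unit_ball:
  assumes "compact X" "\<And>x. x \<in> X \<Longrightarrow> norm x < (1::real)"
  shows "\<exists>r<1. \<forall>x\<in>X. norm x \<le> r"
proof -
  have "\<exists>a>0. \<forall>x\<in>X. a \<le> 1 - norm x"
    using assms by (intro compact_continuous_bounded_below_pos continuous_intros) auto
  then obtain a where "a > 0" "\<And>x. x \<in> X \<Longrightarrow> a \<le> 1 - norm x" by blast
  thus ?thesis by (intro exI[of _ "1 - a"]) force
qed

theorem Q_asymptotics_phase_1:
  assumes "compact X" "X \<subseteq> phase 1 - complex_of_real ` {xstar..0}"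
  shows "uniformly_asymptotic X Q (\<lambda>n x. (1 - x) powr (1 / 12) * saddle_main_term 1 n x)"
proof -
  interpret dominant_root 1 1 X
    using assms trilog_notin_nonpos_Reals_phase_1
    by (intro dominant_root_phase) (auto simp: primitive_root_1_iff simp del: One_nat_def)
  obtain r where r: "r < 1" "\<And>x. x \<in> X \<Longrightarrow> norm x \<le> r"
    using compact_subset_unit_ball[OF compact norm_less_1] by blast
  interpret dominant_saddle 1 1 X "\<lambda>x. Ln (1 - x) / 12"
  proof
    show "continuous_on X (\<lambda>x. Ln (1 - x) / 12)"
      using norm_less_1 one_minus_notin_nonpos_Reals by (intro continuous_intros) auto
    show "\<exists>C. \<forall>x\<in>X. \<forall>s\<in>cone M. norm (log_gf x (1 * exp (- s))
        - (L 1 x ^ 3 / (2 * s ^ 2) + Ln (1 - x) / 12)) \<le> C * norm s" for M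
      using log_gf_expansion_at_1[OF r(1) r(2)] by blast
  qed
  have "exp (Ln (1 - x) / 12) = (1 - x) powr (1 / 12)" if "x \<in> X" for x
    using one_minus_notin_nonpos_Reals[OF norm_less_1[OF that]] by (auto simp: powr_def)
  thus ?thesis
    using uniformly_asymptotic_cong_right[OF coefficients_uniformly_asymptotic] by simp
qed

theorem Q_asymptotics_phase_2:
  assumes "compact X" "X \<subseteq> phase 2"
  shows "uniformly_asymptotic X Q (\<lambda>n x. (- 1) ^ n
    * ((1 - x ^ 2) powr (1 / 24) * ((1 - x) / (1 + x)) powr (1 / 8) * saddle_main_term 2 n x))"
proof -
  define B where "B x = Ln (1 - x ^ 2) / 24 + Ln ((1 - x) / (1 + x)) / 8" for x
  interpret dominant_root 2 "- 1" X
    using assms trilog_notin_nonpos_Reals_phase_2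
    by (intro dominant_root_phase) (auto simp: primitive_root_2_iff)
  have notin: "1 - x \<notin> \<real>\<^sub>\<le>\<^sub>0" "1 + x \<notin> \<real>\<^sub>\<le>\<^sub>0" "1 - x ^ 2 \<notin> \<real>\<^sub>\<le>\<^sub>0" if "x \<in> X" for x
    using norm_less_1[OF that] one_minus_notin_nonpos_Reals[of x]
      one_minus_notin_nonpos_Reals[of "- x"] one_minus_notin_nonpos_Reals[of "x ^ 2"]
    by (auto simp: norm_power power_less_one_iff)
  obtain r where r: "r < 1" "\<And>x. x \<in> X \<Longrightarrow> norm x \<le> r"
    using compact_subset_unit_ball[OF compact norm_less_1] by blast
  interpret dominant_saddle 2 "- 1" X B
  proof
    have "B x = Ln (1 - x ^ 2) / 24 + (2 * Ln (1 - x) - Ln (1 - x ^ 2)) / 8" if "x \<in> X" for x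
      by (simp add: B_def Ln_one_minus_div_one_plus[OF norm_less_1[OF that]])
    moreover have "continuous_on X
        (\<lambda>x. Ln (1 - x ^ 2) / 24 + (2 * Ln (1 - x) - Ln (1 - x ^ 2)) / 8)"
      using notin by (intro continuous_intros) auto
    ultimately show "continuous_on X B" by (simp cong: continuous_on_cong)
    show "\<exists>C. \<forall>x\<in>X. \<forall>s\<in>cone M.
        norm (log_gf x (- 1 * exp (- s)) - (L 2 x ^ 3 / (2 * s ^ 2) + B x)) \<le> C * norm s" for M
      unfolding B_def using log_gf_expansion_at_minus_1[OF r(1) r(2)] by blast
  qed
  have "exp (B x) = (1 - x ^ 2) powr (1 / 24) * ((1 - x) / (1 + x)) powr (1 / 8)" if "x \<in> X" for x
    using notin[OF that] by (auto simp: B_def powr_def exp_add)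
  hence "uniformly_asymptotic X (\<lambda>n x. (- 1) ^ n * Q n x)
      (\<lambda>n x. (1 - x ^ 2) powr (1 / 24) * ((1 - x) / (1 + x)) powr (1 / 8) * saddle_main_term 2 n x)"
    using uniformly_asymptotic_cong_right[OF coefficients_uniformly_asymptotic] by simp
  from uniformly_asymptotic_mult_left[OF this, of "\<lambda>n. (- 1) ^ n"]
  show ?thesis
    by (simp add: mult.assoc[symmetric] power_mult_distrib[symmetric])
qed

theorem theorem2:
  shows "(\<forall>X :: complex set. compact X \<and> X \<subseteq> phase 1 - complex_of_real ` {xstar..0} \<longrightarrow>
           (\<exists>(C :: real) (E :: nat \<Rightarrow> complex \<Rightarrow> complex).
              \<forall>\<^sub>F n in sequentially. \<forall>x \<in> X.
                Q n x = (1 - x) powr (1 / 12)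
                        * csqrt (L 1 x / of_real (6 * pi * real n powr (4 / 3)))
                        * exp (3 / 2 * of_real (real n powr (2 / 3)) * L 1 x)
                        * (1 + E n x) \<and>
                norm (E n x) \<le> C * real n powr (- 1 / 3)))
       \<and> (\<forall>X :: complex set. compact X \<and> X \<subseteq> phase 2 \<longrightarrow>
           (\<exists>(C :: real) (E :: nat \<Rightarrow> complex \<Rightarrow> complex).
              \<forall>\<^sub>F n in sequentially. \<forall>x \<in> X.
                Q n x = (- 1) ^ n
                        * (1 - x ^ 2) powr (1 / 24)
                        * ((1 - x) / (1 + x)) powr (1 / 8)
                        * csqrt (L 2 x / of_real (6 * pi * real n powr (4 / 3)))
                        * exp (3 / 2 * of_real (real n powr (2 / 3)) * L 2 x)
                        * (1 + E n x) \<and>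
                norm (E n x) \<le> C * real n powr (- 1 / 3)))"
proof (intro conjI allI impI, goal_cases phase_1 phase_2)
  case (phase_1 X)
  with Q_asymptotics_phase_1[of X] show ?case
    by (simp only: uniformly_asymptotic_def saddle_main_term_def mult.assoc)
next
  case (phase_2 X)
  with Q_asymptotics_phase_2[of X] show ?case
    by (simp only: uniformly_asymptotic_def saddle_main_term_def mult.assoc)
qed

end
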